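(* Let $G=\mathbf{C}_q[SU_N]$, and let $\Omega^1_{\mathrm{bc},q}(SU_N)$ be the canonical bicovariant calculus over $G$, identified with $G\otimes\Lambda^1_{\mathrm{bc},q,SU_N}$. Then there is a well-defined quotient calculus $$\Omega^1_q(SU_N)=\Omega^1_{\mathrm{bc},q}(SU_N)/s(G\otimes V_D).$$ Its corresponding right ideal of $G^+$ is $I_{SU_N}=\ker(Q)^++D_1+D_2$, where $D_1=\mathrm{span}_{\mathbf{C}}\{u^i_1S(u^1_i):i=2,\dots,N\}$ and $D_2=\mathrm{span}_{\mathbf{C}}\{u^i_j:i,j=2,\dots,N;\ i\ne j\}$. Moreover, the elements $$e^+_i=\overline{u^{i+1}_1},\qquad e^0=\overline{u^1_1-1},\qquad e^-_i=\overline{u^1_{i+1}}\qquad(i=1,\dots,N-1)$$ form a $(2N-1)$-dimensional left-module basis of $\Omega^1_q(SU_N)$.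
   Context: Algebras are unital over $\mathbf{C}$; Sweedler notation is used. Fix $N\ge2$, $q\in(0,1]$, $\nu=q-q^{-1}$, and an $N$-th root $q^{1/N}$ of $q$. Let $H(x)=1$ for $x>0$ and $H(x)=0$ for $x\le0$, and $R^{ik}_{jl}=q^{\delta_{ik}}\delta_{il}\delta_{kj}+\nu H(k-i)\delta_{ij}\delta_{kl}$. $\mathbf{C}_q[M_N]$ is the bialgebra generated by $u^i_j$ ($1\le i,j\le N$) with relations $\sum_{w,x}R^{ac}_{wx}u^w_bu^x_d=\sum_{y,z}R^{yz}_{bd}u^a_yu^c_z$, $\Delta(u^i_j)=\sum_k u^i_k\otimes u^k_j$, $\varepsilon(u^i_j)=\delta_{ij}$; $\det_N=\sum_{\pi\in S_N}(-q)^{\ell(\pi)}u^1_{\pi(1)}\cdots u^N_{\pi(N)}$ is central and grouplike, and $G=\mathbf{C}_q[SU_N]$ is the Hopf algebra $\mathbf{C}_q[M_N]/\langle\det_N-1\rangle$, with antipode $S$ and $G^+=\ker\varepsilon$. $G$ is coquasi-triangular with $r:G\otimes G\to\mathbf{C}$ determined by $r(u^i_j\otimes u^k_l)=q^{-1/N}R^{ki}_{jl}$, $r(fg\otimes h)=r(f\otimes h_{(1)})r(g\otimes h_{(2)})$, $r(f\otimes gh)=r(f_{(1)}\otimes h)r(f_{(2)}\otimes g)$. The quantum Killing representation $Q:G\to M_N(\mathbf{C})$ is $Q_{kl}(h)=\mathcal{Q}(h\otimes u^k_l)$, $\mathcal{Q}(h\otimes g)=r(g_{(1)}\otimes h_{(1)})r(h_{(2)}\otimes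 g_{(2)})$; $\ker(Q)^+=\ker Q\cap G^+$ is an $\mathrm{Ad}_R$-stable right ideal of $G^+$, where $\mathrm{Ad}_R(h)=h_{(2)}\otimes S(h_{(1)})h_{(3)}$. Left-covariant first-order calculi over $G$ correspond bijectively to right ideals $I\subseteq G^+$: the calculus of $I$ is $\Omega^1_u(G)/s(G\otimes I)$, where $\Omega^1_u(G)=\ker(m:G\otimes G\to G)$, $s(a\otimes b)=aS(b_{(1)})\otimes b_{(2)}$. The map $s$ descends to an isomorphism, again written $s$, from $G\otimes(G^+/I)$ to this calculus, and the two are identified, with left multiplication on the first factor, right action $(g\otimes\overline{v})h=gh_{(1)}\otimes\overline{vh_{(2)}}$ and $\mathrm{d}h=h_{(1)}\otimes\overline{h_{(2)}-\varepsilon(h_{(2)})1}$. An element $\overline v\in G^+/I$ is regarded as the form $1\otimes\overline v$. The canonical bicovariant calculus $\Omega^1_{\mathrm{bc},q}(SU_N)$ is the one with ideal $\ker(Q)^+$, and $\Lambda^1_{\mathrm{bc},q,SU_N}=G^+/\ker(Q)^+$, with $V_D=\mathrm{span}\{\overline{u^i_j}:2\le i,j\le N,\ i\ne j\}+\mathrm{span}\{\overline{u^i_1S(u^1_i)}:2\le i\le N\}\subseteq\Lambda^1_{\mathrm{bc},q,SU_N}$.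
   Formalization: The basis claim is stated only for q ≠ 1; for q = 1 (allowed by the setting) it is false, since then Q(u^2_1) = 0, so e^+_1 = 0. The quotient calculus and its right ideal are treated for all q in (0,1]. *)

theory Defs
  imports Complex_Main
    "HOL-Algebra.QuotRing" "HOL-Algebra.Module" "HOL-Algebra.Generated_Groups"
    "HOL-Combinatorics.Permutations" "HOL-Library.Poly_Mapping"
begin

hide_const (open) Multiset.mult

section \<open>Complex vector spaces and algebras\<close>

text \<open>Complex vector spaces and (noncommutative) complex algebras are HOL-Algebra \<^typ>\<open>(complex, 'a) module\<close>
  records. For a mere vector space the fields \<^const>\<open>mult\<close> and \<^const>\<open>one\<close> carry no information.
  The record \<open>complex_alg\<close> is the field of complex numbers, serving as ground ring and as an
  algebra over itself.\<close>

definition complex_alg :: "(complex, complex) module" where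
  "complex_alg = \<lparr>carrier = UNIV, mult = (*), one = 1, zero = 0, add = (+), smult = (*)\<rparr>"

definition complex_algebra :: "(complex, 'a) module \<Rightarrow> bool" where
  "complex_algebra A \<longleftrightarrow> ring A \<and> module complex_alg A \<and>
     (\<forall>c. \<forall>x\<in>carrier A. \<forall>y\<in>carrier A.
        (c \<odot>\<^bsub>A\<^esub> x) \<otimes>\<^bsub>A\<^esub> y = c \<odot>\<^bsub>A\<^esub> (x \<otimes>\<^bsub>A\<^esub> y) \<and> x \<otimes>\<^bsub>A\<^esub> (c \<odot>\<^bsub>A\<^esub> y) = c \<odot>\<^bsub>A\<^esub> (x \<otimes>\<^bsub>A\<^esub> y))"

definition clinear :: "(complex, 'a) module \<Rightarrow> (complex, 'b) module \<Rightarrow> ('a \<Rightarrow> 'b) \<Rightarrow> bool" where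
  "clinear V W f \<longleftrightarrow> f \<in> carrier V \<rightarrow> carrier W \<and>
     (\<forall>x\<in>carrier V. \<forall>y\<in>carrier V. f (x \<oplus>\<^bsub>V\<^esub> y) = f x \<oplus>\<^bsub>W\<^esub> f y) \<and>
     (\<forall>c. \<forall>x\<in>carrier V. f (c \<odot>\<^bsub>V\<^esub> x) = c \<odot>\<^bsub>W\<^esub> f x)"

definition cspan :: "(complex, 'a) module \<Rightarrow> 'a set \<Rightarrow> 'a set" where
  "cspan V X = \<Inter>{W. submodule W complex_alg V \<and> X \<subseteq> W}"

text \<open>The quotient \<open>A Quot I\<close> of the library with its induced scalar multiplication. If \<open>I\<close> is only
  a linear subspace, this is the quotient vector space.\<close>

definition quotient_alg :: "(complex, 'a) module \<Rightarrow> 'a set \<Rightarrow> (complex, 'a set) module" where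
  "quotient_alg A I =
     ring.extend (A Quot I) (module.fields (\<lambda>c X. \<Union>x\<in>X. I +>\<^bsub>A\<^esub> (c \<odot>\<^bsub>A\<^esub> x)))"

definition monoid_alg :: "('a, 'm) monoid_scheme \<Rightarrow> (complex, 'a \<Rightarrow>\<^sub>0 complex) module" where
  "monoid_alg M =
     \<lparr>carrier = {f. Poly_Mapping.keys f \<subseteq> carrier M},
      mult = (\<lambda>f g. \<Sum>x\<in>Poly_Mapping.keys f. \<Sum>y\<in>Poly_Mapping.keys g.
        Poly_Mapping.single (x \<otimes>\<^bsub>M\<^esub> y) (Poly_Mapping.lookup f x * Poly_Mapping.lookup g y)),
      one = Poly_Mapping.single \<one>\<^bsub>M\<^esub> 1,
      zero = 0,
      add = (+),
      smult = (\<lambda>c. Poly_Mapping.map ((*) c))\<rparr>"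


section \<open>Tensor products\<close>

text \<open>\<open>A \<otimes> B\<close> is the free vector space on \<open>carrier A \<times> carrier B\<close> modulo the bilinearity relations.
  Its product \<open>(a \<otimes> b)(a' \<otimes> b') = aa' \<otimes> bb'\<close> is inherited from the monoid algebra of \<open>A \<times>\<times> B\<close>
  and is meaningful when \<open>A\<close> and \<open>B\<close> are algebras.\<close>

definition bilinear_rels ::
  "(complex, 'a) module \<Rightarrow> (complex, 'b) module \<Rightarrow> ('a \<times> 'b \<Rightarrow>\<^sub>0 complex) set" where
  "bilinear_rels A B = cspan (monoid_alg (A \<times>\<times> B))
     ({Poly_Mapping.single (a \<oplus>\<^bsub>A\<^esub> a', b) 1 - Poly_Mapping.single (a, b) 1 - Poly_Mapping.single (a', b) 1 |
         a a' b. a \<in> carrier A \<and> a' \<in> carrier A \<and> b \<in> carrier B} \<union>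
      {Poly_Mapping.single (a, b \<oplus>\<^bsub>B\<^esub> b') 1 - Poly_Mapping.single (a, b) 1 - Poly_Mapping.single (a, b') 1 |
         a b b'. a \<in> carrier A \<and> b \<in> carrier B \<and> b' \<in> carrier B} \<union>
      {Poly_Mapping.single (c \<odot>\<^bsub>A\<^esub> a, b) 1 - Poly_Mapping.single (a, b) c |
         c a b. a \<in> carrier A \<and> b \<in> carrier B} \<union>
      {Poly_Mapping.single (a, c \<odot>\<^bsub>B\<^esub> b) 1 - Poly_Mapping.single (a, b) c |
         c a b. a \<in> carrier A \<and> b \<in> carrier B})"

definition tensor ::
  "(complex, 'a) module \<Rightarrow> (complex, 'b) module \<Rightarrow> (complex, ('a \<times> 'b \<Rightarrow>\<^sub>0 complex) set) module" where
  "tensor A B = quotient_alg (monoid_alg (A \<times>\<times> B)) (bilinear_rels A B)"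

definition tens ::
  "(complex, 'a) module \<Rightarrow> (complex, 'b) module \<Rightarrow> 'a \<Rightarrow> 'b \<Rightarrow> ('a \<times> 'b \<Rightarrow>\<^sub>0 complex) set" where
  "tens A B a b = bilinear_rels A B +>\<^bsub>monoid_alg (A \<times>\<times> B)\<^esub> Poly_Mapping.single (a, b) 1"

text \<open>For subsets \<open>U\<close> and \<open>V\<close> of \<open>A\<close> and \<open>B\<close> that are subspaces, \<open>tensor_sub A B U V\<close> is
  \<open>U \<otimes> V\<close> as a subspace of \<open>A \<otimes> B\<close>.\<close>

definition tensor_sub ::
  "(complex, 'a) module \<Rightarrow> (complex, 'b) module \<Rightarrow> 'a set \<Rightarrow> 'b set \<Rightarrow> ('a \<times> 'b \<Rightarrow>\<^sub>0 complex) set set" where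
  "tensor_sub A B U V = cspan (tensor A B) {tens A B a b | a b. a \<in> U \<and> b \<in> V}"

text \<open>The linear map on a tensor product sending \<open>a \<otimes> b\<close> to \<open>\<beta> a b\<close>. The chosen representative
  does not matter when \<open>\<beta>\<close> is bilinear, and it is only used in that case.\<close>

definition tlift ::
  "(complex, 'c) module \<Rightarrow> ('a \<Rightarrow> 'b \<Rightarrow> 'c) \<Rightarrow> ('a \<times> 'b \<Rightarrow>\<^sub>0 complex) set \<Rightarrow> 'c" where
  "tlift W \<beta> X = (let f = (SOME f. f \<in> X) in
     \<Oplus>\<^bsub>W\<^esub>p\<in>Poly_Mapping.keys f. Poly_Mapping.lookup f p \<odot>\<^bsub>W\<^esub> \<beta> (fst p) (snd p))"


section \<open>Hopf algebras and coquasi-triangular structures\<close>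

text \<open>Sweedler notation: \<open>tlift W \<beta> (\<Delta> h)\<close> is \<open>\<beta> h\<^sub>(\<^sub>1\<^sub>) h\<^sub>(\<^sub>2\<^sub>)\<close>.\<close>

definition hopf_algebra ::
  "(complex, 'a) module \<Rightarrow> ('a \<Rightarrow> ('a \<times> 'a \<Rightarrow>\<^sub>0 complex) set) \<Rightarrow> ('a \<Rightarrow> complex) \<Rightarrow> ('a \<Rightarrow> 'a) \<Rightarrow> bool" where
  "hopf_algebra A \<Delta> \<epsilon> S \<longleftrightarrow>
     complex_algebra A \<and>
     \<Delta> \<in> ring_hom A (tensor A A) \<and> clinear A (tensor A A) \<Delta> \<and>
     \<epsilon> \<in> ring_hom A complex_alg \<and> clinear A complex_alg \<epsilon> \<and>
     clinear A A S \<and>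
     (\<forall>h\<in>carrier A.
        (let T = tensor A (tensor A A) in
          tlift T (\<lambda>a b. tlift T (\<lambda>a\<^sub>1 a\<^sub>2. tens A (tensor A A) a\<^sub>1 (tens A A a\<^sub>2 b)) (\<Delta> a)) (\<Delta> h)
            = tlift T (\<lambda>a b. tens A (tensor A A) a (\<Delta> b)) (\<Delta> h)) \<and>
        tlift A (\<lambda>a b. \<epsilon> a \<odot>\<^bsub>A\<^esub> b) (\<Delta> h) = h \<and>
        tlift A (\<lambda>a b. \<epsilon> b \<odot>\<^bsub>A\<^esub> a) (\<Delta> h) = h \<and>
        tlift A (\<lambda>a b. S a \<otimes>\<^bsub>A\<^esub> b) (\<Delta> h) = \<epsilon> h \<odot>\<^bsub>A\<^esub> \<one>\<^bsub>A\<^esub> \<and>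
        tlift A (\<lambda>a b. a \<otimes>\<^bsub>A\<^esub> S b) (\<Delta> h) = \<epsilon> h \<odot>\<^bsub>A\<^esub> \<one>\<^bsub>A\<^esub>)"

definition bilinear_form :: "(complex, 'a) module \<Rightarrow> ('a \<Rightarrow> 'a \<Rightarrow> complex) \<Rightarrow> bool" where
  "bilinear_form A r \<longleftrightarrow> (\<forall>f\<in>carrier A. clinear A complex_alg (r f)) \<and>
     (\<forall>g\<in>carrier A. clinear A complex_alg (\<lambda>f. r f g))"

text \<open>Linear functionals on \<open>A \<otimes> A\<close> are given as bilinear forms on \<open>A\<close>. The conditions are:
  convolution invertibility, \<open>r(fg \<otimes> h) = r(f \<otimes> h\<^sub>(\<^sub>1\<^sub>)) r(g \<otimes> h\<^sub>(\<^sub>2\<^sub>))\<close>,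
  \<open>r(f \<otimes> gh) = r(f\<^sub>(\<^sub>1\<^sub>) \<otimes> h) r(f\<^sub>(\<^sub>2\<^sub>) \<otimes> g)\<close>, and
  \<open>g\<^sub>(\<^sub>1\<^sub>) h\<^sub>(\<^sub>1\<^sub>) r(h\<^sub>(\<^sub>2\<^sub>) \<otimes> g\<^sub>(\<^sub>2\<^sub>)) = r(h\<^sub>(\<^sub>1\<^sub>) \<otimes> g\<^sub>(\<^sub>1\<^sub>)) h\<^sub>(\<^sub>2\<^sub>) g\<^sub>(\<^sub>2\<^sub>)\<close>.\<close>

definition coquasitriangular ::
  "(complex, 'a) module \<Rightarrow> ('a \<Rightarrow> ('a \<times> 'a \<Rightarrow>\<^sub>0 complex) set) \<Rightarrow> ('a \<Rightarrow> complex)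
     \<Rightarrow> ('a \<Rightarrow> 'a \<Rightarrow> complex) \<Rightarrow> bool" where
  "coquasitriangular A \<Delta> \<epsilon> r \<longleftrightarrow>
     bilinear_form A r \<and>
     (\<exists>r'. bilinear_form A r' \<and> (\<forall>f\<in>carrier A. \<forall>g\<in>carrier A.
        tlift complex_alg (\<lambda>f\<^sub>1 f\<^sub>2. tlift complex_alg (\<lambda>g\<^sub>1 g\<^sub>2. r f\<^sub>1 g\<^sub>1 * r' f\<^sub>2 g\<^sub>2) (\<Delta> g)) (\<Delta> f) = \<epsilon> f * \<epsilon> g \<and>
        tlift complex_alg (\<lambda>f\<^sub>1 f\<^sub>2. tlift complex_alg (\<lambda>g\<^sub>1 g\<^sub>2. r' f\<^sub>1 g\<^sub>1 * r f\<^sub>2 g\<^sub>2) (\<Delta> g)) (\<Delta> f) = \<epsilon> f * \<epsilon> g)) \<and>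
     (\<forall>f\<in>carrier A. \<forall>g\<in>carrier A. \<forall>h\<in>carrier A.
        r (f \<otimes>\<^bsub>A\<^esub> g) h = tlift complex_alg (\<lambda>h\<^sub>1 h\<^sub>2. r f h\<^sub>1 * r g h\<^sub>2) (\<Delta> h) \<and>
        r f (g \<otimes>\<^bsub>A\<^esub> h) = tlift complex_alg (\<lambda>f\<^sub>1 f\<^sub>2. r f\<^sub>1 h * r f\<^sub>2 g) (\<Delta> f)) \<and>
     (\<forall>g\<in>carrier A. \<forall>h\<in>carrier A.
        tlift A (\<lambda>h\<^sub>1 h\<^sub>2. tlift A (\<lambda>g\<^sub>1 g\<^sub>2. r h\<^sub>2 g\<^sub>2 \<odot>\<^bsub>A\<^esub> (g\<^sub>1 \<otimes>\<^bsub>A\<^esub> h\<^sub>1)) (\<Delta> g)) (\<Delta> h) =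
        tlift A (\<lambda>h\<^sub>1 h\<^sub>2. tlift A (\<lambda>g\<^sub>1 g\<^sub>2. r h\<^sub>1 g\<^sub>1 \<odot>\<^bsub>A\<^esub> (h\<^sub>2 \<otimes>\<^bsub>A\<^esub> g\<^sub>2)) (\<Delta> g)) (\<Delta> h))"

definition aug_ideal :: "(complex, 'a) module \<Rightarrow> ('a \<Rightarrow> complex) \<Rightarrow> 'a set" where
  "aug_ideal A \<epsilon> = {h \<in> carrier A. \<epsilon> h = 0}"

text \<open>\<open>\<Q>(h \<otimes> g) = r(g\<^sub>(\<^sub>1\<^sub>) \<otimes> h\<^sub>(\<^sub>1\<^sub>)) r(h\<^sub>(\<^sub>2\<^sub>) \<otimes> g\<^sub>(\<^sub>2\<^sub>))\<close>\<close>

definition killing_form ::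
  "('a \<Rightarrow> ('a \<times> 'a \<Rightarrow>\<^sub>0 complex) set) \<Rightarrow> ('a \<Rightarrow> 'a \<Rightarrow> complex) \<Rightarrow> 'a \<Rightarrow> 'a \<Rightarrow> complex" where
  "killing_form \<Delta> r h g =
     tlift complex_alg (\<lambda>h\<^sub>1 h\<^sub>2. tlift complex_alg (\<lambda>g\<^sub>1 g\<^sub>2. r g\<^sub>1 h\<^sub>1 * r h\<^sub>2 g\<^sub>2) (\<Delta> g)) (\<Delta> h)"


section \<open>First-order differential calculi\<close>

text \<open>An \<open>A\<close>-bimodule with a differential. The inherited \<^const>\<open>smult\<close> is the left action of \<open>A\<close>.\<close>

record ('a, 'm) fodc = "('a, 'm) module" +
  rsmult :: "['m, 'a] \<Rightarrow> 'm"
  diff :: "'a \<Rightarrow> 'm"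

definition first_order_calculus :: "(complex, 'a) module \<Rightarrow> ('a, 'm) fodc \<Rightarrow> bool" where
  "first_order_calculus A \<Gamma> \<longleftrightarrow>
     abelian_group \<Gamma> \<and>
     (\<forall>a\<in>carrier A. \<forall>m\<in>carrier \<Gamma>. a \<odot>\<^bsub>\<Gamma>\<^esub> m \<in> carrier \<Gamma> \<and> rsmult \<Gamma> m a \<in> carrier \<Gamma>) \<and>
     (\<forall>a\<in>carrier A. \<forall>m\<in>carrier \<Gamma>. \<forall>n\<in>carrier \<Gamma>.
        a \<odot>\<^bsub>\<Gamma>\<^esub> (m \<oplus>\<^bsub>\<Gamma>\<^esub> n) = a \<odot>\<^bsub>\<Gamma>\<^esub> m \<oplus>\<^bsub>\<Gamma>\<^esub> a \<odot>\<^bsub>\<Gamma>\<^esub> n \<and>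
        rsmult \<Gamma> (m \<oplus>\<^bsub>\<Gamma>\<^esub> n) a = rsmult \<Gamma> m a \<oplus>\<^bsub>\<Gamma>\<^esub> rsmult \<Gamma> n a) \<and>
     (\<forall>a\<in>carrier A. \<forall>b\<in>carrier A. \<forall>m\<in>carrier \<Gamma>.
        (a \<oplus>\<^bsub>A\<^esub> b) \<odot>\<^bsub>\<Gamma>\<^esub> m = a \<odot>\<^bsub>\<Gamma>\<^esub> m \<oplus>\<^bsub>\<Gamma>\<^esub> b \<odot>\<^bsub>\<Gamma>\<^esub> m \<and>
        rsmult \<Gamma> m (a \<oplus>\<^bsub>A\<^esub> b) = rsmult \<Gamma> m a \<oplus>\<^bsub>\<Gamma>\<^esub> rsmult \<Gamma> m b \<and>
        (a \<otimes>\<^bsub>A\<^esub> b) \<odot>\<^bsub>\<Gamma>\<^esub> m = a \<odot>\<^bsub>\<Gamma>\<^esub> (b \<odot>\<^bsub>\<Gamma>\<^esub> m) \<and>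
        rsmult \<Gamma> m (a \<otimes>\<^bsub>A\<^esub> b) = rsmult \<Gamma> (rsmult \<Gamma> m a) b \<and>
        rsmult \<Gamma> (a \<odot>\<^bsub>\<Gamma>\<^esub> m) b = a \<odot>\<^bsub>\<Gamma>\<^esub> rsmult \<Gamma> m b) \<and>
     (\<forall>m\<in>carrier \<Gamma>. \<one>\<^bsub>A\<^esub> \<odot>\<^bsub>\<Gamma>\<^esub> m = m \<and> rsmult \<Gamma> m \<one>\<^bsub>A\<^esub> = m) \<and>
     (\<forall>c. \<forall>m\<in>carrier \<Gamma>. (c \<odot>\<^bsub>A\<^esub> \<one>\<^bsub>A\<^esub>) \<odot>\<^bsub>\<Gamma>\<^esub> m = rsmult \<Gamma> m (c \<odot>\<^bsub>A\<^esub> \<one>\<^bsub>A\<^esub>)) \<and>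
     diff \<Gamma> \<in> carrier A \<rightarrow> carrier \<Gamma> \<and>
     (\<forall>a\<in>carrier A. \<forall>b\<in>carrier A.
        diff \<Gamma> (a \<oplus>\<^bsub>A\<^esub> b) = diff \<Gamma> a \<oplus>\<^bsub>\<Gamma>\<^esub> diff \<Gamma> b \<and>
        diff \<Gamma> (a \<otimes>\<^bsub>A\<^esub> b) = rsmult \<Gamma> (diff \<Gamma> a) b \<oplus>\<^bsub>\<Gamma>\<^esub> a \<odot>\<^bsub>\<Gamma>\<^esub> diff \<Gamma> b) \<and>
     (\<forall>c. \<forall>a\<in>carrier A. diff \<Gamma> (c \<odot>\<^bsub>A\<^esub> a) = (c \<odot>\<^bsub>A\<^esub> \<one>\<^bsub>A\<^esub>) \<odot>\<^bsub>\<Gamma>\<^esub> diff \<Gamma> a) \<and>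
     carrier \<Gamma> = generate (add_monoid \<Gamma>) {a \<odot>\<^bsub>\<Gamma>\<^esub> diff \<Gamma> b | a b. a \<in> carrier A \<and> b \<in> carrier A}"

definition subbimodule :: "(complex, 'a) module \<Rightarrow> ('a, 'm) fodc \<Rightarrow> 'm set \<Rightarrow> bool" where
  "subbimodule A \<Gamma> W \<longleftrightarrow> subgroup W (add_monoid \<Gamma>) \<and>
     (\<forall>a\<in>carrier A. \<forall>w\<in>W. a \<odot>\<^bsub>\<Gamma>\<^esub> w \<in> W \<and> rsmult \<Gamma> w a \<in> W)"

definition quotient_calculus :: "('a, 'm) fodc \<Rightarrow> 'm set \<Rightarrow> ('a, 'm set) fodc" where
  "quotient_calculus \<Gamma> W =
     \<lparr>carrier = a_rcosets\<^bsub>\<Gamma>\<^esub> W, mult = undefined, one = undefined, zero = W, add = set_add \<Gamma>,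
      smult = (\<lambda>a X. \<Union>x\<in>X. W +>\<^bsub>\<Gamma>\<^esub> (a \<odot>\<^bsub>\<Gamma>\<^esub> x)),
      rsmult = (\<lambda>X a. \<Union>x\<in>X. W +>\<^bsub>\<Gamma>\<^esub> rsmult \<Gamma> x a),
      diff = (\<lambda>h. W +>\<^bsub>\<Gamma>\<^esub> diff \<Gamma> h)\<rparr>"

definition calculus_isomorphic ::
  "(complex, 'a) module \<Rightarrow> ('a, 'm) fodc \<Rightarrow> ('a, 'n) fodc \<Rightarrow> bool" where
  "calculus_isomorphic A \<Gamma> \<Gamma>' \<longleftrightarrow>
     (\<exists>\<phi>. bij_betw \<phi> (carrier \<Gamma>) (carrier \<Gamma>') \<and>
        (\<forall>m\<in>carrier \<Gamma>. \<forall>n\<in>carrier \<Gamma>. \<phi> (m \<oplus>\<^bsub>\<Gamma>\<^esub> n) = \<phi> m \<oplus>\<^bsub>\<Gamma>'\<^esub> \<phi> n) \<and>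
        (\<forall>a\<in>carrier A. \<forall>m\<in>carrier \<Gamma>.
           \<phi> (a \<odot>\<^bsub>\<Gamma>\<^esub> m) = a \<odot>\<^bsub>\<Gamma>'\<^esub> \<phi> m \<and> \<phi> (rsmult \<Gamma> m a) = rsmult \<Gamma>' (\<phi> m) a) \<and>
        (\<forall>h\<in>carrier A. \<phi> (diff \<Gamma> h) = diff \<Gamma>' h))"

definition left_module_basis :: "(complex, 'a) module \<Rightarrow> ('a, 'm) fodc \<Rightarrow> 'm set \<Rightarrow> bool" where
  "left_module_basis A \<Gamma> B \<longleftrightarrow> finite B \<and> B \<subseteq> carrier \<Gamma> \<and>
     (\<forall>m\<in>carrier \<Gamma>. \<exists>!c. c \<in> B \<rightarrow>\<^sub>E carrier A \<and> m = (\<Oplus>\<^bsub>\<Gamma>\<^esub>b\<in>B. c b \<odot>\<^bsub>\<Gamma>\<^esub> b))"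

definition universal_calculus ::
  "(complex, 'a) module \<Rightarrow> ('a, ('a \<times> 'a \<Rightarrow>\<^sub>0 complex) set) fodc" where
  "universal_calculus A =
     \<lparr>carrier = {X \<in> carrier (tensor A A). tlift A (mult A) X = \<zero>\<^bsub>A\<^esub>},
      mult = undefined, one = undefined, zero = \<zero>\<^bsub>tensor A A\<^esub>, add = add (tensor A A),
      smult = (\<lambda>a. tlift (tensor A A) (\<lambda>x y. tens A A (a \<otimes>\<^bsub>A\<^esub> x) y)),
      rsmult = (\<lambda>X b. tlift (tensor A A) (\<lambda>x y. tens A A x (y \<otimes>\<^bsub>A\<^esub> b)) X),
      diff = (\<lambda>h. tens A A \<one>\<^bsub>A\<^esub> h \<ominus>\<^bsub>tensor A A\<^esub> tens A A h \<one>\<^bsub>A\<^esub>)\<rparr>"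

text \<open>A right ideal of \<open>A\<close> (and linear subspace) contained in \<open>P\<close>; used with \<open>P = A\<^sup>+\<close>.\<close>

definition right_ideal_in :: "(complex, 'a) module \<Rightarrow> 'a set \<Rightarrow> 'a set \<Rightarrow> bool" where
  "right_ideal_in A P I \<longleftrightarrow> submodule I complex_alg A \<and> I \<subseteq> P \<and>
     (\<forall>v\<in>I. \<forall>h\<in>carrier A. v \<otimes>\<^bsub>A\<^esub> h \<in> I)"

text \<open>\<open>s(a \<otimes> b) = a S(b\<^sub>(\<^sub>1\<^sub>)) \<otimes> b\<^sub>(\<^sub>2\<^sub>)\<close>\<close>

definition s_map ::
  "(complex, 'a) module \<Rightarrow> ('a \<Rightarrow> ('a \<times> 'a \<Rightarrow>\<^sub>0 complex) set) \<Rightarrow> ('a \<Rightarrow> 'a)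
     \<Rightarrow> ('a \<times> 'a \<Rightarrow>\<^sub>0 complex) set \<Rightarrow> ('a \<times> 'a \<Rightarrow>\<^sub>0 complex) set" where
  "s_map A \<Delta> S =
     tlift (tensor A A) (\<lambda>a b. tlift (tensor A A) (\<lambda>b\<^sub>1 b\<^sub>2. tens A A (a \<otimes>\<^bsub>A\<^esub> S b\<^sub>1) b\<^sub>2) (\<Delta> b))"

definition s_sub ::
  "(complex, 'a) module \<Rightarrow> ('a \<Rightarrow> ('a \<times> 'a \<Rightarrow>\<^sub>0 complex) set) \<Rightarrow> ('a \<Rightarrow> 'a)
     \<Rightarrow> 'a set \<Rightarrow> ('a \<times> 'a \<Rightarrow>\<^sub>0 complex) set set" where
  "s_sub A \<Delta> S I = s_map A \<Delta> S ` tensor_sub A A (carrier A) I"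

text \<open>The calculus of a right ideal \<open>I\<close> of \<open>A\<^sup>+\<close>, and its space \<open>A\<^sup>+/I\<close> of left-invariant forms.\<close>

definition ideal_calculus ::
  "(complex, 'a) module \<Rightarrow> ('a \<Rightarrow> ('a \<times> 'a \<Rightarrow>\<^sub>0 complex) set) \<Rightarrow> ('a \<Rightarrow> 'a)
     \<Rightarrow> 'a set \<Rightarrow> ('a, ('a \<times> 'a \<Rightarrow>\<^sub>0 complex) set set) fodc" where
  "ideal_calculus A \<Delta> S I = quotient_calculus (universal_calculus A) (s_sub A \<Delta> S I)"

definition inv_forms ::
  "(complex, 'a) module \<Rightarrow> ('a \<Rightarrow> complex) \<Rightarrow> 'a set \<Rightarrow> (complex, 'a set) module" where
  "inv_forms A \<epsilon> I = quotient_alg (A\<lparr>carrier := aug_ideal A \<epsilon>\<rparr>) I"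

definition complex_space :: "(complex, 'a) module \<Rightarrow> ('a, 'm) fodc \<Rightarrow> (complex, 'm) module" where
  "complex_space A \<Gamma> =
     \<lparr>carrier = carrier \<Gamma>, mult = undefined, one = undefined, zero = \<zero>\<^bsub>\<Gamma>\<^esub>, add = add \<Gamma>,
      smult = (\<lambda>c m. (c \<odot>\<^bsub>A\<^esub> \<one>\<^bsub>A\<^esub>) \<odot>\<^bsub>\<Gamma>\<^esub> m)\<rparr>"

text \<open>The identification of \<open>A \<otimes> (A\<^sup>+/I)\<close> with the calculus of \<open>I\<close>, to which \<open>s\<close> descends.
  The second argument of the bilinear map is a coset, and the union over its representatives
  is the union of a single class when \<open>a\<close> and the coset lie in the respective carriers.\<close>

definition s_quot ::
  "(complex, 'a) module \<Rightarrow> ('a \<Rightarrow> ('a \<times> 'a \<Rightarrow>\<^sub>0 complex) set) \<Rightarrow> ('a \<Rightarrow> 'a) \<Rightarrow> 'a set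
     \<Rightarrow> ('a \<times> 'a set \<Rightarrow>\<^sub>0 complex) set \<Rightarrow> ('a \<times> 'a \<Rightarrow>\<^sub>0 complex) set set" where
  "s_quot A \<Delta> S I = tlift (complex_space A (ideal_calculus A \<Delta> S I))
     (\<lambda>a V. \<Union>v\<in>V. s_sub A \<Delta> S I +>\<^bsub>universal_calculus A\<^esub> s_map A \<Delta> S (tens A A a v))"


section \<open>The quantum special unitary group\<close>

definition R_matrix :: "real \<Rightarrow> nat \<Rightarrow> nat \<Rightarrow> nat \<Rightarrow> nat \<Rightarrow> real" where
  \<comment> \<open>\<open>R_matrix q i k j l\<close> is the entry with upper indices \<open>i k\<close> and lower indices \<open>j l\<close>\<close>
  "R_matrix q i k j l =
     (if i = k then q else 1) * of_bool (i = l) * of_bool (k = j)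
     + (q - inverse q) * of_bool (k > i) * of_bool (i = j) * of_bool (k = l)"

definition free_alg :: "nat \<Rightarrow> (complex, (nat \<times> nat) list \<Rightarrow>\<^sub>0 complex) module" where
  \<comment> \<open>free algebra on letters \<open>(i, j)\<close>, standing for the generators with upper index \<open>i\<close>, lower index \<open>j\<close>\<close>
  "free_alg N = monoid_alg \<lparr>carrier = lists ({1..N} \<times> {1..N}), mult = (@), one = []\<rparr>"

definition M_relators :: "nat \<Rightarrow> real \<Rightarrow> ((nat \<times> nat) list \<Rightarrow>\<^sub>0 complex) set" where
  "M_relators N q =
     {(\<Sum>w\<in>{1..N}. \<Sum>x\<in>{1..N}. Poly_Mapping.single [(w, b), (x, d)] (of_real (R_matrix q a c w x)))
      - (\<Sum>y\<in>{1..N}. \<Sum>z\<in>{1..N}. Poly_Mapping.single [(a, y), (c, z)] (of_real (R_matrix q y z b d))) |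
      a b c d. a \<in> {1..N} \<and> b \<in> {1..N} \<and> c \<in> {1..N} \<and> d \<in> {1..N}}"

definition CqM :: "nat \<Rightarrow> real \<Rightarrow> (complex, ((nat \<times> nat) list \<Rightarrow>\<^sub>0 complex) set) module" where
  "CqM N q = quotient_alg (free_alg N) (Idl\<^bsub>free_alg N\<^esub> (M_relators N q))"

definition M_gen :: "nat \<Rightarrow> real \<Rightarrow> nat \<Rightarrow> nat \<Rightarrow> ((nat \<times> nat) list \<Rightarrow>\<^sub>0 complex) set" where
  "M_gen N q i j = Idl\<^bsub>free_alg N\<^esub> (M_relators N q) +>\<^bsub>free_alg N\<^esub> Poly_Mapping.single [(i, j)] 1"

definition perm_length :: "nat \<Rightarrow> (nat \<Rightarrow> nat) \<Rightarrow> nat" where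
  "perm_length N \<pi> = card {(i, j). 1 \<le> i \<and> i < j \<and> j \<le> N \<and> \<pi> j < \<pi> i}"

definition q_det :: "nat \<Rightarrow> real \<Rightarrow> ((nat \<times> nat) list \<Rightarrow>\<^sub>0 complex) set" where
  "q_det N q = (\<Oplus>\<^bsub>CqM N q\<^esub>\<pi>\<in>{\<pi>. \<pi> permutes {1..N}}.
     of_real ((- q) ^ perm_length N \<pi>) \<odot>\<^bsub>CqM N q\<^esub>
       foldr (\<lambda>i x. M_gen N q i (\<pi> i) \<otimes>\<^bsub>CqM N q\<^esub> x) [1..<Suc N] \<one>\<^bsub>CqM N q\<^esub>)"

definition det_ideal :: "nat \<Rightarrow> real \<Rightarrow> ((nat \<times> nat) list \<Rightarrow>\<^sub>0 complex) set set" where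
  "det_ideal N q = Idl\<^bsub>CqM N q\<^esub> {q_det N q \<ominus>\<^bsub>CqM N q\<^esub> \<one>\<^bsub>CqM N q\<^esub>}"

definition CqSU :: "nat \<Rightarrow> real \<Rightarrow> (complex, ((nat \<times> nat) list \<Rightarrow>\<^sub>0 complex) set set) module" where
  "CqSU N q = quotient_alg (CqM N q) (det_ideal N q)"

definition SU_gen :: "nat \<Rightarrow> real \<Rightarrow> nat \<Rightarrow> nat \<Rightarrow> ((nat \<times> nat) list \<Rightarrow>\<^sub>0 complex) set set" where
  "SU_gen N q i j = det_ideal N q +>\<^bsub>CqM N q\<^esub> M_gen N q i j"

text \<open>\<open>ker(Q)\<^sup>+\<close>, where \<open>Q\<close> has the matrix entries \<open>Q\<^sub>k\<^sub>l(h) = \<Q>(h \<otimes> u\<^sup>k\<^sub>l)\<close>\<close>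

definition kerQ_plus where
  "kerQ_plus N q \<Delta> \<epsilon> r =
     {h \<in> carrier (CqSU N q). \<forall>k\<in>{1..N}. \<forall>l\<in>{1..N}. killing_form \<Delta> r h (SU_gen N q k l) = 0}
     \<inter> aug_ideal (CqSU N q) \<epsilon>"

end

theory Submission
  imports Defs
begin

text \<open>Put \<open>L\<^sup>+(h)\<^sub>m\<^sub>l = r(h \<otimes> u\<^sup>m\<^sub>l)\<close> and \<open>L\<^sup>-(h)\<^sub>k\<^sub>m = r(u\<^sup>k\<^sub>m \<otimes> h)\<close>. Then
  \<open>M \<cdot> h = L\<^sup>-(h\<^sub>(\<^sub>1\<^sub>)) M L\<^sup>+(h\<^sub>(\<^sub>2\<^sub>))\<close> is a right action of \<open>G\<close> on \<open>N \<times> N\<close> matrices, \<open>Q(h) = 1 \<cdot> h\<close>, and so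
  \<open>Q(gh) = Q(g) \<cdot> h\<close>. For \<open>i \<noteq> j\<close> the matrix \<open>Q(u\<^sup>i\<^sub>j)\<close> is a multiple of \<open>E\<^sub>j\<^sub>i\<close>, and \<open>Q(u\<^sup>i\<^sub>1 S(u\<^sup>1\<^sub>i))\<close> is
  a multiple of \<open>E\<^sub>i\<^sub>i\<close> for \<open>i \<ge> 2\<close>, both nonzero unless \<open>q = 1\<close>. Hence \<open>Q\<close> maps \<open>D\<^sub>1 + D\<^sub>2\<close> onto the block
  of matrices supported on rows and columns \<open>\<ge> 2\<close>, and \<open>I\<^sub>S\<^sub>U\<close> is the preimage of this block in \<open>G\<^sup>+\<close>.
  It is a right ideal because \<open>L\<^sup>-\<close> is lower and \<open>L\<^sup>+\<close> is upper triangular, which makes the block stable.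
  The entries of \<open>Q\<close> in the first row and column are, up to scaling, coordinates on \<open>G\<^sup>+/I\<^sub>S\<^sub>U\<close> dual to the
  \<open>2N - 1\<close> claimed basis elements; for \<open>u\<^sup>1\<^sub>1 - 1\<close> this needs \<open>p\<^sup>2 \<noteq> q\<^sup>2\<close>,
  where \<open>p\<close> is the chosen \<open>N\<close>-th root of \<open>q\<close>, and this holds for \<open>q < 1\<close> and \<open>N \<ge> 2\<close>.
  The case \<open>q = 1\<close> is degenerate: there \<open>D\<^sub>1 + D\<^sub>2 \<subseteq> ker(Q)\<^sup>+\<close>.

  On the side of calculi, \<open>s\<close> has the inverse \<open>a \<otimes> b \<mapsto> a b\<^sub>(\<^sub>1\<^sub>) \<otimes> b\<^sub>(\<^sub>2\<^sub>)\<close>, which intertwines right multiplication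
  by \<open>h\<close> with multiplication by \<open>\<Delta>(h)\<close>. So \<open>s(G \<otimes> I)\<close> is a subbimodule for each right ideal \<open>I\<close> (without
  using that the antipode is antimultiplicative), and the third isomorphism theorem identifies the quotients.\<close>

section \<open>Complex vector spaces\<close>

text \<open>\<open>D\<^sub>1\<close> uses \<open>u\<^sup>i\<^sub>1 S(u\<^sup>1\<^sub>i)\<close> and
  not \<open>u\<^sup>i\<^sub>i - 1\<close> for a reason: \<open>Q(u\<^sup>i\<^sub>i)\<close> is
  diagonal with no zero on its diagonal, and for \<open>q < 1\<close> and \<open>i \<ge> 2\<close>
  the matrix \<open>Q(u\<^sup>i\<^sub>i - 1)\<close> has the nonzero entry
  \<open>1/p\<^sup>2 - 1\<close> at (1,1), outside the block. The unit
  \<open>E\<^sub>i\<^sub>i\<close> is reached by acting on \<open>Q(u\<^sup>i\<^sub>1)\<close>, a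
  multiple of \<open>E\<^sub>1\<^sub>i\<close>. The obstacle is that no formula for the antipode is
  at hand: the action of \<open>S(u\<^sup>1\<^sub>i)\<close> on \<open>E\<^sub>1\<^sub>i\<close> is
  solved from the linear identities \<open>\<Sum>j. u\<^sup>a\<^sub>j S(u\<^sup>j\<^sub>b) =
  \<delta>\<^sub>a\<^sub>b\<close>, since a weighted sum over \<open>a\<close> isolates it. The
  other obstacle is independence of representatives. The map \<open>tlift\<close> evaluates at a
  chosen representative, and the operations of quotients are unions over representatives. Once
  \<open>tlift_coset\<close> and \<open>UN_coset\<close> have settled this, identities between
  Sweedler sums become comparisons of linear maps on pure tensors.\<close>

lemma complex_alg_simps [simp]:
  "carrier complex_alg = UNIV" "x \<otimes>\<^bsub>complex_alg\<^esub> y = x * y" "\<one>\<^bsub>complex_alg\<^esub> = 1"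
  "x \<oplus>\<^bsub>complex_alg\<^esub> y = x + y" "\<zero>\<^bsub>complex_alg\<^esub> = 0" "x \<odot>\<^bsub>complex_alg\<^esub> y = x * y"
  by (simp_all add: complex_alg_def)

lemma cring_complex_alg: "cring complex_alg"
proof (intro cringI abelian_groupI comm_monoidI)
  show "\<exists>y\<in>carrier complex_alg. y \<oplus>\<^bsub>complex_alg\<^esub> x = \<zero>\<^bsub>complex_alg\<^esub>" for x
    by (auto intro!: exI[of _ "- x"])
qed (simp_all add: algebra_simps)

text \<open>On an infinite index set both sums take the default value zero, so the equation holds
  for every \<open>X\<close>.\<close>

lemma finsum_complex_alg [simp]: "finsum complex_alg f X = sum f X"
proof -
  interpret cring complex_alg by (rule cring_complex_alg)
  show ?thesis
  proof (cases "finite X")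
    case True
    then show ?thesis by (induction X) simp_all
  next
    case False
    then show ?thesis by (simp add: finsum_infinite)
  qed
qed

lemma (in abelian_group) minus_add_cancel: "\<lbrakk>x \<in> carrier G; y \<in> carrier G\<rbrakk> \<Longrightarrow> x \<ominus> y \<oplus> y = x"
  by (simp add: a_minus_def a_assoc l_neg)

lemma (in abelian_group) minus_eq_zero_iff:
  assumes "x \<in> carrier G" "y \<in> carrier G"
  shows "x \<ominus> y = \<zero> \<longleftrightarrow> x = y"
proof
  assume "x \<ominus> y = \<zero>"
  then have "(x \<oplus> \<ominus> y) \<oplus> y = y" using assms by (simp add: a_minus_def)
  then show "x = y" using assms by (simp add: a_assoc l_neg)
qed (use assms in \<open>simp add: a_minus_def r_neg\<close>)

text \<open>The axioms of a module over \<open>complex_alg\<close> with the operations of the ground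
  ring unfolded, so that scalars obey ordinary complex arithmetic and range over the whole
  type.\<close>

locale cvs = abelian_group V for V :: "(complex, 'v) module" (structure) +
  assumes smult_closed [simp, intro]: "x \<in> carrier V \<Longrightarrow> (c::complex) \<odot> x \<in> carrier V"
    and smult_l_distr: "x \<in> carrier V \<Longrightarrow> (c + d) \<odot> x = c \<odot> x \<oplus> d \<odot> x"
    and smult_r_distr: "\<lbrakk>x \<in> carrier V; y \<in> carrier V\<rbrakk> \<Longrightarrow> c \<odot> (x \<oplus> y) = c \<odot> x \<oplus> c \<odot> y"
    and smult_assoc: "x \<in> carrier V \<Longrightarrow> (c * d) \<odot> x = c \<odot> (d \<odot> x)"
    and smult_one [simp]: "x \<in> carrier V \<Longrightarrow> 1 \<odot> x = x"

lemma cvs_iff_module: "cvs V \<longleftrightarrow> module complex_alg V"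
  by (auto simp: cvs_def module_def cvs_axioms_def module_axioms_def cring_complex_alg)

lemma cvs_complex_alg: "cvs complex_alg"
proof -
  interpret cring complex_alg by (rule cring_complex_alg)
  show ?thesis by unfold_locales (simp_all add: algebra_simps)
qed

context cvs
begin

lemma smult_zero_left [simp]: "x \<in> carrier V \<Longrightarrow> 0 \<odot> x = \<zero>"
  and smult_zero_right [simp]: "c \<odot> \<zero> = \<zero>"
  and smult_minus_one: "x \<in> carrier V \<Longrightarrow> (- 1) \<odot> x = \<ominus> x"
proof -
  interpret M: module complex_alg V using cvs_axioms by (simp add: cvs_iff_module)
  show z: "x \<in> carrier V \<Longrightarrow> 0 \<odot> x = \<zero>" for x using M.smult_l_null[of x] by simp
  show "c \<odot> \<zero> = \<zero>" using M.smult_r_null[of c] by simp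
  show "x \<in> carrier V \<Longrightarrow> (- 1) \<odot> x = \<ominus> x"
    using smult_l_distr[of x "-1" 1] z[of x] minus_equality[of "(- 1) \<odot> x" x] by simp
qed

text \<open>Closure under negation is scalar multiplication by -1, which leaves only zero, sums and
  multiples to check.\<close>

lemma submodule_iff:
  "submodule W complex_alg V \<longleftrightarrow> W \<subseteq> carrier V \<and> \<zero> \<in> W \<and>
     (\<forall>x\<in>W. \<forall>y\<in>W. x \<oplus> y \<in> W) \<and> (\<forall>c. \<forall>x\<in>W. c \<odot> x \<in> W)" (is "?l \<longleftrightarrow> ?r")
proof
  interpret M: module complex_alg V using cvs_axioms by (simp add: cvs_iff_module)
  show ?r if ?l
    using that M.submoduleE[OF that] subgroup.one_closed[OF submodule.axioms(1)[OF that]] by auto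
  show ?l if ?r
  proof (rule M.submoduleI)
    show "\<ominus> a \<in> W" if "a \<in> W" for a
      by (metis that \<open>?r\<close> smult_minus_one subsetD)
  qed (use that in auto)
qed

lemma submodule_imp_abelian_subgroup:
  assumes "submodule W complex_alg V"
  shows "abelian_subgroup W V"
  by (rule abelian_subgroupI3)
    (auto simp: additive_subgroup_def submodule.axioms(1)[OF assms] abelian_group_axioms)

lemma smult_finsum:
  "f \<in> X \<rightarrow> carrier V \<Longrightarrow> c \<odot> (\<Oplus>i\<in>X. f i) = (\<Oplus>i\<in>X. c \<odot> f i)"
proof (cases "finite X")
  case True
  then show "f \<in> X \<rightarrow> carrier V \<Longrightarrow> ?thesis"
    by (induction X) (auto simp: smult_r_distr Pi_def)
qed (simp add: finsum_infinite)

end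

lemma complex_alg_minus: "x \<ominus>\<^bsub>complex_alg\<^esub> y = x - y"
proof -
  interpret C: cvs complex_alg by (rule cvs_complex_alg)
  show ?thesis using C.smult_minus_one[of y] by (simp add: a_minus_def)
qed

section \<open>Linear maps\<close>

lemma clinearI:
  assumes "\<And>x. x \<in> carrier V \<Longrightarrow> f x \<in> carrier W"
    and "\<And>x y. x \<in> carrier V \<Longrightarrow> y \<in> carrier V \<Longrightarrow> f (x \<oplus>\<^bsub>V\<^esub> y) = f x \<oplus>\<^bsub>W\<^esub> f y"
    and "\<And>c x. x \<in> carrier V \<Longrightarrow> f (c \<odot>\<^bsub>V\<^esub> x) = c \<odot>\<^bsub>W\<^esub> f x"
  shows "clinear V W f"
  using assms by (auto simp: clinear_def)

lemma clinearD:
  assumes "clinear V W f"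
  shows clinear_closed: "x \<in> carrier V \<Longrightarrow> f x \<in> carrier W"
    and clinear_add: "x \<in> carrier V \<Longrightarrow> y \<in> carrier V \<Longrightarrow> f (x \<oplus>\<^bsub>V\<^esub> y) = f x \<oplus>\<^bsub>W\<^esub> f y"
    and clinear_smult: "x \<in> carrier V \<Longrightarrow> f (c \<odot>\<^bsub>V\<^esub> x) = c \<odot>\<^bsub>W\<^esub> f x"
  using assms by (auto simp: clinear_def)

lemma clinear_cong:
  assumes "cvs V" "\<And>x. x \<in> carrier V \<Longrightarrow> f x = g x"
  shows "clinear V W f \<longleftrightarrow> clinear V W g"
proof -
  interpret V: cvs V by fact
  show ?thesis using assms(2) by (simp add: clinear_def Pi_def)
qed

lemma clinear_comp: "clinear U V f \<Longrightarrow> clinear V W g \<Longrightarrow> clinear U W (\<lambda>x. g (f x))"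
  by (auto simp: clinear_def Pi_def)

lemma clinear_id: "clinear V V (\<lambda>x. x)"
  by (auto simp: clinear_def)

lemma clinear_zero:
  assumes "cvs V" "cvs W" "clinear V W f"
  shows "f \<zero>\<^bsub>V\<^esub> = \<zero>\<^bsub>W\<^esub>"
proof -
  interpret V: cvs V by fact
  interpret W: cvs W by fact
  have "f (0 \<odot>\<^bsub>V\<^esub> \<zero>\<^bsub>V\<^esub>) = 0 \<odot>\<^bsub>W\<^esub> f \<zero>\<^bsub>V\<^esub>" by (intro clinear_smult[OF assms(3)]) simp
  then show ?thesis using clinear_closed[OF assms(3), of "\<zero>\<^bsub>V\<^esub>"] by simp
qed

lemma clinear_minus:
  assumes "cvs V" "cvs W" "clinear V W f" "x \<in> carrier V" "y \<in> carrier V"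
  shows "f (x \<ominus>\<^bsub>V\<^esub> y) = f x \<ominus>\<^bsub>W\<^esub> f y"
proof -
  interpret V: cvs V by fact
  interpret W: cvs W by fact
  have "f (\<ominus>\<^bsub>V\<^esub> y) = \<ominus>\<^bsub>W\<^esub> f y"
    using assms(5) clinear_smult[OF assms(3), of y "-1"] clinear_closed[OF assms(3), of y]
    by (simp add: V.smult_minus_one W.smult_minus_one)
  then show ?thesis using assms(4,5) by (simp add: a_minus_def clinear_add[OF assms(3)])
qed

lemma clinear_finsum:
  assumes "cvs V" "cvs W" "clinear V W f" "g \<in> X \<rightarrow> carrier V"
  shows "f (\<Oplus>\<^bsub>V\<^esub>i\<in>X. g i) = (\<Oplus>\<^bsub>W\<^esub>i\<in>X. f (g i))"
proof -
  interpret V: cvs V by fact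
  interpret W: cvs W by fact
  note [simp] = clinear_zero[OF assms(1-3)] clinear_add[OF assms(3)] clinear_closed[OF assms(3)]
  show ?thesis
  proof (cases "finite X")
    case True
    then show ?thesis using assms(4)
    proof (induction X)
      case (insert x X)
      then have "f (g x \<oplus>\<^bsub>V\<^esub> finsum V g X) = f (g x) \<oplus>\<^bsub>W\<^esub> f (finsum V g X)"
        by (intro clinear_add[OF assms(3)]) auto
      with insert show ?case by (subst V.finsum_insert W.finsum_insert; auto simp: Pi_def)+
    qed simp
  next
    case False
    then show ?thesis by (simp add: V.finsum_infinite W.finsum_infinite)
  qed
qed

lemma clinear_finsum_fun:
  assumes "cvs W" "\<And>i. i \<in> X \<Longrightarrow> clinear V W (f i)"
  shows "clinear V W (\<lambda>x. \<Oplus>\<^bsub>W\<^esub>i\<in>X. f i x)"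
proof -
  interpret W: cvs W by fact
  show ?thesis
  proof (rule clinearI)
    fix x y c assume x: "x \<in> carrier V"
    then show "(\<Oplus>\<^bsub>W\<^esub>i\<in>X. f i x) \<in> carrier W"
      using clinear_closed[OF assms(2)] by (intro W.finsum_closed) auto
    show "(\<Oplus>\<^bsub>W\<^esub>i\<in>X. f i (c \<odot>\<^bsub>V\<^esub> x)) = c \<odot>\<^bsub>W\<^esub> (\<Oplus>\<^bsub>W\<^esub>i\<in>X. f i x)"
      using clinearD[OF assms(2)] x by (subst W.smult_finsum) (auto intro!: W.finsum_cong')
    assume y: "y \<in> carrier V"
    have "(\<Oplus>\<^bsub>W\<^esub>i\<in>X. f i (x \<oplus>\<^bsub>V\<^esub> y)) = (\<Oplus>\<^bsub>W\<^esub>i\<in>X. f i x \<oplus>\<^bsub>W\<^esub> f i y)"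
      using clinearD[OF assms(2)] x y by (intro W.finsum_cong') auto
    also have "\<dots> = (\<Oplus>\<^bsub>W\<^esub>i\<in>X. f i x) \<oplus>\<^bsub>W\<^esub> (\<Oplus>\<^bsub>W\<^esub>i\<in>X. f i y)"
      using clinearD[OF assms(2)] x y by (intro W.finsum_addf) auto
    finally show "(\<Oplus>\<^bsub>W\<^esub>i\<in>X. f i (x \<oplus>\<^bsub>V\<^esub> y)) = (\<Oplus>\<^bsub>W\<^esub>i\<in>X. f i x) \<oplus>\<^bsub>W\<^esub> (\<Oplus>\<^bsub>W\<^esub>i\<in>X. f i y)" .
  qed
qed

lemma clinear_smult_left:
  assumes "cvs W" "clinear V W f"
  shows "clinear V W (\<lambda>x. c \<odot>\<^bsub>W\<^esub> f x)"
proof -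
  interpret W: cvs W by fact
  show ?thesis
    by (rule clinearI)
      (simp_all add: clinearD[OF assms(2)] W.smult_r_distr W.smult_assoc[symmetric] mult.commute)
qed

lemma clinear_smult_right:
  assumes "cvs W" "w \<in> carrier W" "clinear V complex_alg f"
  shows "clinear V W (\<lambda>x. f x \<odot>\<^bsub>W\<^esub> w)"
proof -
  interpret W: cvs W by fact
  show ?thesis
    by (rule clinearI)
      (simp_all add: clinearD[OF assms(3)] assms(2) W.smult_l_distr W.smult_assoc)
qed

section \<open>Spans, images and preimages of subspaces\<close>

lemma (in cvs) submodule_cspan:
  assumes "X \<subseteq> carrier V"
  shows "submodule (cspan V X) complex_alg V"
  \<comment> \<open>The carrier itself belongs to the intersected family, which keeps the
    intersection inside it.\<close>
  using assms unfolding submodule_iff by (auto simp: cspan_def submodule_iff)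

lemma cspan_superset: "X \<subseteq> cspan V X"
  by (auto simp: cspan_def)

lemma cspan_least: "submodule W complex_alg V \<Longrightarrow> X \<subseteq> W \<Longrightarrow> cspan V X \<subseteq> W"
  by (auto simp: cspan_def)

lemma (in cvs) cspan_closed: "X \<subseteq> carrier V \<Longrightarrow> cspan V X \<subseteq> carrier V"
  using submodule_cspan[of X] unfolding submodule_iff by auto

lemma submodule_vimage:
  assumes "cvs V" "cvs W" "clinear V W f" "submodule U complex_alg W"
  shows "submodule {x \<in> carrier V. f x \<in> U} complex_alg V"
proof -
  interpret V: cvs V by fact
  interpret W: cvs W by fact
  have U: "\<zero>\<^bsub>W\<^esub> \<in> U" "\<And>x y. x \<in> U \<Longrightarrow> y \<in> U \<Longrightarrow> x \<oplus>\<^bsub>W\<^esub> y \<in> U"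
      "\<And>c x. x \<in> U \<Longrightarrow> c \<odot>\<^bsub>W\<^esub> x \<in> U"
    using assms(4) unfolding W.submodule_iff by auto
  show ?thesis unfolding V.submodule_iff
    using U by (auto simp: clinear_add[OF assms(3)] clinear_smult[OF assms(3)] clinear_zero[OF assms(1-3)])
qed

lemma submodule_image:
  assumes "cvs V" "cvs W" "clinear V W f" "submodule U complex_alg V"
  shows "submodule (f ` U) complex_alg W"
proof -
  interpret V: cvs V by fact
  interpret W: cvs W by fact
  have U: "U \<subseteq> carrier V" "\<zero>\<^bsub>V\<^esub> \<in> U" "\<And>x y. x \<in> U \<Longrightarrow> y \<in> U \<Longrightarrow> x \<oplus>\<^bsub>V\<^esub> y \<in> U"
      "\<And>c x. x \<in> U \<Longrightarrow> c \<odot>\<^bsub>V\<^esub> x \<in> U"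
    using assms(4) unfolding V.submodule_iff by auto
  show ?thesis unfolding W.submodule_iff
  proof (intro conjI allI ballI)
    show "f ` U \<subseteq> carrier W" using U clinear_closed[OF assms(3)] by auto
    show "\<zero>\<^bsub>W\<^esub> \<in> f ` U" using U clinear_zero[OF assms(1-3)] by (metis imageI)
    show "x \<oplus>\<^bsub>W\<^esub> y \<in> f ` U" if "x \<in> f ` U" "y \<in> f ` U" for x y
    proof -
      obtain a b where "a \<in> U" "b \<in> U" "x = f a" "y = f b" using \<open>x \<in> f ` U\<close> \<open>y \<in> f ` U\<close> by auto
      then show ?thesis using U clinear_add[OF assms(3), of a b] by (metis imageI subsetD)
    qed
    show "c \<odot>\<^bsub>W\<^esub> x \<in> f ` U" if "x \<in> f ` U" for c x
    proof -
      obtain a where "a \<in> U" "x = f a" using \<open>x \<in> f ` U\<close> by auto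
      then show ?thesis using U clinear_smult[OF assms(3), of a c] by (metis imageI subsetD)
    qed
  qed
qed

text \<open>The preimage of the span of \<open>f\<close>
  X\<open>is a subspace containing\<close>X\<open>, and the image of the span of\<close>X\<open>is a subspace containing\<close>f
  \<open>X\<close>; minimality of spans gives the two inclusions.\<close>

lemma cspan_image:
  assumes "cvs V" "cvs W" "clinear V W f" "X \<subseteq> carrier V"
  shows "f ` cspan V X = cspan W (f ` X)"
proof
  interpret V: cvs V by fact
  interpret W: cvs W by fact
  have "f ` X \<subseteq> carrier W" using assms(4) clinear_closed[OF assms(3)] by auto
  then have "cspan V X \<subseteq> {x \<in> carrier V. f x \<in> cspan W (f ` X)}"
    using assms(4) cspan_superset[of "f ` X" W]
    by (intro cspan_least submodule_vimage[OF assms(1-3)] W.submodule_cspan) auto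
  then show "f ` cspan V X \<subseteq> cspan W (f ` X)" by auto
  show "cspan W (f ` X) \<subseteq> f ` cspan V X"
    using assms(4) cspan_superset[of X V]
    by (intro cspan_least submodule_image[OF assms(1-3)] V.submodule_cspan) auto
qed

text \<open>A subspace of \<open>V\<close> may be given as a vector space \<open>U\<close> of its own, as for \<open>G\<^sup>+\<close>.\<close>

lemma cspan_subspace:
  assumes "cvs U" "cvs V" "clinear U V (\<lambda>x. x)" "X \<subseteq> carrier U"
  shows "cspan U X = cspan V X"
  using cspan_image[OF assms] by simp

text \<open>The set on which two linear maps agree is a subspace. Every later argument of the form
  "it is enough to check on generators" for linear maps rests on this.\<close>

lemma clinear_eq_on_cspan:
  assumes "cvs V" "cvs W" "clinear V W f" "clinear V W g" "X \<subseteq> carrier V"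
    and "\<And>x. x \<in> X \<Longrightarrow> f x = g x" "x \<in> cspan V X"
  shows "f x = g x"
proof -
  interpret V: cvs V by fact
  interpret W: cvs W by fact
  have "submodule {x \<in> carrier V. f x = g x} complex_alg V"
    unfolding V.submodule_iff
    by (simp add: clinearD[OF assms(3)] clinearD[OF assms(4)] clinear_zero[OF assms(1-3)]
        clinear_zero[OF assms(1,2,4)])
  then have "cspan V X \<subseteq> {x \<in> carrier V. f x = g x}"
    using assms(5,6) by (intro cspan_least) auto
  with assms(7) show ?thesis by auto
qed

context cvs
begin

lemma submodule_set_add:
  assumes "submodule U complex_alg V" "submodule W complex_alg V"
  shows "submodule (U <+>\<^bsub>V\<^esub> W) complex_alg V"
proof -
  have UW: "\<exists>h\<in>U. \<exists>k\<in>W. (a \<oplus> b) \<oplus> (c \<oplus> d) = h \<oplus> k" if "a \<in> U" "b \<in> W" "c \<in> U" "d \<in> W" for a b c d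
  proof (intro bexI)
    show "(a \<oplus> b) \<oplus> (c \<oplus> d) = (a \<oplus> c) \<oplus> (b \<oplus> d)"
      using that assms by (simp add: submodule_iff subset_iff a_ac)
  qed (use that assms in \<open>auto simp: submodule_iff\<close>)
  show ?thesis
    unfolding submodule_iff
  proof (intro conjI allI ballI)
    show "U <+>\<^bsub>V\<^esub> W \<subseteq> carrier V" using assms by (auto simp: submodule_iff set_add_def' subset_iff)
    show "\<zero> \<in> U <+>\<^bsub>V\<^esub> W" using assms by (auto simp: submodule_iff set_add_def' intro!: bexI[of _ \<zero>])
    show "x \<oplus> y \<in> U <+>\<^bsub>V\<^esub> W" if "x \<in> U <+>\<^bsub>V\<^esub> W" "y \<in> U <+>\<^bsub>V\<^esub> W" for x y
      using that UW by (auto simp: set_add_def')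
    show "c \<odot> x \<in> U <+>\<^bsub>V\<^esub> W" if x: "x \<in> U <+>\<^bsub>V\<^esub> W" for c x
    proof -
      obtain u w where "u \<in> U" "w \<in> W" "x = u \<oplus> w" using x by (auto simp: set_add_def')
      moreover from this have "c \<odot> x = c \<odot> u \<oplus> c \<odot> w"
        using assms by (auto simp: submodule_iff subset_iff smult_r_distr)
      moreover have "c \<odot> u \<in> U" "c \<odot> w \<in> W" using assms calculation by (auto simp: submodule_iff)
      ultimately show ?thesis unfolding set_add_def' by blast
    qed
  qed
qed

end

lemma clinear_minus_fun:
  assumes W: "cvs W" and f: "clinear V W f" and g: "clinear V W g"
  shows "clinear V W (\<lambda>x. f x \<ominus>\<^bsub>W\<^esub> g x)"
proof -
  interpret W: cvs W by fact
  have "(a \<oplus>\<^bsub>W\<^esub> b) \<ominus>\<^bsub>W\<^esub> (c \<oplus>\<^bsub>W\<^esub> d) = (a \<ominus>\<^bsub>W\<^esub> c) \<oplus>\<^bsub>W\<^esub> (b \<ominus>\<^bsub>W\<^esub> d)"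
    if "a \<in> carrier W" "b \<in> carrier W" "c \<in> carrier W" "d \<in> carrier W" for a b c d
    using that by (simp add: a_minus_def W.minus_add W.a_ac)
  moreover have "r \<odot>\<^bsub>W\<^esub> (a \<ominus>\<^bsub>W\<^esub> b) = r \<odot>\<^bsub>W\<^esub> a \<ominus>\<^bsub>W\<^esub> r \<odot>\<^bsub>W\<^esub> b" if "a \<in> carrier W" "b \<in> carrier W" for r a b
    using clinear_minus[OF W W clinear_smult_left[OF W clinear_id] that] .
  ultimately show ?thesis
    by (intro clinearI) (simp_all add: clinearD[OF f] clinearD[OF g])
qed

lemma (in cvs) submodule_subspace:
  assumes "cvs U" "clinear U V (\<lambda>x. x)" "submodule W complex_alg V" "W \<subseteq> carrier U"
  shows "submodule W complex_alg U"
proof -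
  interpret U: cvs U by fact
  have add: "x \<oplus>\<^bsub>U\<^esub> y = x \<oplus> y" and smult: "c \<odot>\<^bsub>U\<^esub> x = c \<odot> x" if "x \<in> carrier U" "y \<in> carrier U" for x y c
    using clinear_add[OF assms(2) that] clinear_smult[OF assms(2) that(1)] by auto
  show ?thesis
    using assms(3,4) clinear_zero[OF assms(1) cvs_axioms assms(2)]
    unfolding submodule_iff U.submodule_iff by (auto simp: add smult subset_iff)
qed

lemma (in cvs) submodule_finsum:
  assumes "submodule W complex_alg V" "f \<in> X \<rightarrow> W"
  shows "finsum V f X \<in> W"
proof (cases "finite X")
  case True
  have W: "W \<subseteq> carrier V" "\<zero> \<in> W" "\<And>x y. x \<in> W \<Longrightarrow> y \<in> W \<Longrightarrow> x \<oplus> y \<in> W"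
    using assms(1) unfolding submodule_iff by auto
  show ?thesis
    using True assms(2)
  proof (induction X)
    case (insert x X)
    then have "f \<in> X \<rightarrow> carrier V" "f x \<in> carrier V" using W(1) by auto
    with insert show ?case using W by simp
  qed (simp add: W)
qed (use assms(1) in \<open>simp add: finsum_infinite submodule_iff\<close>)

lemma mem_set_add: "x \<in> H <+>\<^bsub>G\<^esub> K \<longleftrightarrow> (\<exists>h\<in>H. \<exists>k\<in>K. x = h \<oplus>\<^bsub>G\<^esub> k)"
  by (auto simp: set_add_def')

section \<open>Quotients\<close>

context abelian_subgroup
begin

lemma coset_eq_iff:
  assumes "x \<in> carrier G" "y \<in> carrier G"
  shows "H +> x = H +> y \<longleftrightarrow> x \<ominus> y \<in> H"
  using a_rcos_module[OF assms(2,1)] a_rcos_self[OF assms(1)] a_repr_independence'[OF _ assms(2), of x]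
  by (auto simp: a_minus_def)

lemma coset_eq_self_iff: "x \<in> carrier G \<Longrightarrow> H +> x = H \<longleftrightarrow> x \<in> H"
  using coset_eq_iff[of x \<zero>] a_subset by (simp add: a_minus_def add.inv_one[unfolded a_inv_def[symmetric]])

text \<open>Quotient operations are unions over the representatives of a coset. Such a union
  collapses to a single value once the value does not depend on the representative.\<close>

lemma UN_coset:
  assumes "a \<in> carrier G"
    and "\<And>x. x \<in> carrier G \<Longrightarrow> x \<ominus> a \<in> H \<Longrightarrow> f x = f a"
  shows "(\<Union>x\<in>H +> a. f x) = f a"
proof -
  have "f x = f a" if "x \<in> H +> a" for x
    using assms that a_elemrcos_carrier[OF _ that] a_rcos_module_imp[OF _ that]
    by (auto simp: a_minus_def abelian_group_axioms)
  moreover have "a \<in> H +> a" using assms(1) by (rule a_rcos_self)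
  ultimately show ?thesis by blast
qed

end

lemma quotient_alg_simps:
  "carrier (quotient_alg A I) = a_rcosets\<^bsub>A\<^esub> I" "add (quotient_alg A I) = set_add A"
  "\<zero>\<^bsub>quotient_alg A I\<^esub> = I" "\<one>\<^bsub>quotient_alg A I\<^esub> = I +>\<^bsub>A\<^esub> \<one>\<^bsub>A\<^esub>"
  "mult (quotient_alg A I) = rcoset_mult A I"
  "c \<odot>\<^bsub>quotient_alg A I\<^esub> X = (\<Union>x\<in>X. I +>\<^bsub>A\<^esub> (c \<odot>\<^bsub>A\<^esub> x))"
  by (simp_all add: quotient_alg_def ring.defs module.defs FactRing_def)

text \<open>The additive structure shared by \<open>quotient_alg\<close> and
  \<open>quotient_calculus\<close>, two kinds of records with the same cosets; the group laws are
  proved once for both.\<close>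

locale coset_space = abelian_subgroup H G for H and G (structure) +
  fixes Q
  assumes Q_carrier: "carrier Q = a_rcosets H" and Q_add: "add Q = set_add G" and Q_zero: "zero Q = H"
begin

lemma coset_closed [simp, intro]: "x \<in> carrier G \<Longrightarrow> H +> x \<in> carrier Q"
  by (simp add: Q_carrier a_rcosetsI a_subset)

lemma coset_cases: "X \<in> carrier Q \<Longrightarrow> (\<And>x. x \<in> carrier G \<Longrightarrow> X = H +> x \<Longrightarrow> P) \<Longrightarrow> P"
  by (auto simp: Q_carrier A_RCOSETS_def')

lemma coset_add: "x \<in> carrier G \<Longrightarrow> y \<in> carrier G \<Longrightarrow> H +> (x \<oplus> y) = (H +> x) \<oplus>\<^bsub>Q\<^esub> (H +> y)"
  by (simp add: Q_add a_rcos_sum)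

lemma coset_zero: "\<zero>\<^bsub>Q\<^esub> = H +> \<zero>"
  by (simp add: Q_zero a_subset)

lemma abelian_group_coset_space: "abelian_group Q"
proof (rule abelian_groupI)
  show "x \<oplus>\<^bsub>Q\<^esub> y \<in> carrier Q" if "x \<in> carrier Q" "y \<in> carrier Q" for x y
    using that by (auto elim!: coset_cases simp: coset_add[symmetric])
  show "\<zero>\<^bsub>Q\<^esub> \<in> carrier Q" by (simp add: coset_zero del: a_coset_add_zero)
  show "x \<oplus>\<^bsub>Q\<^esub> y \<oplus>\<^bsub>Q\<^esub> z = x \<oplus>\<^bsub>Q\<^esub> (y \<oplus>\<^bsub>Q\<^esub> z)" if "x \<in> carrier Q" "y \<in> carrier Q" "z \<in> carrier Q" for x y z
    using that by (auto elim!: coset_cases simp: coset_add[symmetric] a_assoc)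
  show "x \<oplus>\<^bsub>Q\<^esub> y = y \<oplus>\<^bsub>Q\<^esub> x" if "x \<in> carrier Q" "y \<in> carrier Q" for x y
    using that by (auto elim!: coset_cases simp: coset_add[symmetric] a_comm)
  show "\<zero>\<^bsub>Q\<^esub> \<oplus>\<^bsub>Q\<^esub> x = x" if "x \<in> carrier Q" for x
    using that by (auto elim!: coset_cases simp: coset_zero coset_add[symmetric] simp del: a_coset_add_zero)
  show "\<exists>y\<in>carrier Q. y \<oplus>\<^bsub>Q\<^esub> x = \<zero>\<^bsub>Q\<^esub>" if x: "x \<in> carrier Q" for x
  proof -
    obtain a where "a \<in> carrier G" "x = H +> a" using x by (rule coset_cases)
    then show ?thesis
      by (intro bexI[of _ "H +> (\<ominus> a)"]) (auto simp: coset_zero coset_add[symmetric] l_neg simp del: a_coset_add_zero)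
  qed
qed

end

locale quotient_space = cvs V for V :: "(complex, 'v) module" (structure) and I +
  assumes submodule_I: "submodule I complex_alg V"
begin

sublocale coset_space I V "quotient_alg V I"
  using submodule_imp_abelian_subgroup[OF submodule_I]
  by (simp add: coset_space_def coset_space_axioms_def quotient_alg_simps)

lemma coset_smult: "x \<in> carrier V \<Longrightarrow> I +> (c \<odot> x) = c \<odot>\<^bsub>quotient_alg V I\<^esub> (I +> x)"
proof -
  assume x: "x \<in> carrier V"
  have "I +> (c \<odot> y) = I +> (c \<odot> x)" if y: "y \<in> carrier V" "y \<ominus> x \<in> I" for y
  proof -
    have "c \<odot> y \<ominus> c \<odot> x = c \<odot> (y \<ominus> x)"
      using clinear_minus[OF cvs_axioms cvs_axioms clinear_smult_left[OF cvs_axioms clinear_id]] x y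
      by simp
    also have "\<dots> \<in> I" using submodule_I y by (simp add: submodule_iff)
    finally show ?thesis using x y by (simp add: coset_eq_iff)
  qed
  then show ?thesis using x by (simp add: quotient_alg_simps UN_coset)
qed

lemma clinear_coset: "clinear V (quotient_alg V I) (\<lambda>x. I +> x)"
  by (rule clinearI) (simp_all add: coset_add coset_smult)

lemma cvs_quotient: "cvs (quotient_alg V I)"
proof -
  interpret Q: abelian_group "quotient_alg V I" by (rule abelian_group_coset_space)
  show ?thesis
    by unfold_locales
      (auto elim!: coset_cases simp: coset_add[symmetric] coset_smult[symmetric]
        smult_l_distr smult_r_distr smult_assoc)
qed

end

section \<open>Monoid algebras and tensor products\<close>

lemma monoid_alg_simps [simp]:
  "carrier (monoid_alg M) = {f. Poly_Mapping.keys f \<subseteq> carrier M}"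
  "f \<oplus>\<^bsub>monoid_alg M\<^esub> g = f + g" "\<zero>\<^bsub>monoid_alg M\<^esub> = 0"
  "\<one>\<^bsub>monoid_alg M\<^esub> = Poly_Mapping.single \<one>\<^bsub>M\<^esub> 1"
  "c \<odot>\<^bsub>monoid_alg M\<^esub> f = Poly_Mapping.map ((*) c) f"
  by (simp_all add: monoid_alg_def)

lemma lookup_map_times [simp]:
  fixes f :: "'a \<Rightarrow>\<^sub>0 complex"
  shows "Poly_Mapping.lookup (Poly_Mapping.map ((*) c) f) k = c * Poly_Mapping.lookup f k"
  by (simp add: Poly_Mapping.map.rep_eq when_def)

lemma keys_map_times:
  fixes f :: "'a \<Rightarrow>\<^sub>0 complex"
  shows "Poly_Mapping.keys (Poly_Mapping.map ((*) c) f) \<subseteq> Poly_Mapping.keys f"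
  by (auto simp: in_keys_iff)

lemma cvs_monoid_alg: "cvs (monoid_alg M)"
proof -
  have "abelian_group (monoid_alg M)"
  proof (rule abelian_groupI)
    show "\<exists>y\<in>carrier (monoid_alg M). y \<oplus>\<^bsub>monoid_alg M\<^esub> x = \<zero>\<^bsub>monoid_alg M\<^esub>"
      if "x \<in> carrier (monoid_alg M)" for x
      using that by (intro bexI[of _ "- x"]) (auto simp: in_keys_iff)
  qed (use Poly_Mapping.keys_add in \<open>force simp: algebra_simps\<close>)+
  then show ?thesis
    by (intro cvs.intro cvs_axioms.intro)
      (auto intro!: poly_mapping_eqI simp: lookup_add algebra_simps in_keys_iff subset_iff)
qed

text \<open>A finitely supported function is the sum over its support of multiples of point
  masses.\<close>

lemma cspan_monoid_alg:
  "cspan (monoid_alg M) {Poly_Mapping.single x 1 | x. x \<in> carrier M} = carrier (monoid_alg M)"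
proof
  interpret cvs "monoid_alg M" by (rule cvs_monoid_alg)
  let ?S = "cspan (monoid_alg M) {Poly_Mapping.single x 1 | x. x \<in> carrier M}"
  have sub: "{Poly_Mapping.single x 1 | x. x \<in> carrier M} \<subseteq> carrier (monoid_alg M)"
    by auto
  show "?S \<subseteq> carrier (monoid_alg M)"
    using cspan_closed[OF sub] .
  have S: "submodule ?S complex_alg (monoid_alg M)" by (rule submodule_cspan[OF sub])
  have single: "Poly_Mapping.single x c \<in> ?S" if "x \<in> carrier M" for x c
  proof -
    have "Poly_Mapping.single x 1 \<in> ?S" using that by (intro subsetD[OF cspan_superset]) auto
    then have "c \<odot>\<^bsub>monoid_alg M\<^esub> Poly_Mapping.single x 1 \<in> ?S" using S unfolding submodule_iff by blast
    also have "c \<odot>\<^bsub>monoid_alg M\<^esub> Poly_Mapping.single x 1 = Poly_Mapping.single x c"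
      by (rule poly_mapping_eqI) (simp add: lookup_single when_def)
    finally show ?thesis .
  qed
  have fin: "(\<Sum>x\<in>X. Poly_Mapping.single x (f x)) \<in> ?S" if "finite X" "X \<subseteq> carrier M" for X f
    using that
  proof (induction X)
    case empty
    then show ?case using S by (simp add: submodule_iff)
  next
    case (insert x X)
    then show ?case using S single[of x "f x"] by (simp add: submodule_iff)
  qed
  show "carrier (monoid_alg M) \<subseteq> ?S"
  proof
    fix f assume "f \<in> carrier (monoid_alg M)"
    then have "(\<Sum>x\<in>Poly_Mapping.keys f. Poly_Mapping.single x (Poly_Mapping.lookup f x)) \<in> ?S"
      by (intro fin) auto
    also have "(\<Sum>x\<in>Poly_Mapping.keys f. Poly_Mapping.single x (Poly_Mapping.lookup f x)) = f"
      by (rule poly_mapping_eqI) (auto simp: lookup_sum lookup_single when_def in_keys_iff)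
    finally show "f \<in> ?S" .
  qed
qed

lemma clinear_eq_monoid_alg:
  assumes "cvs W" "clinear (monoid_alg M) W f" "clinear (monoid_alg M) W g"
    and "\<And>x. x \<in> carrier M \<Longrightarrow> f (Poly_Mapping.single x 1) = g (Poly_Mapping.single x 1)"
    and "p \<in> carrier (monoid_alg M)"
  shows "f p = g p"
  by (rule clinear_eq_on_cspan[OF cvs_monoid_alg assms(1-3),
        of "{Poly_Mapping.single x 1 | x. x \<in> carrier M}"])
    (use assms(4,5) in \<open>auto simp: cspan_monoid_alg\<close>)

text \<open>This is the sum inside \<open>tlift\<close> before a representative is chosen, that is,
  the linear map on the free vector space determined by its values on the basis.\<close>

definition lin_ext :: "(complex, 'w) module \<Rightarrow> ('a \<Rightarrow> 'w) \<Rightarrow> ('a \<Rightarrow>\<^sub>0 complex) \<Rightarrow> 'w" where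
  "lin_ext W \<beta> f = (\<Oplus>\<^bsub>W\<^esub>p\<in>Poly_Mapping.keys f. Poly_Mapping.lookup f p \<odot>\<^bsub>W\<^esub> \<beta> p)"

text \<open>Terms off the support vanish, so sums over different supports can be compared over one
  common finite set. Additivity of \<open>lin_ext\<close> needs this, because the support of a sum
  may shrink by cancellation.\<close>

lemma lin_ext_superset:
  assumes "cvs W" "\<beta> \<in> X \<rightarrow> carrier W" "finite X" "Poly_Mapping.keys f \<subseteq> X"
  shows "lin_ext W \<beta> f = (\<Oplus>\<^bsub>W\<^esub>p\<in>X. Poly_Mapping.lookup f p \<odot>\<^bsub>W\<^esub> \<beta> p)"
proof -
  interpret W: cvs W by fact
  let ?g = "\<lambda>p. Poly_Mapping.lookup f p \<odot>\<^bsub>W\<^esub> \<beta> p"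
  let ?K = "Poly_Mapping.keys f"
  have "finsum W ?g (?K \<union> (X - ?K)) = finsum W ?g ?K \<oplus>\<^bsub>W\<^esub> finsum W ?g (X - ?K)"
    using assms by (intro W.finsum_Un_disjoint) auto
  moreover have "finsum W ?g (X - ?K) = \<zero>\<^bsub>W\<^esub>"
  proof -
    have "finsum W ?g (X - ?K) = finsum W (\<lambda>p. \<zero>\<^bsub>W\<^esub>) (X - ?K)"
      using assms by (intro W.finsum_cong') (auto simp: in_keys_iff Pi_def)
    then show ?thesis by simp
  qed
  moreover have "finsum W ?g ?K \<in> carrier W" using assms by (intro W.finsum_closed) auto
  moreover have "?K \<union> (X - ?K) = X" using assms by auto
  ultimately show ?thesis by (simp add: lin_ext_def)
qed

lemma clinear_lin_ext:
  assumes "cvs W" "\<beta> \<in> carrier M \<rightarrow> carrier W"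
  shows "clinear (monoid_alg M) W (lin_ext W \<beta>)"
proof -
  interpret W: cvs W by fact
  show ?thesis
  proof (rule clinearI)
    fix f c assume f: "f \<in> carrier (monoid_alg M)"
    then show "lin_ext W \<beta> f \<in> carrier W"
      using assms by (auto simp: lin_ext_def Pi_def intro!: W.finsum_closed)
    have b: "\<beta> \<in> Poly_Mapping.keys f \<rightarrow> carrier W" using f assms by auto
    have "lin_ext W \<beta> (c \<odot>\<^bsub>monoid_alg M\<^esub> f)
        = (\<Oplus>\<^bsub>W\<^esub>p\<in>Poly_Mapping.keys f. (c * Poly_Mapping.lookup f p) \<odot>\<^bsub>W\<^esub> \<beta> p)"
      using lin_ext_superset[OF assms(1) b, of "c \<odot>\<^bsub>monoid_alg M\<^esub> f"] keys_map_times[of c f]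
      by simp
    also have "\<dots> = (\<Oplus>\<^bsub>W\<^esub>p\<in>Poly_Mapping.keys f. c \<odot>\<^bsub>W\<^esub> (Poly_Mapping.lookup f p \<odot>\<^bsub>W\<^esub> \<beta> p))"
      using b by (intro W.finsum_cong') (auto simp: W.smult_assoc Pi_def)
    also have "\<dots> = c \<odot>\<^bsub>W\<^esub> lin_ext W \<beta> f"
      unfolding lin_ext_def using b by (intro W.smult_finsum[symmetric]) auto
    finally show "lin_ext W \<beta> (c \<odot>\<^bsub>monoid_alg M\<^esub> f) = c \<odot>\<^bsub>W\<^esub> lin_ext W \<beta> f" .
    fix g assume g: "g \<in> carrier (monoid_alg M)"
    let ?X = "Poly_Mapping.keys f \<union> Poly_Mapping.keys g"
    have b: "\<beta> \<in> ?X \<rightarrow> carrier W" using f g assms by auto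
    have sup: "lin_ext W \<beta> h = (\<Oplus>\<^bsub>W\<^esub>p\<in>?X. Poly_Mapping.lookup h p \<odot>\<^bsub>W\<^esub> \<beta> p)"
      if "Poly_Mapping.keys h \<subseteq> ?X" for h
      using lin_ext_superset[OF assms(1) b _ that] by simp
    have "lin_ext W \<beta> (f \<oplus>\<^bsub>monoid_alg M\<^esub> g) = (\<Oplus>\<^bsub>W\<^esub>p\<in>?X. Poly_Mapping.lookup (f + g) p \<odot>\<^bsub>W\<^esub> \<beta> p)"
      using sup[OF Poly_Mapping.keys_add] by simp
    also have "\<dots> = (\<Oplus>\<^bsub>W\<^esub>p\<in>?X. Poly_Mapping.lookup f p \<odot>\<^bsub>W\<^esub> \<beta> p \<oplus>\<^bsub>W\<^esub> Poly_Mapping.lookup g p \<odot>\<^bsub>W\<^esub> \<beta> p)"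
      using b by (intro W.finsum_cong') (auto simp: lookup_add W.smult_l_distr Pi_def)
    also have "\<dots> = lin_ext W \<beta> f \<oplus>\<^bsub>W\<^esub> lin_ext W \<beta> g"
      using b by (subst W.finsum_addf) (auto simp: sup)
    finally show "lin_ext W \<beta> (f \<oplus>\<^bsub>monoid_alg M\<^esub> g) = lin_ext W \<beta> f \<oplus>\<^bsub>W\<^esub> lin_ext W \<beta> g" .
  qed
qed

lemma lin_ext_single:
  assumes "cvs W" "\<beta> x \<in> carrier W"
  shows "lin_ext W \<beta> (Poly_Mapping.single x c) = c \<odot>\<^bsub>W\<^esub> \<beta> x"
proof -
  interpret W: cvs W by fact
  show ?thesis
    using assms lin_ext_superset[OF assms(1), of \<beta> "{x}" "Poly_Mapping.single x c"] by simp
qed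

lemma finsum_monoid_alg:
  assumes "f \<in> X \<rightarrow> carrier (monoid_alg M)"
  shows "finsum (monoid_alg M) f X = sum f X"
proof -
  interpret cvs "monoid_alg M" by (rule cvs_monoid_alg)
  show ?thesis
  proof (cases "finite X")
    case True
    then show ?thesis using assms by (induction X) (simp_all add: Pi_def)
  qed (simp add: finsum_infinite)
qed

text \<open>Written as an iterated linear extension, the convolution product is visibly linear in
  each factor, and the algebra laws reduce to the monoid laws on basis elements.\<close>

lemma mult_monoid_alg:
  assumes "monoid M" "f \<in> carrier (monoid_alg M)" "g \<in> carrier (monoid_alg M)"
  shows "f \<otimes>\<^bsub>monoid_alg M\<^esub> g = lin_ext (monoid_alg M)
     (\<lambda>x. lin_ext (monoid_alg M) (\<lambda>y. Poly_Mapping.single (x \<otimes>\<^bsub>M\<^esub> y) 1) g) f"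
proof -
  interpret M: monoid M by fact
  interpret cvs "monoid_alg M" by (rule cvs_monoid_alg)
  let ?l = "\<lambda>x. lin_ext (monoid_alg M) (\<lambda>y. Poly_Mapping.single (x \<otimes>\<^bsub>M\<^esub> y) 1) g"
  have l: "?l x = (\<Sum>y\<in>Poly_Mapping.keys g. Poly_Mapping.single (x \<otimes>\<^bsub>M\<^esub> y) (Poly_Mapping.lookup g y))"
    if "x \<in> carrier M" for x
    using that assms(3) by (subst lin_ext_def, subst finsum_monoid_alg) (auto split: if_splits)
  have lc: "?l x \<in> carrier (monoid_alg M)" if "x \<in> carrier M" for x
    using that assms(3) by (intro clinear_closed[OF clinear_lin_ext[OF cvs_monoid_alg]]) auto
  have "lin_ext (monoid_alg M) ?l f
      = (\<Sum>x\<in>Poly_Mapping.keys f. Poly_Mapping.lookup f x \<odot>\<^bsub>monoid_alg M\<^esub> ?l x)"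
    using assms(2) smult_closed[OF lc]
    by (subst lin_ext_def[of _ _ f], intro finsum_monoid_alg Pi_I) auto
  also have "\<dots> = (\<Sum>x\<in>Poly_Mapping.keys f. \<Sum>y\<in>Poly_Mapping.keys g.
      Poly_Mapping.single (x \<otimes>\<^bsub>M\<^esub> y) (Poly_Mapping.lookup f x * Poly_Mapping.lookup g y))"
  proof (rule sum.cong[OF refl])
    fix x assume "x \<in> Poly_Mapping.keys f"
    then have x: "x \<in> carrier M" using assms by auto
    show "Poly_Mapping.lookup f x \<odot>\<^bsub>monoid_alg M\<^esub> ?l x = (\<Sum>y\<in>Poly_Mapping.keys g.
        Poly_Mapping.single (x \<otimes>\<^bsub>M\<^esub> y) (Poly_Mapping.lookup f x * Poly_Mapping.lookup g y))"
      unfolding l[OF x]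
      by (rule poly_mapping_eqI) (simp add: lookup_sum lookup_single sum_distrib_left when_def if_distrib cong: if_cong)
  qed
  also have "\<dots> = f \<otimes>\<^bsub>monoid_alg M\<^esub> g" by (simp add: monoid_alg_def)
  finally show ?thesis by (rule sym)
qed

section \<open>Complex algebras and their quotients\<close>

locale calg = cvs A + ring A for A :: "(complex, 'a) module" (structure) +
  assumes smult_mult_left: "\<lbrakk>x \<in> carrier A; y \<in> carrier A\<rbrakk> \<Longrightarrow> (c \<odot> x) \<otimes> y = c \<odot> (x \<otimes> y)"
    and smult_mult_right: "\<lbrakk>x \<in> carrier A; y \<in> carrier A\<rbrakk> \<Longrightarrow> x \<otimes> (c \<odot> y) = c \<odot> (x \<otimes> y)"

lemma calg_iff_complex_algebra: "calg A \<longleftrightarrow> complex_algebra A"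
  by (auto simp: calg_def calg_axioms_def complex_algebra_def cvs_iff_module)

context calg
begin

lemma clinear_mult_left: "y \<in> carrier A \<Longrightarrow> clinear A A (\<lambda>x. x \<otimes> y)"
  by (rule clinearI) (simp_all add: l_distr smult_mult_left)

lemma clinear_mult_right: "y \<in> carrier A \<Longrightarrow> clinear A A (\<lambda>x. y \<otimes> x)"
  by (rule clinearI) (simp_all add: r_distr smult_mult_right)

lemma smult_one_mult: "x \<in> carrier A \<Longrightarrow> (c \<odot> \<one>) \<otimes> x = c \<odot> x"
  and mult_smult_one: "x \<in> carrier A \<Longrightarrow> x \<otimes> (c \<odot> \<one>) = c \<odot> x"
  by (simp_all add: smult_mult_left smult_mult_right)

end

lemma calg_monoid_alg:
  assumes "monoid M"
  shows "calg (monoid_alg M)"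
proof -
  let ?R = "monoid_alg M"
  let ?m = "\<lambda>f g. lin_ext ?R (\<lambda>x. lin_ext ?R (\<lambda>y. Poly_Mapping.single (x \<otimes>\<^bsub>M\<^esub> y) 1) g) f"
  note cv = cvs_monoid_alg[of M]
  interpret M: monoid M by fact
  interpret cvs ?R by (rule cv)
  have inner: "lin_ext ?R (\<lambda>y. Poly_Mapping.single (x \<otimes>\<^bsub>M\<^esub> y) 1) g \<in> carrier ?R"
    if "x \<in> carrier M" "g \<in> carrier ?R" for x g
    using that by (intro clinear_closed[OF clinear_lin_ext[OF cv]]) auto
  have lin_l: "clinear ?R ?R (\<lambda>f. f \<otimes>\<^bsub>?R\<^esub> g)" if g: "g \<in> carrier ?R" for g
  proof -
    have "clinear ?R ?R (\<lambda>f. ?m f g)"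
      using inner[OF _ g] by (intro clinear_lin_ext[OF cv]) auto
    then show ?thesis using mult_monoid_alg[OF assms _ g] clinear_cong[OF cv, of "\<lambda>f. f \<otimes>\<^bsub>?R\<^esub> g"] by simp
  qed
  have lin_r: "clinear ?R ?R (\<lambda>g. f \<otimes>\<^bsub>?R\<^esub> g)" if f: "f \<in> carrier ?R" for f
  proof -
    have "clinear ?R ?R (\<lambda>g. ?m f g)"
      unfolding lin_ext_def[of _ _ f]
      using f by (intro clinear_finsum_fun[OF cv] clinear_smult_left[OF cv] clinear_lin_ext[OF cv]) auto
    then show ?thesis using mult_monoid_alg[OF assms f] clinear_cong[OF cv, of "\<lambda>g. f \<otimes>\<^bsub>?R\<^esub> g"] by simp
  qed
  have single: "Poly_Mapping.single x 1 \<otimes>\<^bsub>?R\<^esub> Poly_Mapping.single y 1 = Poly_Mapping.single (x \<otimes>\<^bsub>M\<^esub> y) 1"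
    if "x \<in> carrier M" "y \<in> carrier M" for x y
    using that by (subst mult_monoid_alg[OF assms]) (auto simp: lin_ext_single[OF cv])
  have closed: "f \<otimes>\<^bsub>?R\<^esub> g \<in> carrier ?R" if "f \<in> carrier ?R" "g \<in> carrier ?R" for f g
    using clinear_closed[OF lin_l] that by blast
  note lin_lc = clinear_comp[OF _ lin_l] and lin_rc = clinear_comp[OF _ lin_r]
  have s: "Poly_Mapping.single x 1 \<in> carrier ?R" if "x \<in> carrier M" for x using that by simp
  \<comment> \<open>Associativity spreads from basis elements to arbitrary ones one argument at a
    time: the third, then the second, then the first.\<close>
  have assoc1: "(Poly_Mapping.single x 1 \<otimes>\<^bsub>?R\<^esub> Poly_Mapping.single y 1) \<otimes>\<^bsub>?R\<^esub> h
      = Poly_Mapping.single x 1 \<otimes>\<^bsub>?R\<^esub> (Poly_Mapping.single y 1 \<otimes>\<^bsub>?R\<^esub> h)"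
    if "h \<in> carrier ?R" "x \<in> carrier M" "y \<in> carrier M" for h x y
    by (rule clinear_eq_monoid_alg[OF cv lin_r lin_rc[OF lin_r]])
      (use that in \<open>simp_all add: s closed single M.m_assoc del: monoid_alg_simps(1)\<close>)
  have assoc2: "(Poly_Mapping.single x 1 \<otimes>\<^bsub>?R\<^esub> g) \<otimes>\<^bsub>?R\<^esub> h = Poly_Mapping.single x 1 \<otimes>\<^bsub>?R\<^esub> (g \<otimes>\<^bsub>?R\<^esub> h)"
    if "g \<in> carrier ?R" "h \<in> carrier ?R" "x \<in> carrier M" for g h x
    by (rule clinear_eq_monoid_alg[OF cv lin_lc[OF lin_r] lin_rc[OF lin_l]])
      (use that in \<open>simp_all add: s closed assoc1 del: monoid_alg_simps(1)\<close>)
  have assoc: "(f \<otimes>\<^bsub>?R\<^esub> g) \<otimes>\<^bsub>?R\<^esub> h = f \<otimes>\<^bsub>?R\<^esub> (g \<otimes>\<^bsub>?R\<^esub> h)"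
    if "f \<in> carrier ?R" "g \<in> carrier ?R" "h \<in> carrier ?R" for f g h
    by (rule clinear_eq_monoid_alg[OF cv lin_lc[OF lin_l] lin_l])
      (use that in \<open>simp_all add: s closed assoc2 del: monoid_alg_simps(1)\<close>)
  have one: "\<one>\<^bsub>?R\<^esub> \<in> carrier ?R" by simp
  have l_one: "\<one>\<^bsub>?R\<^esub> \<otimes>\<^bsub>?R\<^esub> f = f" if "f \<in> carrier ?R" for f
    by (rule clinear_eq_monoid_alg[OF cv lin_r clinear_id _ that])
      (use one in \<open>simp_all add: single\<close>)
  have r_one: "f \<otimes>\<^bsub>?R\<^esub> \<one>\<^bsub>?R\<^esub> = f" if "f \<in> carrier ?R" for f
    by (rule clinear_eq_monoid_alg[OF cv lin_l clinear_id _ that])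
      (use one in \<open>simp_all add: single\<close>)
  have "ring ?R"
    by (intro ringI abelian_group_axioms monoidI closed assoc one l_one r_one
        clinear_add[OF lin_l] clinear_add[OF lin_r])
  then show ?thesis
    unfolding calg_def calg_axioms_def using cv clinear_smult[OF lin_l] clinear_smult[OF lin_r] by blast
qed

lemma monoid_alg_mult_single:
  assumes "monoid M" "x \<in> carrier M" "y \<in> carrier M"
  shows "Poly_Mapping.single x c \<otimes>\<^bsub>monoid_alg M\<^esub> Poly_Mapping.single y d = Poly_Mapping.single (x \<otimes>\<^bsub>M\<^esub> y) (c * d)"
proof -
  interpret M: monoid M by fact
  show ?thesis
    using assms(2,3) by (subst mult_monoid_alg[OF assms(1)]) (auto simp: lin_ext_single[OF cvs_monoid_alg])
qed

lemma quotient_spaceI: "cvs V \<Longrightarrow> submodule I complex_alg V \<Longrightarrow> quotient_space V I"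
  by (simp add: quotient_space_def quotient_space_axioms_def)

locale quotient_calg = calg A + ideal I A for A :: "(complex, 'a) module" (structure) and I
begin

text \<open>Scalars act through the unit, \<open>c x = (c 1) x\<close>, so a ring ideal is
  automatically a linear subspace.\<close>

lemma submodule_ideal: "submodule I complex_alg A"
  unfolding submodule_iff
proof (intro conjI allI ballI)
  show "c \<odot> x \<in> I" if "x \<in> I" for c x
    using that I_l_closed[of x "c \<odot> \<one>"] a_subset smult_one_mult[of x c] by auto
qed (use a_subset in auto)

sublocale quotient_space A I
  by (intro quotient_spaceI cvs_axioms submodule_ideal)

lemma coset_mult: "x \<in> carrier A \<Longrightarrow> y \<in> carrier A \<Longrightarrow> I +> (x \<otimes> y) = (I +> x) \<otimes>\<^bsub>quotient_alg A I\<^esub> (I +> y)"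
  by (simp add: quotient_alg_simps rcoset_mult_add)

lemma coset_one: "\<one>\<^bsub>quotient_alg A I\<^esub> = I +> \<one>"
  by (simp add: quotient_alg_simps)

lemma calg_quotient: "calg (quotient_alg A I)"
proof -
  interpret Q: cvs "quotient_alg A I" by (rule cvs_quotient)
  have "ring (quotient_alg A I)"
    by (intro ringI Q.abelian_group_axioms monoidI)
      (auto elim!: coset_cases simp: coset_add[symmetric] coset_mult[symmetric] coset_one
        m_assoc l_distr r_distr)
  then show ?thesis
    unfolding calg_def calg_axioms_def
    by (auto intro!: cvs_quotient elim!: coset_cases
        simp: coset_smult[symmetric] coset_mult[symmetric] smult_mult_left smult_mult_right)
qed

end

lemma quotient_calgI: "calg A \<Longrightarrow> ideal I A \<Longrightarrow> quotient_calg A I"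
  by (simp add: quotient_calg_def)

section \<open>Bilinear maps and the universal property of the tensor product\<close>

definition cbilinear ::
  "(complex, 'a) module \<Rightarrow> (complex, 'b) module \<Rightarrow> (complex, 'w) module \<Rightarrow> ('a \<Rightarrow> 'b \<Rightarrow> 'w) \<Rightarrow> bool" where
  "cbilinear A B W \<beta> \<longleftrightarrow> (\<forall>a\<in>carrier A. clinear B W (\<beta> a)) \<and> (\<forall>b\<in>carrier B. clinear A W (\<lambda>a. \<beta> a b))"

lemma cbilinearI:
  "(\<And>a. a \<in> carrier A \<Longrightarrow> clinear B W (\<beta> a)) \<Longrightarrow> (\<And>b. b \<in> carrier B \<Longrightarrow> clinear A W (\<lambda>a. \<beta> a b))
    \<Longrightarrow> cbilinear A B W \<beta>"
  by (simp add: cbilinear_def)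

lemma cbilinearD:
  assumes "cbilinear A B W \<beta>"
  shows "a \<in> carrier A \<Longrightarrow> clinear B W (\<beta> a)" "b \<in> carrier B \<Longrightarrow> clinear A W (\<lambda>a. \<beta> a b)"
    "a \<in> carrier A \<Longrightarrow> b \<in> carrier B \<Longrightarrow> \<beta> a b \<in> carrier W"
  using assms by (auto simp: cbilinear_def intro: clinear_closed)

lemma cbilinear_comp: "cbilinear A B W \<beta> \<Longrightarrow> clinear W U F \<Longrightarrow> cbilinear A B U (\<lambda>a b. F (\<beta> a b))"
  unfolding cbilinear_def
  using clinear_comp[of B W "\<beta> _" U F] clinear_comp[of A W "\<lambda>a. \<beta> a _" U F] by blast

lemma cbilinear_cong:
  assumes "cvs A" "cvs B" "\<And>a b. a \<in> carrier A \<Longrightarrow> b \<in> carrier B \<Longrightarrow> \<beta> a b = \<gamma> a b"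
  shows "cbilinear A B W \<beta> \<longleftrightarrow> cbilinear A B W \<gamma>"
proof -
  have "clinear B W (\<beta> a) \<longleftrightarrow> clinear B W (\<gamma> a)" if "a \<in> carrier A" for a
    using assms(3) that by (intro clinear_cong[OF assms(2)])
  moreover have "clinear A W (\<lambda>a. \<beta> a b) \<longleftrightarrow> clinear A W (\<lambda>a. \<gamma> a b)" if "b \<in> carrier B" for b
    using assms(3) that by (intro clinear_cong[OF assms(1)])
  ultimately show ?thesis by (simp add: cbilinear_def)
qed

lemma (in calg) cbilinear_mult: "cbilinear A A A (\<otimes>)"
  by (intro cbilinearI clinear_mult_left clinear_mult_right)

lemma monoid_alg_minus:
  assumes "f \<in> carrier (monoid_alg M)" "g \<in> carrier (monoid_alg M)"
  shows "f \<ominus>\<^bsub>monoid_alg M\<^esub> g = f - g"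
proof -
  interpret cvs "monoid_alg M" by (rule cvs_monoid_alg)
  have "(f - g) \<in> carrier (monoid_alg M)" using assms keys_diff[of f g] by auto
  moreover have "(f - g) \<oplus>\<^bsub>monoid_alg M\<^esub> g = f" by simp
  ultimately show ?thesis
    using assms by (metis add.inv_solve_right' a_minus_def add.inv_closed a_inv_def)
qed

text \<open>The spanning set of \<open>bilinear_rels\<close> under its own name, so that a claim
  about the relations can be proved by cases over the four families.\<close>

definition bilinear_gens ::
  "(complex, 'a) module \<Rightarrow> (complex, 'b) module \<Rightarrow> ('a \<times> 'b \<Rightarrow>\<^sub>0 complex) set" where
  "bilinear_gens A B =
     {Poly_Mapping.single (a \<oplus>\<^bsub>A\<^esub> a', b) 1 - Poly_Mapping.single (a, b) 1 - Poly_Mapping.single (a', b) 1 |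
         a a' b. a \<in> carrier A \<and> a' \<in> carrier A \<and> b \<in> carrier B} \<union>
      {Poly_Mapping.single (a, b \<oplus>\<^bsub>B\<^esub> b') 1 - Poly_Mapping.single (a, b) 1 - Poly_Mapping.single (a, b') 1 |
         a b b'. a \<in> carrier A \<and> b \<in> carrier B \<and> b' \<in> carrier B} \<union>
      {Poly_Mapping.single (c \<odot>\<^bsub>A\<^esub> a, b) 1 - Poly_Mapping.single (a, b) c |
         c a b. a \<in> carrier A \<and> b \<in> carrier B} \<union>
      {Poly_Mapping.single (a, c \<odot>\<^bsub>B\<^esub> b) 1 - Poly_Mapping.single (a, b) c |
         c a b. a \<in> carrier A \<and> b \<in> carrier B}"

lemma bilinear_rels_eq: "bilinear_rels A B = cspan (monoid_alg (A \<times>\<times> B)) (bilinear_gens A B)"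
  by (simp add: bilinear_rels_def bilinear_gens_def)

lemma bilinear_gensI:
  "\<lbrakk>a \<in> carrier A; a' \<in> carrier A; b \<in> carrier B\<rbrakk> \<Longrightarrow> Poly_Mapping.single (a \<oplus>\<^bsub>A\<^esub> a', b) 1
      - Poly_Mapping.single (a, b) 1 - Poly_Mapping.single (a', b) 1 \<in> bilinear_gens A B"
  "\<lbrakk>a \<in> carrier A; b \<in> carrier B; b' \<in> carrier B\<rbrakk> \<Longrightarrow> Poly_Mapping.single (a, b \<oplus>\<^bsub>B\<^esub> b') 1
      - Poly_Mapping.single (a, b) 1 - Poly_Mapping.single (a, b') 1 \<in> bilinear_gens A B"
  "\<lbrakk>a \<in> carrier A; b \<in> carrier B\<rbrakk> \<Longrightarrow>
    Poly_Mapping.single (c \<odot>\<^bsub>A\<^esub> a, b) 1 - Poly_Mapping.single (a, b) c \<in> bilinear_gens A B"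
  "\<lbrakk>a \<in> carrier A; b \<in> carrier B\<rbrakk> \<Longrightarrow>
    Poly_Mapping.single (a, c \<odot>\<^bsub>B\<^esub> b) 1 - Poly_Mapping.single (a, b) c \<in> bilinear_gens A B"
  unfolding bilinear_gens_def by blast+

lemma bilinear_gens_cases [consumes 1, case_names add_left add_right smult_left smult_right]:
  assumes "g \<in> bilinear_gens A B"
  obtains a a' b where "a \<in> carrier A" "a' \<in> carrier A" "b \<in> carrier B"
      "g = Poly_Mapping.single (a \<oplus>\<^bsub>A\<^esub> a', b) 1 - Poly_Mapping.single (a, b) 1 - Poly_Mapping.single (a', b) 1"
    | a b b' where "a \<in> carrier A" "b \<in> carrier B" "b' \<in> carrier B"
      "g = Poly_Mapping.single (a, b \<oplus>\<^bsub>B\<^esub> b') 1 - Poly_Mapping.single (a, b) 1 - Poly_Mapping.single (a, b') 1"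
    | c a b where "a \<in> carrier A" "b \<in> carrier B"
      "g = Poly_Mapping.single (c \<odot>\<^bsub>A\<^esub> a, b) 1 - Poly_Mapping.single (a, b) c"
    | c a b where "a \<in> carrier A" "b \<in> carrier B"
      "g = Poly_Mapping.single (a, c \<odot>\<^bsub>B\<^esub> b) 1 - Poly_Mapping.single (a, b) c"
  using assms unfolding bilinear_gens_def by blast

locale tensor_space = A: cvs A + B: cvs B
  for A :: "(complex, 'a) module" and B :: "(complex, 'b) module"
begin

abbreviation "FM \<equiv> monoid_alg (A \<times>\<times> B)"

lemma single_in_FM: "a \<in> carrier A \<Longrightarrow> b \<in> carrier B \<Longrightarrow> Poly_Mapping.single (a, b) c \<in> carrier FM"
  by simp

lemma diff_in_FM: "f \<in> carrier FM \<Longrightarrow> g \<in> carrier FM \<Longrightarrow> f - g \<in> carrier FM"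
  using keys_diff[of f g] by auto

lemma bilinear_gens_closed: "bilinear_gens A B \<subseteq> carrier FM"
proof
  fix g assume "g \<in> bilinear_gens A B"
  then show "g \<in> carrier FM"
    by (cases rule: bilinear_gens_cases)
      (simp_all only: diff_in_FM single_in_FM A.a_closed B.a_closed A.smult_closed B.smult_closed)
qed

lemma submodule_bilinear_rels: "submodule (bilinear_rels A B) complex_alg FM"
  unfolding bilinear_rels_eq by (intro cvs.submodule_cspan cvs_monoid_alg bilinear_gens_closed)

lemma bilinear_gens_rels: "g \<in> bilinear_gens A B \<Longrightarrow> g \<in> bilinear_rels A B"
  unfolding bilinear_rels_eq by (rule subsetD[OF cspan_superset])

sublocale FM: quotient_space FM "bilinear_rels A B"
  by (intro quotient_spaceI cvs_monoid_alg submodule_bilinear_rels)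

lemma cvs_tensor: "cvs (tensor A B)"
  unfolding tensor_def by (rule FM.cvs_quotient)

lemma clinear_coset_tensor:
  "clinear FM (tensor A B) (\<lambda>f. bilinear_rels A B +>\<^bsub>FM\<^esub> f)"
  unfolding tensor_def by (rule FM.clinear_coset)

lemma tens_closed [simp, intro]: "a \<in> carrier A \<Longrightarrow> b \<in> carrier B \<Longrightarrow> tens A B a b \<in> carrier (tensor A B)"
  unfolding tens_def by (intro clinear_closed[OF clinear_coset_tensor] single_in_FM)

lemma coset_FM_eqI:
  assumes "f \<in> carrier FM" "g \<in> carrier FM" "f - g \<in> bilinear_rels A B"
  shows "bilinear_rels A B +>\<^bsub>FM\<^esub> f = bilinear_rels A B +>\<^bsub>FM\<^esub> g"
  using assms by (subst FM.coset_eq_iff) (simp_all only: monoid_alg_minus)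

lemma smult_tens:
  assumes "a \<in> carrier A" "b \<in> carrier B"
  shows "c \<odot>\<^bsub>tensor A B\<^esub> tens A B a b = bilinear_rels A B +>\<^bsub>FM\<^esub> Poly_Mapping.single (a, b) c"
  unfolding tens_def
  by (subst clinear_smult[OF clinear_coset_tensor, symmetric]) (use assms in simp_all)

lemma add_tens:
  assumes "a \<in> carrier A" "b \<in> carrier B" "a' \<in> carrier A" "b' \<in> carrier B"
  shows "tens A B a b \<oplus>\<^bsub>tensor A B\<^esub> tens A B a' b' =
     bilinear_rels A B +>\<^bsub>FM\<^esub> (Poly_Mapping.single (a, b) 1 + Poly_Mapping.single (a', b') 1)"
  unfolding tens_def
  by (subst clinear_add[OF clinear_coset_tensor, symmetric]) (use assms in simp_all)

lemma add_in_FM: "f \<in> carrier FM \<Longrightarrow> g \<in> carrier FM \<Longrightarrow> f + g \<in> carrier FM"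
  using Poly_Mapping.keys_add[of f g] by auto

lemma FM_a_closed: "f \<in> carrier FM \<Longrightarrow> g \<in> carrier FM \<Longrightarrow> f \<oplus>\<^bsub>FM\<^esub> g \<in> carrier FM"
  using add_in_FM by simp

lemma cbilinear_tens: "cbilinear A B (tensor A B) (tens A B)"
proof (intro cbilinearI clinearI)
  fix a b c assume ab: "a \<in> carrier A" "b \<in> carrier B"
  have "Poly_Mapping.single (a, c \<odot>\<^bsub>B\<^esub> b) 1 - Poly_Mapping.single (a, b) c \<in> bilinear_gens A B"
    using ab by (intro bilinear_gensI)
  then show "tens A B a (c \<odot>\<^bsub>B\<^esub> b) = c \<odot>\<^bsub>tensor A B\<^esub> tens A B a b"
    unfolding smult_tens[OF ab] unfolding tens_def
    by (intro coset_FM_eqI single_in_FM bilinear_gens_rels ab B.smult_closed)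
  fix b' assume b': "b' \<in> carrier B"
  have "Poly_Mapping.single (a, b \<oplus>\<^bsub>B\<^esub> b') 1 - Poly_Mapping.single (a, b) 1 - Poly_Mapping.single (a, b') 1
      \<in> bilinear_gens A B"
    using ab b' by (intro bilinear_gensI)
  then show "tens A B a (b \<oplus>\<^bsub>B\<^esub> b') = tens A B a b \<oplus>\<^bsub>tensor A B\<^esub> tens A B a b'"
    unfolding add_tens[OF ab ab(1) b'] unfolding tens_def
    by (intro coset_FM_eqI single_in_FM add_in_FM bilinear_gens_rels ab b' B.a_closed)
      (simp add: algebra_simps)
next
  fix a b c assume ab: "b \<in> carrier B" "a \<in> carrier A"
  have "Poly_Mapping.single (c \<odot>\<^bsub>A\<^esub> a, b) 1 - Poly_Mapping.single (a, b) c \<in> bilinear_gens A B"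
    using ab by (intro bilinear_gensI)
  then show "tens A B (c \<odot>\<^bsub>A\<^esub> a) b = c \<odot>\<^bsub>tensor A B\<^esub> tens A B a b"
    unfolding smult_tens[OF ab(2,1)] unfolding tens_def
    by (intro coset_FM_eqI single_in_FM bilinear_gens_rels ab A.smult_closed)
  fix a' assume a': "a' \<in> carrier A"
  have "Poly_Mapping.single (a \<oplus>\<^bsub>A\<^esub> a', b) 1 - Poly_Mapping.single (a, b) 1 - Poly_Mapping.single (a', b) 1
      \<in> bilinear_gens A B"
    using ab a' by (intro bilinear_gensI)
  then show "tens A B (a \<oplus>\<^bsub>A\<^esub> a') b = tens A B a b \<oplus>\<^bsub>tensor A B\<^esub> tens A B a' b"
    unfolding add_tens[OF ab(2,1) a' ab(1)] unfolding tens_def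
    by (intro coset_FM_eqI single_in_FM add_in_FM bilinear_gens_rels ab a' A.a_closed)
      (simp add: algebra_simps)
qed auto

lemmas clinear_tens = cbilinearD(1,2)[OF cbilinear_tens]

lemma cspan_tens:
  "cspan (tensor A B) {tens A B a b | a b. a \<in> carrier A \<and> b \<in> carrier B} = carrier (tensor A B)"
proof -
  have "carrier (tensor A B) = (\<lambda>f. bilinear_rels A B +>\<^bsub>FM\<^esub> f) ` carrier FM"
    using clinear_closed[OF clinear_coset_tensor] unfolding tensor_def by (blast elim: FM.coset_cases)
  also have "\<dots> = (\<lambda>f. bilinear_rels A B +>\<^bsub>FM\<^esub> f) `
      cspan FM {Poly_Mapping.single x 1 | x. x \<in> carrier (A \<times>\<times> B)}"
    by (simp only: cspan_monoid_alg)
  also have "\<dots> = cspan (tensor A B) ((\<lambda>f. bilinear_rels A B +>\<^bsub>FM\<^esub> f) `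
      {Poly_Mapping.single x 1 | x. x \<in> carrier (A \<times>\<times> B)})"
    by (intro cspan_image cvs_monoid_alg cvs_tensor clinear_coset_tensor) auto
  also have "((\<lambda>f. bilinear_rels A B +>\<^bsub>FM\<^esub> f) ` {Poly_Mapping.single x 1 | x. x \<in> carrier (A \<times>\<times> B)})
      = {tens A B a b | a b. a \<in> carrier A \<and> b \<in> carrier B}"
    by (auto simp: tens_def)
  finally show ?thesis by simp
qed

lemma clinear_eq_tensor:
  assumes "cvs W" "clinear (tensor A B) W F" "clinear (tensor A B) W F'"
    and "\<And>a b. a \<in> carrier A \<Longrightarrow> b \<in> carrier B \<Longrightarrow> F (tens A B a b) = F' (tens A B a b)"
    and "X \<in> carrier (tensor A B)"
  shows "F X = F' X"
  by (rule clinear_eq_on_cspan[OF cvs_tensor assms(1-3),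
        of "{tens A B a b | a b. a \<in> carrier A \<and> b \<in> carrier B}"])
    (use assms(4,5) in \<open>auto simp: cspan_tens\<close>)

text \<open>The linear extension of a bilinear map vanishes on each of the four families, hence on
  their span. It is therefore constant on cosets, and the representative picked by
  \<open>SOME\<close> does no harm.\<close>

lemma tlift_coset:
  assumes W: "cvs W" and \<beta>: "cbilinear A B W \<beta>" and f: "f \<in> carrier FM"
  shows "tlift W \<beta> (bilinear_rels A B +>\<^bsub>FM\<^esub> f) = lin_ext W (\<lambda>p. \<beta> (fst p) (snd p)) f"
proof -
  interpret W: cvs W by fact
  let ?L = "lin_ext W (\<lambda>p. \<beta> (fst p) (snd p))"
  have L: "clinear FM W ?L"
    using cbilinearD[OF \<beta>] by (intro clinear_lin_ext W) auto
  have minus: "?L (x - y) = ?L x \<ominus>\<^bsub>W\<^esub> ?L y" if "x \<in> carrier FM" "y \<in> carrier FM" for x y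
    using clinear_minus[OF cvs_monoid_alg W L that] by (simp only: monoid_alg_minus[OF that])
  have single: "?L (Poly_Mapping.single (a, b) c) = c \<odot>\<^bsub>W\<^esub> \<beta> a b" if "a \<in> carrier A" "b \<in> carrier B" for a b c
    using cbilinearD(3)[OF \<beta> that] by (subst lin_ext_single[OF W]) auto
  have sub_add: "x \<oplus>\<^bsub>W\<^esub> y \<ominus>\<^bsub>W\<^esub> x \<ominus>\<^bsub>W\<^esub> y = \<zero>\<^bsub>W\<^esub>" if "x \<in> carrier W" "y \<in> carrier W" for x y
  proof -
    have "x \<oplus>\<^bsub>W\<^esub> y \<ominus>\<^bsub>W\<^esub> x = y"
      using that by (simp add: a_minus_def W.a_comm[of x] W.a_assoc W.r_neg)
    then show ?thesis using that by (simp add: a_minus_def W.r_neg)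
  qed
  have sub_self: "x \<ominus>\<^bsub>W\<^esub> x = \<zero>\<^bsub>W\<^esub>" if "x \<in> carrier W" for x
    using that by (simp add: a_minus_def W.r_neg)
  have "?L g = \<zero>\<^bsub>W\<^esub>" if "g \<in> bilinear_gens A B" for g
    using that
  proof (cases rule: bilinear_gens_cases)
    case (add_left a a' b)
    then show ?thesis
      using cbilinearD(3)[OF \<beta>] clinear_add[OF cbilinearD(2)[OF \<beta>]]
      by (simp only: minus diff_in_FM single_in_FM A.a_closed single W.smult_one W.a_closed sub_add)
  next
    case (add_right a b b')
    then show ?thesis
      using cbilinearD(3)[OF \<beta>] clinear_add[OF cbilinearD(1)[OF \<beta>]]
      by (simp only: minus diff_in_FM single_in_FM B.a_closed single W.smult_one W.a_closed sub_add)
  next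
    case (smult_left c a b)
    then show ?thesis
      using cbilinearD(3)[OF \<beta>] clinear_smult[OF cbilinearD(2)[OF \<beta>]]
      by (simp only: minus diff_in_FM single_in_FM A.smult_closed single W.smult_one W.smult_closed sub_self)
  next
    case (smult_right c a b)
    then show ?thesis
      using cbilinearD(3)[OF \<beta>] clinear_smult[OF cbilinearD(1)[OF \<beta>]]
      by (simp only: minus diff_in_FM single_in_FM B.smult_closed single W.smult_one W.smult_closed sub_self)
  qed
  then have "bilinear_gens A B \<subseteq> {x \<in> carrier FM. ?L x \<in> {\<zero>\<^bsub>W\<^esub>}}"
    using bilinear_gens_closed by auto
  then have rels: "?L g = \<zero>\<^bsub>W\<^esub>" if "g \<in> bilinear_rels A B" for g
    using that cspan_least[OF submodule_vimage[OF cvs_monoid_alg W L, of "{\<zero>\<^bsub>W\<^esub>}"]]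
    by (auto simp: W.submodule_iff bilinear_rels_eq)
  define g where "g = (SOME g. g \<in> bilinear_rels A B +>\<^bsub>FM\<^esub> f)"
  have "f \<in> bilinear_rels A B +>\<^bsub>FM\<^esub> f" using f by (rule FM.a_rcos_self)
  then have g: "g \<in> bilinear_rels A B +>\<^bsub>FM\<^esub> f" unfolding g_def by (rule someI)
  have gc: "g \<in> carrier FM" using FM.a_elemrcos_carrier[OF f g] .
  have "g - f \<in> bilinear_rels A B"
    using FM.a_rcos_module_imp[OF f g] by (simp only: monoid_alg_minus[OF gc f, symmetric] a_minus_def)
  then have "?L g \<ominus>\<^bsub>W\<^esub> ?L f = \<zero>\<^bsub>W\<^esub>" using rels minus[OF gc f] by simp
  then have "?L g = ?L f"
    using clinear_closed[OF L gc] clinear_closed[OF L f] W.minus_eq_zero_iff by simp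
  then show ?thesis by (simp add: tlift_def g_def[symmetric] lin_ext_def)
qed

lemma clinear_tlift:
  assumes W: "cvs W" and \<beta>: "cbilinear A B W \<beta>"
  shows "clinear (tensor A B) W (tlift W \<beta>)"
proof -
  have L: "clinear FM W (lin_ext W (\<lambda>p. \<beta> (fst p) (snd p)))"
    using cbilinearD[OF \<beta>] by (intro clinear_lin_ext W) auto
  note eq = tlift_coset[OF W \<beta>]
  show ?thesis
  proof (rule clinearI)
    fix X c assume "X \<in> carrier (tensor A B)"
    then obtain f where f: "f \<in> carrier FM" "X = bilinear_rels A B +>\<^bsub>FM\<^esub> f"
      unfolding tensor_def by (rule FM.coset_cases)
    then show "tlift W \<beta> X \<in> carrier W" using clinear_closed[OF L] by (simp only: eq)
    show "tlift W \<beta> (c \<odot>\<^bsub>tensor A B\<^esub> X) = c \<odot>\<^bsub>W\<^esub> tlift W \<beta> X"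
      using f FM.smult_closed
      by (simp only: clinear_smult[OF clinear_coset_tensor, symmetric] eq clinear_smult[OF L])
    fix Y assume "Y \<in> carrier (tensor A B)"
    then obtain g where g: "g \<in> carrier FM" "Y = bilinear_rels A B +>\<^bsub>FM\<^esub> g"
      unfolding tensor_def by (rule FM.coset_cases)
    show "tlift W \<beta> (X \<oplus>\<^bsub>tensor A B\<^esub> Y) = tlift W \<beta> X \<oplus>\<^bsub>W\<^esub> tlift W \<beta> Y"
      using f g FM_a_closed
      by (simp only: clinear_add[OF clinear_coset_tensor, symmetric] eq clinear_add[OF L])
  qed
qed

lemma tlift_tens:
  assumes W: "cvs W" and \<beta>: "cbilinear A B W \<beta>" and ab: "a \<in> carrier A" "b \<in> carrier B"
  shows "tlift W \<beta> (tens A B a b) = \<beta> a b"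
proof -
  interpret W: cvs W by fact
  have "\<beta> a b \<in> carrier W" using cbilinearD(3)[OF \<beta> ab] .
  then show ?thesis
    unfolding tens_def tlift_coset[OF W \<beta> single_in_FM[OF ab]] by (subst lin_ext_single[OF W]) simp_all
qed

text \<open>This allows rewriting under a Sweedler sum. Bilinearity is asked of only one of the two
  integrands, since it passes to any function that agrees with it on the carriers.\<close>

lemma tlift_cong:
  assumes W: "cvs W" and \<beta>: "cbilinear A B W \<beta>"
    and eq: "\<And>a b. a \<in> carrier A \<Longrightarrow> b \<in> carrier B \<Longrightarrow> \<beta>' a b = \<beta> a b"
    and X: "X \<in> carrier (tensor A B)"
  shows "tlift W \<beta>' X = tlift W \<beta> X"
proof -
  have \<beta>': "cbilinear A B W \<beta>'"
    using \<beta> cbilinear_cong[of A B \<beta>' \<beta> W] A.cvs_axioms B.cvs_axioms eq by blast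
  show ?thesis
    by (rule clinear_eq_tensor[OF W clinear_tlift[OF W \<beta>'] clinear_tlift[OF W \<beta>] _ X])
      (simp add: tlift_tens[OF W \<beta>'] tlift_tens[OF W \<beta>] eq)
qed

lemma clinear_tlift_comp:
  assumes W: "cvs W" "cvs U" and \<beta>: "cbilinear A B W \<beta>" and F: "clinear W U F"
    and X: "X \<in> carrier (tensor A B)"
  shows "F (tlift W \<beta> X) = tlift U (\<lambda>a b. F (\<beta> a b)) X"
  by (rule clinear_eq_tensor[OF W(2) clinear_comp[OF clinear_tlift[OF W(1) \<beta>] F]
        clinear_tlift[OF W(2) cbilinear_comp[OF \<beta> F]] _ X])
    (simp add: tlift_tens[OF W(1) \<beta>] tlift_tens[OF W(2) cbilinear_comp[OF \<beta> F]])

lemma tensor_subI: "a \<in> U \<Longrightarrow> b \<in> V \<Longrightarrow> tens A B a b \<in> tensor_sub A B U V"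
  unfolding tensor_sub_def by (rule subsetD[OF cspan_superset]) auto

lemma submodule_tensor_sub:
  assumes "U \<subseteq> carrier A" "V \<subseteq> carrier B"
  shows "submodule (tensor_sub A B U V) complex_alg (tensor A B)"
  unfolding tensor_sub_def using assms
  by (intro cvs.submodule_cspan[OF cvs_tensor]) auto

end

lemma tensor_spaceI: "cvs A \<Longrightarrow> cvs B \<Longrightarrow> tensor_space A B"
  by (simp add: tensor_space_def)

text \<open>An integrand depending linearly on a parameter has a lift depending linearly on it. This
  is what gives nested Sweedler sums a bilinear outer integrand.\<close>

lemma cbilinear_tlift:
  assumes "cvs A" "cvs B" "cvs C" "cvs W"
    and "\<And>c. c \<in> carrier C \<Longrightarrow> cbilinear A B W (\<lambda>a b. \<gamma> c a b)"
    and "\<And>a b. a \<in> carrier A \<Longrightarrow> b \<in> carrier B \<Longrightarrow> clinear C W (\<lambda>c. \<gamma> c a b)"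
  shows "cbilinear C (tensor A B) W (\<lambda>c. tlift W (\<gamma> c))"
proof -
  interpret tensor_space A B using assms by (intro tensor_spaceI)
  interpret C: cvs C by fact
  interpret W: cvs W by fact
  interpret T: cvs "tensor A B" by (rule cvs_tensor)
  note lin = clinear_tlift[OF assms(4,5)] and val = tlift_tens[OF assms(4,5)]
  show ?thesis
  proof (rule cbilinearI)
    show "clinear (tensor A B) W (tlift W (\<gamma> c))" if "c \<in> carrier C" for c
      using lin[OF that] .
    show "clinear C W (\<lambda>c. tlift W (\<gamma> c) X)" if X: "X \<in> carrier (tensor A B)" for X
    proof (rule clinearI)
      fix c d r assume c: "c \<in> carrier C"
      then show "tlift W (\<gamma> c) X \<in> carrier W" using clinear_closed[OF lin X] by simp
      show "tlift W (\<gamma> (r \<odot>\<^bsub>C\<^esub> c)) X = r \<odot>\<^bsub>W\<^esub> tlift W (\<gamma> c) X"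
        by (rule clinear_eq_tensor[OF assms(4) lin clinear_smult_left[OF assms(4) lin] _ X])
          (use c in \<open>simp_all add: val clinear_smult[OF assms(6)]\<close>)
      assume d: "d \<in> carrier C"
      have add: "clinear (tensor A B) W (\<lambda>X. tlift W (\<gamma> c) X \<oplus>\<^bsub>W\<^esub> tlift W (\<gamma> d) X)"
        using lin[OF c] lin[OF d]
        by (intro clinearI) (simp_all add: clinear_def Pi_def W.a_ac W.smult_r_distr)
      show "tlift W (\<gamma> (c \<oplus>\<^bsub>C\<^esub> d)) X = tlift W (\<gamma> c) X \<oplus>\<^bsub>W\<^esub> tlift W (\<gamma> d) X"
        by (rule clinear_eq_tensor[OF assms(4) lin add _ X])
          (use c d in \<open>simp_all add: val clinear_add[OF assms(6)]\<close>)
    qed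
  qed
qed

section \<open>The product on the tensor product of two algebras\<close>

lemma bilinear_gens_mult:
  assumes "calg A" "calg B" "a \<in> carrier A" "b \<in> carrier B" "g \<in> bilinear_gens A B"
  shows "Poly_Mapping.single (a, b) 1 \<otimes>\<^bsub>monoid_alg (A \<times>\<times> B)\<^esub> g \<in> bilinear_gens A B"
    and "g \<otimes>\<^bsub>monoid_alg (A \<times>\<times> B)\<^esub> Poly_Mapping.single (a, b) 1 \<in> bilinear_gens A B"
proof -
  interpret A: calg A by fact
  interpret B: calg B by fact
  interpret tensor_space A B by (intro tensor_spaceI A.cvs_axioms B.cvs_axioms)
  have M: "monoid (A \<times>\<times> B)" by (intro DirProd_monoid A.monoid_axioms B.monoid_axioms)
  interpret R: calg FM by (rule calg_monoid_alg[OF M])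
  have diff_r: "x \<otimes>\<^bsub>FM\<^esub> (f - g) = x \<otimes>\<^bsub>FM\<^esub> f - x \<otimes>\<^bsub>FM\<^esub> g"
    and diff_l: "(f - g) \<otimes>\<^bsub>FM\<^esub> x = f \<otimes>\<^bsub>FM\<^esub> x - g \<otimes>\<^bsub>FM\<^esub> x"
    if "x \<in> carrier FM" "f \<in> carrier FM" "g \<in> carrier FM" for x f g
    using clinear_minus[OF cvs_monoid_alg cvs_monoid_alg R.clinear_mult_right[OF that(1)] that(2,3)]
      clinear_minus[OF cvs_monoid_alg cvs_monoid_alg R.clinear_mult_left[OF that(1)] that(2,3)]
      that R.m_closed by (simp_all only: monoid_alg_minus)
  have single: "Poly_Mapping.single (a, b) c \<otimes>\<^bsub>FM\<^esub> Poly_Mapping.single (a', b') d =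
      Poly_Mapping.single (a \<otimes>\<^bsub>A\<^esub> a', b \<otimes>\<^bsub>B\<^esub> b') (c * d)"
    if "a \<in> carrier A" "a' \<in> carrier A" "b \<in> carrier B" "b' \<in> carrier B" for a a' b b' c d
    using that monoid_alg_mult_single[OF M, of "(a, b)" "(a', b')"] by simp
  note rules = diff_in_FM single_in_FM A.a_closed B.a_closed A.smult_closed B.smult_closed
    diff_r diff_l single A.r_distr A.l_distr B.r_distr B.l_distr A.smult_mult_left A.smult_mult_right
    B.smult_mult_left B.smult_mult_right assms(3,4) mult_1_left mult_1_right
  show "Poly_Mapping.single (a, b) 1 \<otimes>\<^bsub>FM\<^esub> g \<in> bilinear_gens A B"
    using assms(5) by (cases rule: bilinear_gens_cases)
      (simp_all only: rules bilinear_gensI A.m_closed B.m_closed)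
  show "g \<otimes>\<^bsub>FM\<^esub> Poly_Mapping.single (a, b) 1 \<in> bilinear_gens A B"
    using assms(5) by (cases rule: bilinear_gens_cases)
      (simp_all only: rules bilinear_gensI A.m_closed B.m_closed)
qed

text \<open>Multiplying a bilinearity relation by a basis element \<open>(a, b)\<close> on either
  side gives a relation of the same family, by distributivity in \<open>A\<close> and
  \<open>B\<close>. Linearity in the relation and then in the multiplier extends this to all
  products.\<close>

lemma ideal_bilinear_rels:
  assumes "calg A" "calg B"
  shows "ideal (bilinear_rels A B) (monoid_alg (A \<times>\<times> B))"
proof -
  interpret A: calg A by fact
  interpret B: calg B by fact
  interpret tensor_space A B by (intro tensor_spaceI A.cvs_axioms B.cvs_axioms)
  have M: "monoid (A \<times>\<times> B)" by (intro DirProd_monoid A.monoid_axioms B.monoid_axioms)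
  interpret R: calg FM by (rule calg_monoid_alg[OF M])
  note cv = cvs_monoid_alg
  have gen: "{Poly_Mapping.single x 1 | x. x \<in> carrier (A \<times>\<times> B)} \<subseteq> {x \<in> carrier FM. F x \<in> bilinear_rels A B}"
    if "\<And>a b. a \<in> carrier A \<Longrightarrow> b \<in> carrier B \<Longrightarrow> F (Poly_Mapping.single (a, b) 1) \<in> bilinear_rels A B" for F
    using that by auto
  have all: "F x \<in> bilinear_rels A B"
    if "clinear FM FM F"
      "\<And>a b. a \<in> carrier A \<Longrightarrow> b \<in> carrier B \<Longrightarrow> F (Poly_Mapping.single (a, b) 1) \<in> bilinear_rels A B"
      "x \<in> carrier FM" for F x
    using cspan_least[OF submodule_vimage[OF cv cv that(1) submodule_bilinear_rels] gen[of F]] that(2,3)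
    unfolding cspan_monoid_alg by blast
  have rels: "F g \<in> bilinear_rels A B"
    if "clinear FM FM F" "\<And>g. g \<in> bilinear_gens A B \<Longrightarrow> F g \<in> bilinear_gens A B" "g \<in> bilinear_rels A B" for F g
  proof -
    have "bilinear_gens A B \<subseteq> {x \<in> carrier FM. F x \<in> bilinear_rels A B}"
      using that(2) bilinear_gens_closed bilinear_gens_rels by blast
    then show ?thesis
      using cspan_least[OF submodule_vimage[OF cv cv that(1) submodule_bilinear_rels], of "bilinear_gens A B"] that(3)
      unfolding bilinear_rels_eq by blast
  qed
  have rc: "g \<in> bilinear_rels A B \<Longrightarrow> g \<in> carrier FM" for g
    using FM.a_subset by blast
  show ?thesis
  proof (rule idealI)
    show "ring FM" by (rule R.ring_axioms)
    show "subgroup (bilinear_rels A B) (add_monoid FM)"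
      using submodule_bilinear_rels by (rule submodule.axioms)
    fix g x assume g: "g \<in> bilinear_rels A B" and x: "x \<in> carrier FM"
    show "x \<otimes>\<^bsub>FM\<^esub> g \<in> bilinear_rels A B"
    proof (rule all[OF R.clinear_mult_left[OF rc[OF g]] _ x])
      fix a b assume ab: "a \<in> carrier A" "b \<in> carrier B"
      show "Poly_Mapping.single (a, b) 1 \<otimes>\<^bsub>FM\<^esub> g \<in> bilinear_rels A B"
        by (rule rels[OF R.clinear_mult_right[OF single_in_FM[OF ab]] bilinear_gens_mult(1)[OF assms ab] g])
    qed
    show "g \<otimes>\<^bsub>FM\<^esub> x \<in> bilinear_rels A B"
    proof (rule all[OF R.clinear_mult_right[OF rc[OF g]] _ x])
      fix a b assume ab: "a \<in> carrier A" "b \<in> carrier B"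
      show "g \<otimes>\<^bsub>FM\<^esub> Poly_Mapping.single (a, b) 1 \<in> bilinear_rels A B"
        by (rule rels[OF R.clinear_mult_left[OF single_in_FM[OF ab]] bilinear_gens_mult(2)[OF assms ab] g])
    qed
  qed
qed

lemma
  assumes "calg A" "calg B"
  shows calg_tensor: "calg (tensor A B)"
    and one_tensor: "\<one>\<^bsub>tensor A B\<^esub> = tens A B \<one>\<^bsub>A\<^esub> \<one>\<^bsub>B\<^esub>"
    and mult_tens: "\<lbrakk>a \<in> carrier A; b \<in> carrier B; a' \<in> carrier A; b' \<in> carrier B\<rbrakk>
      \<Longrightarrow> tens A B a b \<otimes>\<^bsub>tensor A B\<^esub> tens A B a' b' = tens A B (a \<otimes>\<^bsub>A\<^esub> a') (b \<otimes>\<^bsub>B\<^esub> b')"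
proof -
  interpret A: calg A by fact
  interpret B: calg B by fact
  interpret tensor_space A B by (intro tensor_spaceI A.cvs_axioms B.cvs_axioms)
  have M: "monoid (A \<times>\<times> B)" by (intro DirProd_monoid A.monoid_axioms B.monoid_axioms)
  interpret R: quotient_calg FM "bilinear_rels A B"
    by (intro quotient_calgI calg_monoid_alg M ideal_bilinear_rels assms)
  show "calg (tensor A B)" unfolding tensor_def by (rule R.calg_quotient)
  show "\<one>\<^bsub>tensor A B\<^esub> = tens A B \<one>\<^bsub>A\<^esub> \<one>\<^bsub>B\<^esub>" unfolding tensor_def tens_def by (simp add: R.coset_one)
  show "\<lbrakk>a \<in> carrier A; b \<in> carrier B; a' \<in> carrier A; b' \<in> carrier B\<rbrakk>
      \<Longrightarrow> tens A B a b \<otimes>\<^bsub>tensor A B\<^esub> tens A B a' b' = tens A B (a \<otimes>\<^bsub>A\<^esub> a') (b \<otimes>\<^bsub>B\<^esub> b')"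
    unfolding tensor_def tens_def using monoid_alg_mult_single[OF M, of "(a, b)" "(a', b')" 1 1]
    by (subst R.coset_mult[symmetric]) simp_all
qed

section \<open>First-order calculi and their quotients\<close>

locale calculus = A: calg A + abelian_group \<Gamma>
  for A :: "(complex, 'a) module" and \<Gamma> :: "('a, 'm) fodc" (structure) +
  assumes lsmult_closed: "\<lbrakk>a \<in> carrier A; m \<in> carrier \<Gamma>\<rbrakk> \<Longrightarrow> a \<odot> m \<in> carrier \<Gamma>"
    and rsmult_closed: "\<lbrakk>a \<in> carrier A; m \<in> carrier \<Gamma>\<rbrakk> \<Longrightarrow> rsmult \<Gamma> m a \<in> carrier \<Gamma>"
    and lsmult_r_distr: "\<lbrakk>a \<in> carrier A; m \<in> carrier \<Gamma>; n \<in> carrier \<Gamma>\<rbrakk> \<Longrightarrow> a \<odot> (m \<oplus> n) = a \<odot> m \<oplus> a \<odot> n"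
    and rsmult_l_distr: "\<lbrakk>a \<in> carrier A; m \<in> carrier \<Gamma>; n \<in> carrier \<Gamma>\<rbrakk>
      \<Longrightarrow> rsmult \<Gamma> (m \<oplus> n) a = rsmult \<Gamma> m a \<oplus> rsmult \<Gamma> n a"
    and lsmult_l_distr: "\<lbrakk>a \<in> carrier A; b \<in> carrier A; m \<in> carrier \<Gamma>\<rbrakk>
      \<Longrightarrow> (a \<oplus>\<^bsub>A\<^esub> b) \<odot> m = a \<odot> m \<oplus> b \<odot> m"
    and rsmult_r_distr: "\<lbrakk>a \<in> carrier A; b \<in> carrier A; m \<in> carrier \<Gamma>\<rbrakk>
      \<Longrightarrow> rsmult \<Gamma> m (a \<oplus>\<^bsub>A\<^esub> b) = rsmult \<Gamma> m a \<oplus> rsmult \<Gamma> m b"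
    and lsmult_mult: "\<lbrakk>a \<in> carrier A; b \<in> carrier A; m \<in> carrier \<Gamma>\<rbrakk> \<Longrightarrow> (a \<otimes>\<^bsub>A\<^esub> b) \<odot> m = a \<odot> (b \<odot> m)"
    and rsmult_mult: "\<lbrakk>a \<in> carrier A; b \<in> carrier A; m \<in> carrier \<Gamma>\<rbrakk>
      \<Longrightarrow> rsmult \<Gamma> m (a \<otimes>\<^bsub>A\<^esub> b) = rsmult \<Gamma> (rsmult \<Gamma> m a) b"
    and lsmult_rsmult: "\<lbrakk>a \<in> carrier A; b \<in> carrier A; m \<in> carrier \<Gamma>\<rbrakk>
      \<Longrightarrow> rsmult \<Gamma> (a \<odot> m) b = a \<odot> rsmult \<Gamma> m b"
    and lsmult_one: "m \<in> carrier \<Gamma> \<Longrightarrow> \<one>\<^bsub>A\<^esub> \<odot> m = m"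
    and rsmult_one: "m \<in> carrier \<Gamma> \<Longrightarrow> rsmult \<Gamma> m \<one>\<^bsub>A\<^esub> = m"
    and scalar_central: "m \<in> carrier \<Gamma> \<Longrightarrow> (c \<odot>\<^bsub>A\<^esub> \<one>\<^bsub>A\<^esub>) \<odot> m = rsmult \<Gamma> m (c \<odot>\<^bsub>A\<^esub> \<one>\<^bsub>A\<^esub>)"
    and diff_closed: "a \<in> carrier A \<Longrightarrow> diff \<Gamma> a \<in> carrier \<Gamma>"
    and diff_add: "\<lbrakk>a \<in> carrier A; b \<in> carrier A\<rbrakk> \<Longrightarrow> diff \<Gamma> (a \<oplus>\<^bsub>A\<^esub> b) = diff \<Gamma> a \<oplus> diff \<Gamma> b"
    and diff_mult: "\<lbrakk>a \<in> carrier A; b \<in> carrier A\<rbrakk>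
      \<Longrightarrow> diff \<Gamma> (a \<otimes>\<^bsub>A\<^esub> b) = rsmult \<Gamma> (diff \<Gamma> a) b \<oplus> a \<odot> diff \<Gamma> b"
    and diff_smult: "a \<in> carrier A \<Longrightarrow> diff \<Gamma> (c \<odot>\<^bsub>A\<^esub> a) = (c \<odot>\<^bsub>A\<^esub> \<one>\<^bsub>A\<^esub>) \<odot> diff \<Gamma> a"
    and generated: "carrier \<Gamma> = generate (add_monoid \<Gamma>) {a \<odot> diff \<Gamma> b | a b. a \<in> carrier A \<and> b \<in> carrier A}"

lemma calculus_imp_first_order_calculus: "calculus A \<Gamma> \<Longrightarrow> first_order_calculus A \<Gamma>"
  by (simp add: calculus_def calculus_axioms_def first_order_calculus_def Pi_def)

locale subcalculus = calculus A \<Gamma> for A and \<Gamma> :: "('a, 'm) fodc" (structure) and W +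
  assumes subbimodule: "subbimodule A \<Gamma> W"
begin

sublocale coset_space W \<Gamma> "quotient_calculus \<Gamma> W"
proof -
  have "abelian_subgroup W \<Gamma>"
    using subbimodule by (intro abelian_subgroupI3 additive_subgroup.intro abelian_group_axioms) (simp add: subbimodule_def)
  then show "coset_space W \<Gamma> (quotient_calculus \<Gamma> W)"
    by (simp add: coset_space_def coset_space_axioms_def quotient_calculus_def)
qed

lemma lsmult_W: "a \<in> carrier A \<Longrightarrow> w \<in> W \<Longrightarrow> a \<odot> w \<in> W"
  and rsmult_W: "a \<in> carrier A \<Longrightarrow> w \<in> W \<Longrightarrow> rsmult \<Gamma> w a \<in> W"
  using subbimodule by (auto simp: subbimodule_def)

text \<open>An additive map that preserves \<open>W\<close> descends to the cosets of
  \<open>W\<close>; the left and the right action on the quotient are both instances.\<close>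

lemma UN_coset_additive:
  assumes f: "\<And>x. x \<in> carrier \<Gamma> \<Longrightarrow> f x \<in> carrier \<Gamma>" "\<And>w. w \<in> W \<Longrightarrow> f w \<in> W"
    and add: "\<And>x y. x \<in> carrier \<Gamma> \<Longrightarrow> y \<in> carrier \<Gamma> \<Longrightarrow> f (x \<oplus> y) = f x \<oplus> f y"
    and m: "m \<in> carrier \<Gamma>"
  shows "(\<Union>x\<in>W +> m. W +> f x) = W +> f m"
proof (rule UN_coset[OF m])
  fix x assume x: "x \<in> carrier \<Gamma>" "x \<ominus> m \<in> W"
  have "f (x \<ominus> m) \<oplus> f m = f x"
    using add[of "x \<ominus> m" m] x m by (simp add: a_minus_def a_assoc l_neg)
  then have "f x \<ominus> f m = (f (x \<ominus> m) \<oplus> f m) \<ominus> f m" by simp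
  also have "\<dots> = f (x \<ominus> m)"
    using x m f(1)[of m] f(1)[of "x \<ominus> m"] by (simp add: a_minus_def a_assoc r_neg)
  finally have "f x \<ominus> f m = f (x \<ominus> m)" .
  then show "W +> f x = W +> f m" using x m f by (simp add: coset_eq_iff)
qed

lemma coset_lsmult:
  assumes "a \<in> carrier A" "m \<in> carrier \<Gamma>"
  shows "W +> (a \<odot> m) = a \<odot>\<^bsub>quotient_calculus \<Gamma> W\<^esub> (W +> m)"
  using UN_coset_additive[of "\<lambda>x. a \<odot> x" m] assms
  by (simp add: quotient_calculus_def lsmult_closed lsmult_W lsmult_r_distr)

lemma coset_rsmult:
  assumes "a \<in> carrier A" "m \<in> carrier \<Gamma>"
  shows "W +> rsmult \<Gamma> m a = rsmult (quotient_calculus \<Gamma> W) (W +> m) a"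
  using UN_coset_additive[of "\<lambda>x. rsmult \<Gamma> x a" m] assms
  by (simp add: quotient_calculus_def rsmult_closed rsmult_W rsmult_l_distr)

lemma coset_diff: "diff (quotient_calculus \<Gamma> W) a = W +> diff \<Gamma> a"
  by (simp add: quotient_calculus_def)

lemma calculus_quotient: "calculus A (quotient_calculus \<Gamma> W)"
proof -
  let ?Q = "quotient_calculus \<Gamma> W"
  interpret Q: abelian_group ?Q by (rule abelian_group_coset_space)
  note simps = coset_add[symmetric] coset_lsmult[symmetric] coset_rsmult[symmetric] coset_diff
    lsmult_closed rsmult_closed lsmult_r_distr lsmult_l_distr rsmult_r_distr rsmult_l_distr lsmult_mult
    rsmult_mult lsmult_rsmult lsmult_one rsmult_one scalar_central diff_closed diff_add diff_mult diff_smult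
  \<comment> \<open>The coset map is a surjective homomorphism of additive groups, so it carries the
    subgroup generated by the forms \<open>a db\<close> onto the one generated by their
    cosets.\<close>
  have "group_hom (add_monoid \<Gamma>) (add_monoid ?Q) (\<lambda>m. W +> m)"
    by (intro group_hom.intro group_hom_axioms.intro a_group Q.a_group homI) (simp_all add: coset_add)
  then have "generate (add_monoid ?Q) ((\<lambda>m. W +> m) ` {a \<odot> diff \<Gamma> b | a b. a \<in> carrier A \<and> b \<in> carrier A})
      = (\<lambda>m. W +> m) ` carrier \<Gamma>"
    by (subst generated, intro group_hom.generate_img) (auto simp: lsmult_closed diff_closed)
  moreover have "(\<lambda>m. W +> m) ` {a \<odot> diff \<Gamma> b | a b. a \<in> carrier A \<and> b \<in> carrier A}
      = {a \<odot>\<^bsub>?Q\<^esub> diff ?Q b | a b. a \<in> carrier A \<and> b \<in> carrier A}" (is "?l = ?r")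
  proof -
    have "W +> (a \<odot> diff \<Gamma> b) = a \<odot>\<^bsub>?Q\<^esub> diff ?Q b" if "a \<in> carrier A" "b \<in> carrier A" for a b
      using that by (simp add: simps)
    then show ?thesis by (auto simp: image_iff) blast
  qed
  moreover have "(\<lambda>m. W +> m) ` carrier \<Gamma> = carrier ?Q"
    by (auto elim: coset_cases)
  ultimately have gen: "carrier ?Q = generate (add_monoid ?Q) {a \<odot>\<^bsub>?Q\<^esub> diff ?Q b | a b. a \<in> carrier A \<and> b \<in> carrier A}"
    by simp
  show ?thesis
    by (intro calculus.intro calculus_axioms.intro A.calg_axioms Q.abelian_group_axioms gen)
      (auto elim!: coset_cases simp: simps)
qed

end

lemma subcalculusI: "calculus A \<Gamma> \<Longrightarrow> subbimodule A \<Gamma> W \<Longrightarrow> subcalculus A \<Gamma> W"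
  by (simp add: subcalculus_def subcalculus_axioms_def)

text \<open>The relation \<open>calculus_isomorphic\<close> with its witness exposed: a basis must
  be transported along a map whose values on the basis forms are known.\<close>

definition calculus_iso ::
  "(complex, 'a) module \<Rightarrow> ('a, 'm) fodc \<Rightarrow> ('a, 'n) fodc \<Rightarrow> ('m \<Rightarrow> 'n) \<Rightarrow> bool" where
  "calculus_iso A \<Gamma> \<Gamma>' \<phi> \<longleftrightarrow> bij_betw \<phi> (carrier \<Gamma>) (carrier \<Gamma>') \<and>
     (\<forall>m\<in>carrier \<Gamma>. \<forall>n\<in>carrier \<Gamma>. \<phi> (m \<oplus>\<^bsub>\<Gamma>\<^esub> n) = \<phi> m \<oplus>\<^bsub>\<Gamma>'\<^esub> \<phi> n) \<and>
     (\<forall>a\<in>carrier A. \<forall>m\<in>carrier \<Gamma>.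
        \<phi> (a \<odot>\<^bsub>\<Gamma>\<^esub> m) = a \<odot>\<^bsub>\<Gamma>'\<^esub> \<phi> m \<and> \<phi> (rsmult \<Gamma> m a) = rsmult \<Gamma>' (\<phi> m) a) \<and>
     (\<forall>h\<in>carrier A. \<phi> (diff \<Gamma> h) = diff \<Gamma>' h)"

lemma calculus_isomorphicI: "calculus_iso A \<Gamma> \<Gamma>' \<phi> \<Longrightarrow> calculus_isomorphic A \<Gamma> \<Gamma>'"
  unfolding calculus_isomorphic_def calculus_iso_def by blast

text \<open>The isomorphism from \<open>\<Gamma>/P\<close> to \<open>(\<Gamma>/N)/(P/N)\<close>
  sends the class of \<open>x\<close> to the class of its class. This formula is part of the
  conclusion because the position of the basis forms is read off from it.\<close>

lemma third_isomorphism: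
  assumes "calculus A \<Gamma>" and N: "subbimodule A \<Gamma> N" and P: "subbimodule A \<Gamma> P" and "N \<subseteq> P"
  defines "PN \<equiv> (\<lambda>p. N +>\<^bsub>\<Gamma>\<^esub> p) ` P"
  shows "subbimodule A (quotient_calculus \<Gamma> N) PN"
    and "\<exists>\<phi>. calculus_iso A (quotient_calculus \<Gamma> P) (quotient_calculus (quotient_calculus \<Gamma> N) PN) \<phi> \<and>
      (\<forall>x\<in>carrier \<Gamma>. \<phi> (P +>\<^bsub>\<Gamma>\<^esub> x) = PN +>\<^bsub>quotient_calculus \<Gamma> N\<^esub> (N +>\<^bsub>\<Gamma>\<^esub> x))"
proof -
  interpret N: subcalculus A \<Gamma> N using assms by (intro subcalculusI)
  interpret P: subcalculus A \<Gamma> P using assms by (intro subcalculusI)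
  let ?Q = "quotient_calculus \<Gamma> N"
  interpret Q: calculus A ?Q by (rule N.calculus_quotient)
  have Pc: "P \<subseteq> carrier \<Gamma>" by (rule P.a_subset)
  have "group_hom (add_monoid \<Gamma>) (add_monoid ?Q) (\<lambda>m. N +>\<^bsub>\<Gamma>\<^esub> m)"
    by (intro group_hom.intro group_hom_axioms.intro N.a_group Q.a_group homI) (simp_all add: N.coset_add)
  then have "subgroup PN (add_monoid ?Q)"
    unfolding PN_def by (rule group_hom.subgroup_img_is_subgroup[OF _ conjunct1[OF P[unfolded subbimodule_def]]])
  moreover have "a \<odot>\<^bsub>?Q\<^esub> w \<in> PN \<and> rsmult ?Q w a \<in> PN" if "a \<in> carrier A" "w \<in> PN" for a w
    using that Pc P.lsmult_W P.rsmult_W unfolding PN_def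
    by (auto simp: N.coset_lsmult[symmetric] N.coset_rsmult[symmetric] subset_iff)
  ultimately show sub: "subbimodule A ?Q PN" by (simp add: subbimodule_def)
  interpret PN: subcalculus A ?Q PN by (intro subcalculusI N.calculus_quotient sub)
  let ?R = "quotient_calculus ?Q PN"
  \<comment> \<open>Because \<open>N \<subseteq> P\<close>, changing a representative modulo
    \<open>N\<close> does not affect membership in \<open>P\<close>. This yields both injectivity
    and independence of representatives.\<close>
  have PN_iff: "N +>\<^bsub>\<Gamma>\<^esub> x \<in> PN \<longleftrightarrow> x \<in> P" if x: "x \<in> carrier \<Gamma>" for x
  proof
    assume "N +>\<^bsub>\<Gamma>\<^esub> x \<in> PN"
    then obtain p where p: "p \<in> P" "N +>\<^bsub>\<Gamma>\<^esub> x = N +>\<^bsub>\<Gamma>\<^esub> p" by (auto simp: PN_def)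
    then have "x \<ominus>\<^bsub>\<Gamma>\<^esub> p \<in> P" using x Pc \<open>N \<subseteq> P\<close> N.coset_eq_iff[of x p] by blast
    then have "(x \<ominus>\<^bsub>\<Gamma>\<^esub> p) \<oplus>\<^bsub>\<Gamma>\<^esub> p \<in> P" using p by (intro P.a_closed)
    then show "x \<in> P" using x p Pc by (simp add: a_minus_def N.a_assoc N.l_neg subset_iff)
  qed (auto simp: PN_def)
  define \<phi> where "\<phi> X = (\<Union>x\<in>X. PN +>\<^bsub>?Q\<^esub> (N +>\<^bsub>\<Gamma>\<^esub> x))" for X
  have coset_minus: "N +>\<^bsub>\<Gamma>\<^esub> (x \<ominus>\<^bsub>\<Gamma>\<^esub> y) = (N +>\<^bsub>\<Gamma>\<^esub> x) \<ominus>\<^bsub>?Q\<^esub> (N +>\<^bsub>\<Gamma>\<^esub> y)"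
    if "x \<in> carrier \<Gamma>" "y \<in> carrier \<Gamma>" for x y
  proof -
    have "(N +>\<^bsub>\<Gamma>\<^esub> (x \<ominus>\<^bsub>\<Gamma>\<^esub> y)) \<oplus>\<^bsub>?Q\<^esub> (N +>\<^bsub>\<Gamma>\<^esub> y) = N +>\<^bsub>\<Gamma>\<^esub> x"
      using that by (simp add: N.coset_add[symmetric] a_minus_def N.a_assoc N.l_neg)
    then show ?thesis
      using that by (metis N.coset_closed N.minus_closed Q.add.inv_solve_right a_minus_def a_inv_def Q.add.inv_closed)
  qed
  have R_eq_iff: "PN +>\<^bsub>?Q\<^esub> (N +>\<^bsub>\<Gamma>\<^esub> x) = PN +>\<^bsub>?Q\<^esub> (N +>\<^bsub>\<Gamma>\<^esub> y) \<longleftrightarrow> x \<ominus>\<^bsub>\<Gamma>\<^esub> y \<in> P"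
    if "x \<in> carrier \<Gamma>" "y \<in> carrier \<Gamma>" for x y
    using that by (simp add: PN.coset_eq_iff coset_minus[symmetric] PN_iff)
  have \<phi>: "\<phi> (P +>\<^bsub>\<Gamma>\<^esub> x) = PN +>\<^bsub>?Q\<^esub> (N +>\<^bsub>\<Gamma>\<^esub> x)" if "x \<in> carrier \<Gamma>" for x
    unfolding \<phi>_def using that by (intro P.UN_coset) (simp_all add: R_eq_iff)
  have bij: "bij_betw \<phi> (carrier (quotient_calculus \<Gamma> P)) (carrier ?R)"
  proof (rule bij_betwI')
    show "\<phi> X = \<phi> Y \<longleftrightarrow> X = Y"
      if X: "X \<in> carrier (quotient_calculus \<Gamma> P)" and Y: "Y \<in> carrier (quotient_calculus \<Gamma> P)" for X Y
    proof -
      obtain x where "x \<in> carrier \<Gamma>" "X = P +>\<^bsub>\<Gamma>\<^esub> x" using X by (rule P.coset_cases)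
      moreover obtain y where "y \<in> carrier \<Gamma>" "Y = P +>\<^bsub>\<Gamma>\<^esub> y" using Y by (rule P.coset_cases)
      ultimately show ?thesis by (simp add: \<phi> R_eq_iff P.coset_eq_iff)
    qed
    show "\<phi> X \<in> carrier ?R" if "X \<in> carrier (quotient_calculus \<Gamma> P)" for X
      using that by (auto elim!: P.coset_cases simp: \<phi>)
    show "\<exists>X\<in>carrier (quotient_calculus \<Gamma> P). Y = \<phi> X" if Y: "Y \<in> carrier ?R" for Y
    proof -
      obtain y where "y \<in> carrier ?Q" "Y = PN +>\<^bsub>?Q\<^esub> y" using Y by (rule PN.coset_cases)
      moreover from this obtain x where "x \<in> carrier \<Gamma>" "y = N +>\<^bsub>\<Gamma>\<^esub> x" by (auto elim: N.coset_cases)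
      ultimately show ?thesis by (intro bexI[of _ "P +>\<^bsub>\<Gamma>\<^esub> x"]) (simp_all add: \<phi>)
    qed
  qed
  have add: "\<phi> (X \<oplus>\<^bsub>quotient_calculus \<Gamma> P\<^esub> Y) = \<phi> X \<oplus>\<^bsub>?R\<^esub> \<phi> Y"
    if "X \<in> carrier (quotient_calculus \<Gamma> P)" "Y \<in> carrier (quotient_calculus \<Gamma> P)" for X Y
    using that by (auto elim!: P.coset_cases simp: P.coset_add[symmetric] \<phi> N.coset_add PN.coset_add)
  have smult: "\<phi> (a \<odot>\<^bsub>quotient_calculus \<Gamma> P\<^esub> X) = a \<odot>\<^bsub>?R\<^esub> \<phi> X
      \<and> \<phi> (rsmult (quotient_calculus \<Gamma> P) X a) = rsmult ?R (\<phi> X) a"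
    if "a \<in> carrier A" "X \<in> carrier (quotient_calculus \<Gamma> P)" for a X
    using that by (auto elim!: P.coset_cases simp: P.coset_lsmult[symmetric] P.coset_rsmult[symmetric] \<phi>
        N.coset_lsmult PN.coset_lsmult N.coset_rsmult PN.coset_rsmult N.lsmult_closed N.rsmult_closed)
  have diff: "\<phi> (diff (quotient_calculus \<Gamma> P) h) = diff ?R h" if "h \<in> carrier A" for h
    using that by (simp add: P.coset_diff PN.coset_diff N.coset_diff \<phi> N.diff_closed)
  have "calculus_iso A (quotient_calculus \<Gamma> P) ?R \<phi>"
    unfolding calculus_iso_def by (intro conjI ballI bij add smult[THEN conjunct1] smult[THEN conjunct2] diff)
  then show "\<exists>\<phi>. calculus_iso A (quotient_calculus \<Gamma> P) ?R \<phi> \<and>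
      (\<forall>x\<in>carrier \<Gamma>. \<phi> (P +>\<^bsub>\<Gamma>\<^esub> x) = PN +>\<^bsub>?Q\<^esub> (N +>\<^bsub>\<Gamma>\<^esub> x))"
    using \<phi> by (intro exI[of _ \<phi>] conjI ballI)
qed


section \<open>Bases\<close>

text \<open>Freeness for an indexed family. Compared with \<open>left_module_basis\<close> it
  transports along isomorphisms without any question of coinciding members; coefficients are
  compared only on \<open>J\<close>, so they need not be extensional.\<close>

definition free_family ::
  "(complex, 'a) module \<Rightarrow> ('a, 'm) fodc \<Rightarrow> 'j set \<Rightarrow> ('j \<Rightarrow> 'm) \<Rightarrow> bool" where
  "free_family A \<Gamma> J f \<longleftrightarrow> finite J \<and> f \<in> J \<rightarrow> carrier \<Gamma> \<and>
     (\<forall>m\<in>carrier \<Gamma>. \<exists>c\<in>J \<rightarrow> carrier A. m = (\<Oplus>\<^bsub>\<Gamma>\<^esub>j\<in>J. c j \<odot>\<^bsub>\<Gamma>\<^esub> f j)) \<and>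
     (\<forall>c\<in>J \<rightarrow> carrier A. \<forall>c'\<in>J \<rightarrow> carrier A.
        (\<Oplus>\<^bsub>\<Gamma>\<^esub>j\<in>J. c j \<odot>\<^bsub>\<Gamma>\<^esub> f j) = (\<Oplus>\<^bsub>\<Gamma>\<^esub>j\<in>J. c' j \<odot>\<^bsub>\<Gamma>\<^esub> f j) \<longrightarrow> (\<forall>j\<in>J. c j = c' j))"

lemma (in calculus) lsmult_zero: "m \<in> carrier \<Gamma> \<Longrightarrow> \<zero>\<^bsub>A\<^esub> \<odot> m = \<zero>"
  using lsmult_l_distr[of "\<zero>\<^bsub>A\<^esub>" "\<zero>\<^bsub>A\<^esub>" m] lsmult_closed[of "\<zero>\<^bsub>A\<^esub>" m] by simp

text \<open>If two members with different indices coincided, two different Kronecker delta families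
  would represent the same form; \<open>1 \<noteq> 0\<close> excludes this. The family is then
  injective, and sums over \<open>J\<close> become sums over its image.\<close>

lemma (in calculus) free_family_basis:
  assumes "free_family A \<Gamma> J f" and nontriv: "\<one>\<^bsub>A\<^esub> \<noteq> \<zero>\<^bsub>A\<^esub>"
  shows "left_module_basis A \<Gamma> (f ` J)" and "card (f ` J) = card J"
proof -
  have fin: "finite J" and f: "\<And>j. j \<in> J \<Longrightarrow> f j \<in> carrier \<Gamma>"
    and span: "\<And>m. m \<in> carrier \<Gamma> \<Longrightarrow> \<exists>c\<in>J \<rightarrow> carrier A. m = (\<Oplus>j\<in>J. c j \<odot> f j)"
    and indep: "\<And>c c' j. c \<in> J \<rightarrow> carrier A \<Longrightarrow> c' \<in> J \<rightarrow> carrier A \<Longrightarrow>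
       (\<Oplus>j\<in>J. c j \<odot> f j) = (\<Oplus>j\<in>J. c' j \<odot> f j) \<Longrightarrow> j \<in> J \<Longrightarrow> c j = c' j"
    using assms(1) unfolding free_family_def by (auto simp: Pi_def)
  have delta: "(\<Oplus>j\<in>J. (if i = j then \<one>\<^bsub>A\<^esub> else \<zero>\<^bsub>A\<^esub>) \<odot> f j) = f i" if "i \<in> J" for i
  proof -
    have "(\<Oplus>j\<in>J. (if i = j then \<one>\<^bsub>A\<^esub> else \<zero>\<^bsub>A\<^esub>) \<odot> f j) = (\<Oplus>j\<in>J. if i = j then f j else \<zero>)"
      using f by (intro finsum_cong') (auto simp: lsmult_one lsmult_zero)
    then show ?thesis using f finsum_singleton[OF that fin, of f] by auto
  qed
  have inj: "inj_on f J"
  proof (rule inj_onI, rule ccontr)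
    fix i k assume "i \<in> J" "k \<in> J" "f i = f k" "i \<noteq> k"
    then show False
      using indep[of "\<lambda>j. if i = j then \<one>\<^bsub>A\<^esub> else \<zero>\<^bsub>A\<^esub>" "\<lambda>j. if k = j then \<one>\<^bsub>A\<^esub> else \<zero>\<^bsub>A\<^esub>" i] nontriv delta
      by auto
  qed
  then show "card (f ` J) = card J" by (rule card_image)
  have reindex: "(\<Oplus>b\<in>f ` J. c b \<odot> b) = (\<Oplus>j\<in>J. c (f j) \<odot> f j)" if "c \<in> f ` J \<rightarrow> carrier A" for c
    using inj that f by (intro finsum_reindex) (auto intro!: lsmult_closed)
  show "left_module_basis A \<Gamma> (f ` J)"
    unfolding left_module_basis_def
  proof (intro conjI ballI)
    fix m assume m: "m \<in> carrier \<Gamma>"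
    obtain c where c: "c \<in> J \<rightarrow> carrier A" "m = (\<Oplus>j\<in>J. c j \<odot> f j)" using span[OF m] by blast
    \<comment> \<open>The restriction makes the coefficient function extensional, as the uniqueness
      in \<open>left_module_basis\<close> requires.\<close>
    let ?c = "restrict (\<lambda>b. c (inv_into J f b)) (f ` J)"
    show "\<exists>!c. c \<in> f ` J \<rightarrow>\<^sub>E carrier A \<and> m = (\<Oplus>b\<in>f ` J. c b \<odot> b)"
    proof (rule ex1I[of _ ?c], intro conjI)
      show cc: "?c \<in> f ` J \<rightarrow>\<^sub>E carrier A" using c inj by auto
      have "(\<Oplus>b\<in>f ` J. ?c b \<odot> b) = (\<Oplus>j\<in>J. ?c (f j) \<odot> f j)"
        using cc by (intro reindex) auto
      also have "\<dots> = (\<Oplus>j\<in>J. c j \<odot> f j)"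
        using c f inj by (intro finsum_cong') (auto intro!: lsmult_closed)
      finally show "m = (\<Oplus>b\<in>f ` J. ?c b \<odot> b)" using c by simp
      fix d assume d: "d \<in> f ` J \<rightarrow>\<^sub>E carrier A \<and> m = (\<Oplus>b\<in>f ` J. d b \<odot> b)"
      then have "d \<in> f ` J \<rightarrow> carrier A" by auto
      then have "(\<Oplus>j\<in>J. d (f j) \<odot> f j) = (\<Oplus>j\<in>J. c j \<odot> f j)"
        using reindex[of d] c d by simp
      then have "d (f j) = c j" if "j \<in> J" for j
        using indep[of "\<lambda>j. d (f j)" c j] c(1) d that by auto
      then show "d = ?c"
        using d inj by (intro extensionalityI[of _ "f ` J"]) (auto simp: PiE_def)
    qed
  qed (use fin f in auto)
qed

lemma additive_finsum:
  assumes "abelian_group G" "abelian_group H"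
    and \<phi>: "\<And>x. x \<in> carrier G \<Longrightarrow> \<phi> x \<in> carrier H"
      "\<And>x y. x \<in> carrier G \<Longrightarrow> y \<in> carrier G \<Longrightarrow> \<phi> (x \<oplus>\<^bsub>G\<^esub> y) = \<phi> x \<oplus>\<^bsub>H\<^esub> \<phi> y"
    and g: "finite J" "g \<in> J \<rightarrow> carrier G"
  shows "\<phi> (\<Oplus>\<^bsub>G\<^esub>j\<in>J. g j) = (\<Oplus>\<^bsub>H\<^esub>j\<in>J. \<phi> (g j))"
proof -
  interpret G: abelian_group G by fact
  interpret H: abelian_group H by fact
  have z: "\<phi> \<zero>\<^bsub>G\<^esub> = \<zero>\<^bsub>H\<^esub>"
    using \<phi>(2)[of "\<zero>\<^bsub>G\<^esub>" "\<zero>\<^bsub>G\<^esub>"] \<phi>(1)[of "\<zero>\<^bsub>G\<^esub>"] by simp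
  show ?thesis
    using g
  proof (induction J)
    case (insert x J)
    then have "\<phi> (g x \<oplus>\<^bsub>G\<^esub> finsum G g J) = \<phi> (g x) \<oplus>\<^bsub>H\<^esub> \<phi> (finsum G g J)"
      by (intro \<phi>(2)) auto
    with insert show ?case using \<phi>(1) by (subst G.finsum_insert H.finsum_insert; auto simp: Pi_def)+
  qed (simp add: z)
qed

lemma free_family_iso:
  assumes "calculus A \<Gamma>" "calculus A \<Gamma>'" and iso: "calculus_iso A \<Gamma> \<Gamma>' \<phi>" and free: "free_family A \<Gamma> J f"
  shows "free_family A \<Gamma>' J (\<lambda>j. \<phi> (f j))"
proof -
  interpret G: calculus A \<Gamma> by fact
  interpret H: calculus A \<Gamma>' by fact
  have bij: "bij_betw \<phi> (carrier \<Gamma>) (carrier \<Gamma>')"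
    and add: "\<And>m n. m \<in> carrier \<Gamma> \<Longrightarrow> n \<in> carrier \<Gamma> \<Longrightarrow> \<phi> (m \<oplus>\<^bsub>\<Gamma>\<^esub> n) = \<phi> m \<oplus>\<^bsub>\<Gamma>'\<^esub> \<phi> n"
    and smult: "\<And>a m. a \<in> carrier A \<Longrightarrow> m \<in> carrier \<Gamma> \<Longrightarrow> \<phi> (a \<odot>\<^bsub>\<Gamma>\<^esub> m) = a \<odot>\<^bsub>\<Gamma>'\<^esub> \<phi> m"
    using iso unfolding calculus_iso_def by auto
  have fin: "finite J" and f: "\<And>j. j \<in> J \<Longrightarrow> f j \<in> carrier \<Gamma>"
    and span: "\<And>m. m \<in> carrier \<Gamma> \<Longrightarrow> \<exists>c\<in>J \<rightarrow> carrier A. m = (\<Oplus>\<^bsub>\<Gamma>\<^esub>j\<in>J. c j \<odot>\<^bsub>\<Gamma>\<^esub> f j)"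
    and indep: "\<And>c c' j. c \<in> J \<rightarrow> carrier A \<Longrightarrow> c' \<in> J \<rightarrow> carrier A \<Longrightarrow>
       (\<Oplus>\<^bsub>\<Gamma>\<^esub>j\<in>J. c j \<odot>\<^bsub>\<Gamma>\<^esub> f j) = (\<Oplus>\<^bsub>\<Gamma>\<^esub>j\<in>J. c' j \<odot>\<^bsub>\<Gamma>\<^esub> f j) \<Longrightarrow> j \<in> J \<Longrightarrow> c j = c' j"
    using free unfolding free_family_def by (auto simp: Pi_def)
  have closed: "\<phi> m \<in> carrier \<Gamma>'" if "m \<in> carrier \<Gamma>" for m using bij that by (auto simp: bij_betw_def)
  have sum: "\<phi> (\<Oplus>\<^bsub>\<Gamma>\<^esub>j\<in>J. c j \<odot>\<^bsub>\<Gamma>\<^esub> f j) = (\<Oplus>\<^bsub>\<Gamma>'\<^esub>j\<in>J. c j \<odot>\<^bsub>\<Gamma>'\<^esub> \<phi> (f j))"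
    and sum_closed: "(\<Oplus>\<^bsub>\<Gamma>\<^esub>j\<in>J. c j \<odot>\<^bsub>\<Gamma>\<^esub> f j) \<in> carrier \<Gamma>" if "c \<in> J \<rightarrow> carrier A" for c
  proof -
    have c: "(\<lambda>j. c j \<odot>\<^bsub>\<Gamma>\<^esub> f j) \<in> J \<rightarrow> carrier \<Gamma>" using that f by (auto intro!: G.lsmult_closed)
    then show "(\<Oplus>\<^bsub>\<Gamma>\<^esub>j\<in>J. c j \<odot>\<^bsub>\<Gamma>\<^esub> f j) \<in> carrier \<Gamma>" by (rule G.finsum_closed)
    have "\<phi> (\<Oplus>\<^bsub>\<Gamma>\<^esub>j\<in>J. c j \<odot>\<^bsub>\<Gamma>\<^esub> f j) = (\<Oplus>\<^bsub>\<Gamma>'\<^esub>j\<in>J. \<phi> (c j \<odot>\<^bsub>\<Gamma>\<^esub> f j))"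
      by (intro additive_finsum G.abelian_group_axioms H.abelian_group_axioms closed add fin c)
    also have "\<dots> = (\<Oplus>\<^bsub>\<Gamma>'\<^esub>j\<in>J. c j \<odot>\<^bsub>\<Gamma>'\<^esub> \<phi> (f j))"
      using that f by (intro H.finsum_cong') (auto simp: smult Pi_iff intro!: H.lsmult_closed closed)
    finally show "\<phi> (\<Oplus>\<^bsub>\<Gamma>\<^esub>j\<in>J. c j \<odot>\<^bsub>\<Gamma>\<^esub> f j) = (\<Oplus>\<^bsub>\<Gamma>'\<^esub>j\<in>J. c j \<odot>\<^bsub>\<Gamma>'\<^esub> \<phi> (f j))" .
  qed
  show ?thesis
    unfolding free_family_def
  proof (intro conjI ballI impI fin)
    show "(\<lambda>j. \<phi> (f j)) \<in> J \<rightarrow> carrier \<Gamma>'" using f closed by auto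
    show "\<exists>c\<in>J \<rightarrow> carrier A. m = (\<Oplus>\<^bsub>\<Gamma>'\<^esub>j\<in>J. c j \<odot>\<^bsub>\<Gamma>'\<^esub> \<phi> (f j))" if m: "m \<in> carrier \<Gamma>'" for m
    proof -
      obtain n where n: "n \<in> carrier \<Gamma>" "m = \<phi> n" using m bij by (auto simp: bij_betw_def)
      then show ?thesis using span[OF n(1)] sum by metis
    qed
    fix c c' j assume c: "c \<in> J \<rightarrow> carrier A" "c' \<in> J \<rightarrow> carrier A" "j \<in> J"
      and eq: "(\<Oplus>\<^bsub>\<Gamma>'\<^esub>j\<in>J. c j \<odot>\<^bsub>\<Gamma>'\<^esub> \<phi> (f j)) = (\<Oplus>\<^bsub>\<Gamma>'\<^esub>j\<in>J. c' j \<odot>\<^bsub>\<Gamma>'\<^esub> \<phi> (f j))"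
    then show "c j = c' j"
      using bij sum_closed[of c] sum_closed[of c'] indep[OF c(1,2) _ c(3)]
      by (auto simp: sum[symmetric] bij_betw_def inj_on_def)
  qed
qed


lemma (in calculus) free_family_cong:
  assumes "free_family A \<Gamma> J f" and eq: "\<And>j. j \<in> J \<Longrightarrow> f j = g j"
  shows "free_family A \<Gamma> J g"
proof -
  have f: "f \<in> J \<rightarrow> carrier \<Gamma>" using assms(1) by (simp add: free_family_def)
  have sum: "(\<Oplus>j\<in>J. c j \<odot> g j) = (\<Oplus>j\<in>J. c j \<odot> f j)" if "c \<in> J \<rightarrow> carrier A" for c
    using that f eq by (intro finsum_cong') (auto intro!: lsmult_closed)
  show ?thesis
    unfolding free_family_def
  proof (intro conjI ballI impI)
    show "finite J" "g \<in> J \<rightarrow> carrier \<Gamma>" using assms(1) f eq by (auto simp: free_family_def Pi_iff)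
    show "\<exists>c\<in>J \<rightarrow> carrier A. m = (\<Oplus>j\<in>J. c j \<odot> g j)" if m: "m \<in> carrier \<Gamma>" for m
    proof -
      obtain c where "c \<in> J \<rightarrow> carrier A" "m = (\<Oplus>j\<in>J. c j \<odot> f j)"
        using assms(1) m unfolding free_family_def by blast
      then show ?thesis using sum by (intro bexI[of _ c]) simp_all
    qed
    show "c j = c' j" if c: "c \<in> J \<rightarrow> carrier A" "c' \<in> J \<rightarrow> carrier A"
      and "(\<Oplus>j\<in>J. c j \<odot> g j) = (\<Oplus>j\<in>J. c' j \<odot> g j)" "j \<in> J" for c c' j
    proof -
      have "(\<Oplus>j\<in>J. c j \<odot> f j) = (\<Oplus>j\<in>J. c' j \<odot> f j)" using that sum[OF c(1)] sum[OF c(2)] by simp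
      then show ?thesis using assms(1) c \<open>j \<in> J\<close> unfolding free_family_def by blast
    qed
  qed
qed

lemma (in calculus) cvs_complex_space: "cvs (complex_space A \<Gamma>)"
proof -
  let ?C = "complex_space A \<Gamma>"
  have simps: "carrier ?C = carrier \<Gamma>" "add ?C = add \<Gamma>" "\<zero>\<^bsub>?C\<^esub> = \<zero>" "c \<odot>\<^bsub>?C\<^esub> m = (c \<odot>\<^bsub>A\<^esub> \<one>\<^bsub>A\<^esub>) \<odot> m" for c m
    by (simp_all add: complex_space_def)
  have "abelian_group ?C"
  proof (rule abelian_groupI)
    show "\<exists>y\<in>carrier ?C. y \<oplus>\<^bsub>?C\<^esub> x = \<zero>\<^bsub>?C\<^esub>" if "x \<in> carrier ?C" for x
      using that by (intro bexI[of _ "\<ominus> x"]) (simp_all add: simps l_neg)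
  qed (simp_all add: simps a_ac)
  moreover have "(c * d) \<odot>\<^bsub>A\<^esub> \<one>\<^bsub>A\<^esub> = (c \<odot>\<^bsub>A\<^esub> \<one>\<^bsub>A\<^esub>) \<otimes>\<^bsub>A\<^esub> (d \<odot>\<^bsub>A\<^esub> \<one>\<^bsub>A\<^esub>)" for c d
    by (simp add: A.smult_one_mult A.smult_assoc)
  ultimately show ?thesis
    by (intro cvs.intro cvs_axioms.intro)
      (simp_all add: simps lsmult_closed lsmult_r_distr lsmult_l_distr[symmetric] A.smult_l_distr lsmult_mult lsmult_one)
qed


section \<open>The universal calculus\<close>

text \<open>Kept apart from \<open>calg\<close>, which would otherwise be declared a sublocale of itself without end.\<close>

locale calg_tensor_square = calg
begin

section \<open>Left and right multiplication on \<open>A \<otimes> A\<close>\<close>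

abbreviation "T \<equiv> tensor A A"

sublocale TS: tensor_space A A
  by (intro tensor_spaceI cvs_axioms)

sublocale T: calg T
  by (intro calg_tensor calg_axioms)

abbreviation lact :: "'a \<Rightarrow> ('a \<times> 'a \<Rightarrow>\<^sub>0 complex) set \<Rightarrow> ('a \<times> 'a \<Rightarrow>\<^sub>0 complex) set" where
  "lact a \<equiv> tlift T (\<lambda>x y. tens A A (a \<otimes> x) y)"

abbreviation ract :: "('a \<times> 'a \<Rightarrow>\<^sub>0 complex) set \<Rightarrow> 'a \<Rightarrow> ('a \<times> 'a \<Rightarrow>\<^sub>0 complex) set" where
  "ract X b \<equiv> tlift T (\<lambda>x y. tens A A x (y \<otimes> b)) X"

lemma cbilinear_lact: "a \<in> carrier A \<Longrightarrow> cbilinear A A T (\<lambda>x y. tens A A (a \<otimes> x) y)"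
  by (intro cbilinearI TS.clinear_tens clinear_comp[OF clinear_mult_right TS.clinear_tens(2)]) simp_all

lemma cbilinear_ract: "b \<in> carrier A \<Longrightarrow> cbilinear A A T (\<lambda>x y. tens A A x (y \<otimes> b))"
  by (intro cbilinearI TS.clinear_tens clinear_comp[OF clinear_mult_left TS.clinear_tens(1)]) simp_all

lemma cbilinear_lact_tensor: "cbilinear A T T lact"
  by (rule cbilinear_tlift[OF cvs_axioms cvs_axioms cvs_axioms T.cvs_axioms cbilinear_lact])
    (simp_all add: clinear_comp[OF clinear_mult_left TS.clinear_tens(2)])

lemma cbilinear_ract_tensor: "cbilinear A T T (\<lambda>b X. ract X b)"
  by (rule cbilinear_tlift[OF cvs_axioms cvs_axioms cvs_axioms T.cvs_axioms cbilinear_ract])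
    (simp_all add: clinear_comp[OF clinear_mult_right TS.clinear_tens(1)])

lemmas clinear_lact = cbilinearD(1)[OF cbilinear_lact_tensor]
lemmas clinear_lact_left = cbilinearD(2)[OF cbilinear_lact_tensor]
lemmas lact_closed = cbilinearD(3)[OF cbilinear_lact_tensor]
lemmas clinear_ract = cbilinearD(1)[OF cbilinear_ract_tensor]
lemmas clinear_ract_left = cbilinearD(2)[OF cbilinear_ract_tensor]
lemmas ract_closed = cbilinearD(3)[OF cbilinear_ract_tensor]

lemma lact_tens: "\<lbrakk>a \<in> carrier A; x \<in> carrier A; y \<in> carrier A\<rbrakk> \<Longrightarrow> lact a (tens A A x y) = tens A A (a \<otimes> x) y"
  by (simp add: TS.tlift_tens[OF T.cvs_axioms cbilinear_lact])

lemma ract_tens: "\<lbrakk>b \<in> carrier A; x \<in> carrier A; y \<in> carrier A\<rbrakk> \<Longrightarrow> ract (tens A A x y) b = tens A A x (y \<otimes> b)"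
  by (simp add: TS.tlift_tens[OF T.cvs_axioms cbilinear_ract])

lemmas clinear_eq_T = TS.clinear_eq_tensor[OF T.cvs_axioms]

lemma lact_mult:
  assumes "a \<in> carrier A" "b \<in> carrier A" "X \<in> carrier T"
  shows "lact (a \<otimes> b) X = lact a (lact b X)"
  by (rule clinear_eq_T[OF clinear_lact clinear_comp[OF clinear_lact clinear_lact] _ assms(3)])
    (use assms in \<open>simp_all add: lact_tens m_assoc\<close>)

lemma ract_mult:
  assumes "a \<in> carrier A" "b \<in> carrier A" "X \<in> carrier T"
  shows "ract X (a \<otimes> b) = ract (ract X a) b"
  by (rule clinear_eq_T[OF clinear_ract clinear_comp[OF clinear_ract clinear_ract] _ assms(3)])
    (use assms in \<open>simp_all add: ract_tens m_assoc\<close>)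

lemma lact_ract:
  assumes "a \<in> carrier A" "b \<in> carrier A" "X \<in> carrier T"
  shows "ract (lact a X) b = lact a (ract X b)"
  by (rule clinear_eq_T[OF clinear_comp[OF clinear_lact clinear_ract] clinear_comp[OF clinear_ract clinear_lact] _ assms(3)])
    (use assms in \<open>simp_all add: ract_tens lact_tens\<close>)

lemma lact_scalar:
  assumes "X \<in> carrier T"
  shows "lact (c \<odot> \<one>) X = c \<odot>\<^bsub>T\<^esub> X"
  by (rule clinear_eq_T[OF clinear_lact clinear_smult_left[OF T.cvs_axioms clinear_id] _ assms])
    (simp_all add: lact_tens smult_one_mult clinear_smult[OF TS.clinear_tens(2)])

lemma ract_scalar:
  assumes "X \<in> carrier T"
  shows "ract X (c \<odot> \<one>) = c \<odot>\<^bsub>T\<^esub> X"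
  by (rule clinear_eq_T[OF clinear_ract clinear_smult_left[OF T.cvs_axioms clinear_id] _ assms])
    (simp_all add: ract_tens mult_smult_one clinear_smult[OF TS.clinear_tens(1)])

lemma lact_one: "X \<in> carrier T \<Longrightarrow> lact \<one> X = X"
  and ract_one: "X \<in> carrier T \<Longrightarrow> ract X \<one> = X"
  using lact_scalar[of X 1] ract_scalar[of X 1] by simp_all

section \<open>The kernel of the multiplication as a calculus\<close>

abbreviation "mult_map \<equiv> tlift A (\<otimes>)"

lemma clinear_mult_map: "clinear T A mult_map"
  by (rule TS.clinear_tlift[OF cvs_axioms cbilinear_mult])

lemma mult_map_tens: "\<lbrakk>a \<in> carrier A; b \<in> carrier A\<rbrakk> \<Longrightarrow> mult_map (tens A A a b) = a \<otimes> b"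
  by (rule TS.tlift_tens[OF cvs_axioms cbilinear_mult])

lemma mult_map_lact:
  assumes "a \<in> carrier A" "X \<in> carrier T"
  shows "mult_map (lact a X) = a \<otimes> mult_map X"
  by (rule TS.clinear_eq_tensor[OF cvs_axioms clinear_comp[OF clinear_lact clinear_mult_map]
        clinear_comp[OF clinear_mult_map clinear_mult_right] _ assms(2)])
    (use assms in \<open>simp_all add: lact_tens mult_map_tens m_assoc\<close>)

lemma mult_map_ract:
  assumes "b \<in> carrier A" "X \<in> carrier T"
  shows "mult_map (ract X b) = mult_map X \<otimes> b"
  by (rule TS.clinear_eq_tensor[OF cvs_axioms clinear_comp[OF clinear_ract clinear_mult_map]
        clinear_comp[OF clinear_mult_map clinear_mult_left] _ assms(2)])
    (use assms in \<open>simp_all add: ract_tens mult_map_tens m_assoc\<close>)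

abbreviation "uc \<equiv> universal_calculus A"

lemma universal_calculus_simps:
  "carrier uc = {X \<in> carrier T. mult_map X = \<zero>}" "add uc = add T" "\<zero>\<^bsub>uc\<^esub> = \<zero>\<^bsub>T\<^esub>"
  "smult uc = lact" "rsmult uc = ract"
  "diff uc = (\<lambda>h. tens A A \<one> h \<ominus>\<^bsub>T\<^esub> tens A A h \<one>)"
  by (simp_all add: universal_calculus_def)

lemma abelian_group_universal: "abelian_group uc"
proof (rule abelian_groupI)
  show "x \<oplus>\<^bsub>uc\<^esub> y \<in> carrier uc" if "x \<in> carrier uc" "y \<in> carrier uc" for x y
    using that by (simp add: universal_calculus_simps clinear_add[OF clinear_mult_map])
  show "\<exists>y\<in>carrier uc. y \<oplus>\<^bsub>uc\<^esub> x = \<zero>\<^bsub>uc\<^esub>" if "x \<in> carrier uc" for x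
  proof
    show "(- 1) \<odot>\<^bsub>T\<^esub> x \<in> carrier uc"
      using that by (simp add: universal_calculus_simps(1) clinear_smult[OF clinear_mult_map])
    show "(- 1) \<odot>\<^bsub>T\<^esub> x \<oplus>\<^bsub>uc\<^esub> x = \<zero>\<^bsub>uc\<^esub>"
      using that by (simp add: universal_calculus_simps(1-3) T.smult_minus_one T.l_neg)
  qed
qed (simp_all add: universal_calculus_simps clinear_zero[OF T.cvs_axioms cvs_axioms clinear_mult_map] T.a_ac)

lemma clinear_diff_univ: "clinear A T (diff uc)"
proof -
  have "clinear T T (\<lambda>X. X)" by (rule clinear_id)
  show ?thesis
  proof (rule clinearI)
    fix x y c assume x: "x \<in> carrier A"
    then show "diff uc x \<in> carrier T" by (simp add: universal_calculus_simps)
    have "c \<odot>\<^bsub>T\<^esub> (X \<ominus>\<^bsub>T\<^esub> Y) = c \<odot>\<^bsub>T\<^esub> X \<ominus>\<^bsub>T\<^esub> c \<odot>\<^bsub>T\<^esub> Y" if "X \<in> carrier T" "Y \<in> carrier T" for X Y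
      using clinear_minus[OF T.cvs_axioms T.cvs_axioms clinear_smult_left[OF T.cvs_axioms clinear_id] that] .
    then show "diff uc (c \<odot> x) = c \<odot>\<^bsub>T\<^esub> diff uc x"
      using x by (simp add: universal_calculus_simps clinear_smult[OF TS.clinear_tens(1)] clinear_smult[OF TS.clinear_tens(2)])
    have "(X \<oplus>\<^bsub>T\<^esub> X') \<ominus>\<^bsub>T\<^esub> (Y \<oplus>\<^bsub>T\<^esub> Y') = (X \<ominus>\<^bsub>T\<^esub> Y) \<oplus>\<^bsub>T\<^esub> (X' \<ominus>\<^bsub>T\<^esub> Y')"
      if "X \<in> carrier T" "Y \<in> carrier T" "X' \<in> carrier T" "Y' \<in> carrier T" for X X' Y Y'
      using that by (simp add: a_minus_def T.minus_add T.a_ac)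
    moreover assume "y \<in> carrier A"
    ultimately show "diff uc (x \<oplus> y) = diff uc x \<oplus>\<^bsub>T\<^esub> diff uc y"
      using x by (simp add: universal_calculus_simps clinear_add[OF TS.clinear_tens(1)] clinear_add[OF TS.clinear_tens(2)])
  qed
qed

lemma lact_diff:
  assumes "a \<in> carrier A" "b \<in> carrier A"
  shows "lact a (diff uc b) = tens A A a b \<ominus>\<^bsub>T\<^esub> tens A A (a \<otimes> b) \<one>"
  using assms
  by (simp add: universal_calculus_simps clinear_minus[OF T.cvs_axioms T.cvs_axioms clinear_lact] lact_tens)

text \<open>The map sending \<open>X\<close> to \<open>X - m(X) \<otimes> 1\<close>, with
  \<open>m\<close> the multiplication, takes \<open>a \<otimes> b\<close> to \<open>a db\<close> and
  fixes every \<open>X\<close> in the kernel of \<open>m\<close>. It thus exhibits the kernel inside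
  the span of the forms \<open>a db\<close>.\<close>

lemma cspan_lact_diff: "X \<in> carrier uc \<Longrightarrow> X \<in> cspan T {lact a (diff uc b) | a b. a \<in> carrier A \<and> b \<in> carrier A}"
proof -
  assume X: "X \<in> carrier uc"
  let ?\<Theta> = "\<lambda>X. X \<ominus>\<^bsub>T\<^esub> tens A A (mult_map X) \<one>"
  have \<Theta>: "clinear T T ?\<Theta>"
  proof -
    have lin: "clinear T T (\<lambda>X. tens A A (mult_map X) \<one>)"
      by (rule clinear_comp[OF clinear_mult_map TS.clinear_tens(2)]) simp
    have "clinear T T (\<lambda>X. X \<oplus>\<^bsub>T\<^esub> (- 1) \<odot>\<^bsub>T\<^esub> tens A A (mult_map X) \<one>)"
      using clinear_smult_left[OF T.cvs_axioms lin, of "-1"]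
      by (intro clinearI) (simp_all add: clinear_def Pi_def T.a_ac T.smult_r_distr)
    then show ?thesis
      by (rule iffD1[OF clinear_cong[OF T.cvs_axioms], rotated])
        (use clinear_closed[OF lin] in \<open>simp add: a_minus_def T.smult_minus_one\<close>)
  qed
  have "?\<Theta> ` carrier T = cspan T (?\<Theta> ` {tens A A a b | a b. a \<in> carrier A \<and> b \<in> carrier A})"
    unfolding TS.cspan_tens[symmetric] by (rule cspan_image[OF T.cvs_axioms T.cvs_axioms \<Theta>]) auto
  also have "?\<Theta> ` {tens A A a b | a b. a \<in> carrier A \<and> b \<in> carrier A}
      = {lact a (diff uc b) | a b. a \<in> carrier A \<and> b \<in> carrier A}"
  proof -
    have "?\<Theta> (tens A A a b) = lact a (diff uc b)" if "a \<in> carrier A" "b \<in> carrier A" for a b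
      using that by (simp add: lact_diff mult_map_tens)
    then show ?thesis by (auto simp: image_iff) blast
  qed
  finally have "?\<Theta> X \<in> cspan T {lact a (diff uc b) | a b. a \<in> carrier A \<and> b \<in> carrier A}"
    using X unfolding universal_calculus_simps(1) by blast
  then show ?thesis
    using X clinear_zero[OF cvs_axioms T.cvs_axioms TS.clinear_tens(2)[OF one_closed]]
    by (simp add: universal_calculus_simps a_minus_def T.minus_zero)
qed

lemma diff_univ_closed:
  assumes "h \<in> carrier A"
  shows "diff uc h \<in> carrier uc"
proof -
  have "mult_map (diff uc h) = h \<ominus> h"
    using assms
    by (simp add: universal_calculus_simps clinear_minus[OF T.cvs_axioms cvs_axioms clinear_mult_map] mult_map_tens)
  then show ?thesis
    using assms clinear_closed[OF clinear_diff_univ]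
    by (simp add: universal_calculus_simps(1) a_minus_def r_neg)
qed

lemma calculus_universal: "calculus A uc"
proof -
  interpret U: abelian_group uc by (rule abelian_group_universal)
  let ?D = "{a \<odot>\<^bsub>uc\<^esub> diff uc b | a b. a \<in> carrier A \<and> b \<in> carrier A}"
  have D: "?D = {lact a (diff uc b) | a b. a \<in> carrier A \<and> b \<in> carrier A}"
    by (simp add: universal_calculus_simps)
  have lu: "lact a X \<in> carrier uc" if "a \<in> carrier A" "X \<in> carrier uc" for a X
    using that by (auto simp: universal_calculus_simps mult_map_lact lact_closed)
  have ru: "ract X a \<in> carrier uc" if "a \<in> carrier A" "X \<in> carrier uc" for a X
    using that by (auto simp: universal_calculus_simps mult_map_ract ract_closed)
  have Dc: "?D \<subseteq> carrier uc" unfolding D using lu diff_univ_closed by blast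
  have uT: "X \<in> carrier uc \<Longrightarrow> X \<in> carrier T" for X by (simp add: universal_calculus_simps)
  have DT: "?D \<subseteq> carrier T" using Dc uT by blast
  have gen: "carrier uc = generate (add_monoid uc) ?D"
  proof
    show "generate (add_monoid uc) ?D \<subseteq> carrier uc"
      using U.add.generate_incl[of ?D] Dc by simp
    let ?E = "generate (add_monoid uc) ?D"
    have E: "X \<in> carrier T" if "X \<in> ?E" for X
      using U.add.generate_in_carrier[of ?D] Dc that uT by auto
    \<comment> \<open>Being generated refers to additive subgroups, whereas
      \<open>cspan_lact_diff\<close> speaks of linear spans. Demanding that all multiples
      \<open>c X\<close> be generated gives a subspace, and a scalar in front of \<open>a db\<close>
      is absorbed into \<open>a\<close>.\<close>
    have "submodule {X \<in> carrier T. \<forall>c. c \<odot>\<^bsub>T\<^esub> X \<in> ?E} complex_alg T"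
      unfolding T.submodule_iff
    proof (intro conjI allI ballI)
      have "\<zero>\<^bsub>T\<^esub> \<in> ?E" using generate.one[of "add_monoid uc" ?D] by (simp add: universal_calculus_simps)
      then show "\<zero>\<^bsub>T\<^esub> \<in> {X \<in> carrier T. \<forall>c. c \<odot>\<^bsub>T\<^esub> X \<in> ?E}" by simp
      show "X \<oplus>\<^bsub>T\<^esub> Y \<in> {X \<in> carrier T. \<forall>c. c \<odot>\<^bsub>T\<^esub> X \<in> ?E}"
        if "X \<in> {X \<in> carrier T. \<forall>c. c \<odot>\<^bsub>T\<^esub> X \<in> ?E}" "Y \<in> {X \<in> carrier T. \<forall>c. c \<odot>\<^bsub>T\<^esub> X \<in> ?E}" for X Y
        using that generate.eng[of _ "add_monoid uc" ?D]
        by (auto simp: T.smult_r_distr universal_calculus_simps)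
    qed (auto simp: T.smult_assoc[symmetric])
    moreover have "?D \<subseteq> {X \<in> carrier T. \<forall>c. c \<odot>\<^bsub>T\<^esub> X \<in> ?E}"
    proof (intro subsetI CollectI conjI allI)
      fix X c assume X: "X \<in> ?D"
      then show "X \<in> carrier T" using DT by blast
      obtain a b where ab: "a \<in> carrier A" "b \<in> carrier A" "X = lact a (diff uc b)" using X unfolding D by blast
      then have "c \<odot>\<^bsub>T\<^esub> X = lact (c \<odot> a) (diff uc b)"
        using uT[OF diff_univ_closed[OF ab(2)]] by (simp add: clinear_smult[OF clinear_lact_left])
      then have "c \<odot>\<^bsub>T\<^esub> X \<in> ?D" using ab unfolding D by blast
      then show "c \<odot>\<^bsub>T\<^esub> X \<in> ?E" by (rule generate.incl)
    qed
    ultimately have sub: "cspan T ?D \<subseteq> {X \<in> carrier T. \<forall>c. c \<odot>\<^bsub>T\<^esub> X \<in> ?E}" by (rule cspan_least)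
    show "carrier uc \<subseteq> ?E"
    proof
      fix X assume X: "X \<in> carrier uc"
      then have "X \<in> cspan T ?D" unfolding D by (rule cspan_lact_diff)
      then have "1 \<odot>\<^bsub>T\<^esub> X \<in> ?E" using sub by blast
      then show "X \<in> ?E" using uT[OF X] by simp
    qed
  qed
  have mult: "diff uc (a \<otimes> b) = rsmult uc (diff uc a) b \<oplus>\<^bsub>uc\<^esub> a \<odot>\<^bsub>uc\<^esub> diff uc b"
    if "a \<in> carrier A" "b \<in> carrier A" for a b
  proof -
    \<comment> \<open>The Leibniz rule is a telescoping sum whose middle term is
      \<open>a \<otimes> b\<close>.\<close>
    have "(X \<ominus>\<^bsub>T\<^esub> Y) \<oplus>\<^bsub>T\<^esub> (Y \<ominus>\<^bsub>T\<^esub> Z) = X \<ominus>\<^bsub>T\<^esub> Z" if "X \<in> carrier T" "Y \<in> carrier T" "Z \<in> carrier T" for X Y Z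
    proof -
      have "(X \<ominus>\<^bsub>T\<^esub> Y) \<oplus>\<^bsub>T\<^esub> (Y \<ominus>\<^bsub>T\<^esub> Z) = X \<oplus>\<^bsub>T\<^esub> ((\<ominus>\<^bsub>T\<^esub> Y \<oplus>\<^bsub>T\<^esub> Y) \<oplus>\<^bsub>T\<^esub> (\<ominus>\<^bsub>T\<^esub> Z))"
        using that by (simp add: a_minus_def T.a_assoc)
      then show ?thesis using that by (simp add: a_minus_def T.l_neg)
    qed
    then show ?thesis
      using that lact_diff[of a b]
      by (simp add: universal_calculus_simps clinear_minus[OF T.cvs_axioms T.cvs_axioms clinear_ract] ract_tens)
  qed
  show ?thesis
  proof (intro calculus.intro calculus_axioms.intro calg_axioms U.abelian_group_axioms gen mult diff_univ_closed)
    show "diff uc (c \<odot> a) = (c \<odot> \<one>) \<odot>\<^bsub>uc\<^esub> diff uc a" if "a \<in> carrier A" for c a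
      using that clinear_smult[OF clinear_diff_univ] clinear_closed[OF clinear_diff_univ]
      by (simp add: universal_calculus_simps(4) lact_scalar)
    show "diff uc (a \<oplus> b) = diff uc a \<oplus>\<^bsub>uc\<^esub> diff uc b" if "a \<in> carrier A" "b \<in> carrier A" for a b
      using that clinear_add[OF clinear_diff_univ] by (simp add: universal_calculus_simps(2))
  qed (use lu ru in \<open>simp_all add: universal_calculus_simps lact_mult ract_mult lact_ract lact_one ract_one
      lact_scalar ract_scalar clinear_add[OF clinear_lact] clinear_add[OF clinear_ract]
      clinear_add[OF clinear_lact_left] clinear_add[OF clinear_ract_left]\<close>)
qed

end

section \<open>Left-covariant calculi over a Hopf algebra\<close>

locale hopf = calg_tensor_square A for A :: "(complex, 'a) module" (structure) +
  fixes \<Delta> \<epsilon> S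
  assumes hopf_algebra: "hopf_algebra A \<Delta> \<epsilon> S"
begin

lemma clinear_\<Delta>: "clinear A T \<Delta>" and clinear_\<epsilon>: "clinear A complex_alg \<epsilon>" and clinear_S: "clinear A A S"
  using hopf_algebra by (simp_all add: hopf_algebra_def)

lemma \<Delta>_closed [simp]: "h \<in> carrier A \<Longrightarrow> \<Delta> h \<in> carrier T"
  and S_closed [simp]: "h \<in> carrier A \<Longrightarrow> S h \<in> carrier A"
  using clinear_closed[OF clinear_\<Delta>] clinear_closed[OF clinear_S] by auto

lemma \<Delta>_mult: "\<lbrakk>x \<in> carrier A; y \<in> carrier A\<rbrakk> \<Longrightarrow> \<Delta> (x \<otimes> y) = \<Delta> x \<otimes>\<^bsub>T\<^esub> \<Delta> y"
  and \<Delta>_one: "\<Delta> \<one> = tens A A \<one> \<one>"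
  and \<epsilon>_mult: "\<lbrakk>x \<in> carrier A; y \<in> carrier A\<rbrakk> \<Longrightarrow> \<epsilon> (x \<otimes> y) = \<epsilon> x * \<epsilon> y"
  and \<epsilon>_one: "\<epsilon> \<one> = 1"
  using hopf_algebra by (simp_all add: hopf_algebra_def ring_hom_def one_tensor[OF calg_axioms calg_axioms])

lemma coassoc:
  "h \<in> carrier A \<Longrightarrow>
    tlift (tensor A T) (\<lambda>a b. tlift (tensor A T) (\<lambda>a\<^sub>1 a\<^sub>2. tens A T a\<^sub>1 (tens A A a\<^sub>2 b)) (\<Delta> a)) (\<Delta> h)
      = tlift (tensor A T) (\<lambda>a b. tens A T a (\<Delta> b)) (\<Delta> h)"
  and counit_left: "h \<in> carrier A \<Longrightarrow> tlift A (\<lambda>a b. \<epsilon> a \<odot> b) (\<Delta> h) = h"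
  and counit_right: "h \<in> carrier A \<Longrightarrow> tlift A (\<lambda>a b. \<epsilon> b \<odot> a) (\<Delta> h) = h"
  and antipode_left: "h \<in> carrier A \<Longrightarrow> tlift A (\<lambda>a b. S a \<otimes> b) (\<Delta> h) = \<epsilon> h \<odot> \<one>"
  and antipode_right: "h \<in> carrier A \<Longrightarrow> tlift A (\<lambda>a b. a \<otimes> S b) (\<Delta> h) = \<epsilon> h \<odot> \<one>"
  using hopf_algebra by (simp_all add: hopf_algebra_def Let_def)

text \<open>An inner Sweedler sum over \<open>h\<close> is linear in \<open>h\<close> through
  \<open>\<Delta>\<close>, so it can itself serve as the integrand of an outer one.\<close>

lemma cbilinear_sweedler:
  assumes "cvs C" "cvs W"
    and "\<And>c. c \<in> carrier C \<Longrightarrow> cbilinear A A W (\<gamma> c)"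
    and "\<And>a b. a \<in> carrier A \<Longrightarrow> b \<in> carrier A \<Longrightarrow> clinear C W (\<lambda>c. \<gamma> c a b)"
  shows "cbilinear C A W (\<lambda>c h. tlift W (\<gamma> c) (\<Delta> h))"
proof -
  have "cbilinear C T W (\<lambda>c. tlift W (\<gamma> c))"
    using assms by (intro cbilinear_tlift cvs_axioms) auto
  then show ?thesis
    unfolding cbilinear_def using clinear_comp[OF clinear_\<Delta>] by auto
qed

text \<open>Coassociativity \<open>h\<^sub>(\<^sub>1\<^sub>)\<^sub>(\<^sub>1\<^sub>) \<otimes> h\<^sub>(\<^sub>1\<^sub>)\<^sub>(\<^sub>2\<^sub>) \<otimes> h\<^sub>(\<^sub>2\<^sub>) = h\<^sub>(\<^sub>1\<^sub>) \<otimes> h\<^sub>(\<^sub>2\<^sub>)\<^sub>(\<^sub>1\<^sub>) \<otimes> h\<^sub>(\<^sub>2\<^sub>)\<^sub>(\<^sub>2\<^sub>)\<close> under a trilinear map.\<close>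

lemma coassoc_lift:
  assumes W: "cvs W"
    and g1: "\<And>b c. b \<in> carrier A \<Longrightarrow> c \<in> carrier A \<Longrightarrow> clinear A W (\<lambda>a. \<gamma> a b c)"
    and g2: "\<And>a c. a \<in> carrier A \<Longrightarrow> c \<in> carrier A \<Longrightarrow> clinear A W (\<lambda>b. \<gamma> a b c)"
    and g3: "\<And>a b. a \<in> carrier A \<Longrightarrow> b \<in> carrier A \<Longrightarrow> clinear A W (\<lambda>c. \<gamma> a b c)"
    and h: "h \<in> carrier A"
  shows "tlift W (\<lambda>a c. tlift W (\<lambda>x y. \<gamma> x y c) (\<Delta> a)) (\<Delta> h) = tlift W (\<lambda>a b. tlift W (\<gamma> a) (\<Delta> b)) (\<Delta> h)"
proof -
  interpret AT: tensor_space A T by (intro tensor_spaceI cvs_axioms T.cvs_axioms)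
  let ?T3 = "tensor A T"
  note T3 = AT.cvs_tensor
  have \<gamma>: "cbilinear A A W (\<gamma> a)" if "a \<in> carrier A" for a
    using that g2 g3 by (intro cbilinearI) auto
  have F: "cbilinear A T W (\<lambda>x. tlift W (\<gamma> x))"
    using \<gamma> g1 by (intro cbilinear_tlift cvs_axioms W) auto
  \<comment> \<open>The linear map on \<open>A \<otimes> (A \<otimes> A)\<close> that represents
    \<open>\<gamma>\<close>. The two nested sums are its values at the two sides of the
    coassociativity axiom.\<close>
  let ?F = "tlift W (\<lambda>x. tlift W (\<gamma> x))"
  have linF: "clinear ?T3 W ?F" by (rule AT.clinear_tlift[OF W F])
  have F_tens: "?F (tens A T x X) = tlift W (\<gamma> x) X" if "x \<in> carrier A" "X \<in> carrier T" for x X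
    using that by (rule AT.tlift_tens[OF W F])
  have F_tens3: "?F (tens A T x (tens A A y z)) = \<gamma> x y z"
    if "x \<in> carrier A" "y \<in> carrier A" "z \<in> carrier A" for x y z
    using that by (simp add: F_tens TS.tlift_tens[OF W \<gamma>])
  have rhs: "cbilinear A A ?T3 (\<lambda>a b. tens A T a (\<Delta> b))"
    by (intro cbilinearI clinear_comp[OF clinear_\<Delta> AT.clinear_tens(1)] AT.clinear_tens(2)) auto
  have inner: "cbilinear A A ?T3 (\<lambda>x y. tens A T x (tens A A y z))" if "z \<in> carrier A" for z
    using that by (intro cbilinearI clinear_comp[OF TS.clinear_tens(2) AT.clinear_tens(1)] AT.clinear_tens(2)) auto
  have "cbilinear A A ?T3 (\<lambda>c a. tlift ?T3 (\<lambda>x y. tens A T x (tens A A y c)) (\<Delta> a))"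
    by (rule cbilinear_sweedler[OF cvs_axioms T3 inner])
      (auto intro!: clinear_comp[OF TS.clinear_tens(1) AT.clinear_tens(1)])
  then have lhs: "cbilinear A A ?T3 (\<lambda>a c. tlift ?T3 (\<lambda>x y. tens A T x (tens A A y c)) (\<Delta> a))"
    by (auto simp: cbilinear_def)
  have inner': "cbilinear A A W (\<lambda>x y. \<gamma> x y z)" if "z \<in> carrier A" for z
    using that g1 g2 by (intro cbilinearI) auto
  have "cbilinear A A W (\<lambda>c a. tlift W (\<lambda>x y. \<gamma> x y c) (\<Delta> a))"
    by (rule cbilinear_sweedler[OF cvs_axioms W inner']) (use g3 in auto)
  then have lhs': "cbilinear A A W (\<lambda>a c. tlift W (\<lambda>x y. \<gamma> x y c) (\<Delta> a))"
    by (auto simp: cbilinear_def)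
  have rhs': "cbilinear A A W (\<lambda>a b. tlift W (\<gamma> a) (\<Delta> b))"
    by (rule cbilinear_sweedler[OF cvs_axioms W \<gamma>]) (use g1 in auto)
  have "?F (tlift ?T3 (\<lambda>a b. tens A T a (\<Delta> b)) (\<Delta> h)) = tlift W (\<lambda>a b. ?F (tens A T a (\<Delta> b))) (\<Delta> h)"
    using h by (intro TS.clinear_tlift_comp[OF T3 W rhs linF]) simp
  also have "\<dots> = tlift W (\<lambda>a b. tlift W (\<gamma> a) (\<Delta> b)) (\<Delta> h)"
    using h by (intro TS.tlift_cong[OF W rhs']) (simp_all add: F_tens)
  finally have 1: "?F (tlift ?T3 (\<lambda>a b. tens A T a (\<Delta> b)) (\<Delta> h)) = tlift W (\<lambda>a b. tlift W (\<gamma> a) (\<Delta> b)) (\<Delta> h)" .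
  have "?F (tlift ?T3 (\<lambda>x y. tens A T x (tens A A y c)) (\<Delta> a)) = tlift W (\<lambda>x y. \<gamma> x y c) (\<Delta> a)"
    if "a \<in> carrier A" "c \<in> carrier A" for a c
  proof -
    have "?F (tlift ?T3 (\<lambda>x y. tens A T x (tens A A y c)) (\<Delta> a))
        = tlift W (\<lambda>x y. ?F (tens A T x (tens A A y c))) (\<Delta> a)"
      using that by (intro TS.clinear_tlift_comp[OF T3 W inner linF]) simp_all
    also have "\<dots> = tlift W (\<lambda>x y. \<gamma> x y c) (\<Delta> a)"
      using that by (intro TS.tlift_cong[OF W inner']) (simp_all add: F_tens3)
    finally show ?thesis .
  qed
  then have "?F (tlift ?T3 (\<lambda>a c. tlift ?T3 (\<lambda>x y. tens A T x (tens A A y c)) (\<Delta> a)) (\<Delta> h))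
      = tlift W (\<lambda>a c. tlift W (\<lambda>x y. \<gamma> x y c) (\<Delta> a)) (\<Delta> h)"
    using h by (subst TS.clinear_tlift_comp[OF T3 W lhs linF]) (auto intro!: TS.tlift_cong[OF W lhs'])
  then show ?thesis using 1 coassoc[OF h] by simp
qed

text \<open>Coassociativity regroups the sum as \<open>a f(b\<^sub>(\<^sub>1\<^sub>),
  b\<^sub>(\<^sub>2\<^sub>)) \<otimes> b\<^sub>(\<^sub>3\<^sub>)\<close>; the hypothesis on
  \<open>f\<close> turns the first factor into a counit, which the counit axiom removes. With
  \<open>f(x, y) = S(x) y\<close> and \<open>f(x, y) = x S(y)\<close> this serves both composites of
  \<open>s\<close> and \<open>t\<close>.\<close>

lemma sweedler_contract:
  assumes f: "cbilinear A A A f" and fe: "\<And>c. c \<in> carrier A \<Longrightarrow> tlift A f (\<Delta> c) = \<epsilon> c \<odot> \<one>"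
    and a: "a \<in> carrier A" and b: "b \<in> carrier A"
  shows "tlift T (\<lambda>x y. tlift T (\<lambda>u v. tens A A (a \<otimes> f x u) v) (\<Delta> y)) (\<Delta> b) = tens A A a b"
proof -
  have lin: "clinear A T (\<lambda>z. tens A A (a \<otimes> z) v)" if "v \<in> carrier A" for v
    using that a by (intro clinear_comp[OF clinear_mult_right TS.clinear_tens(2)])
  have eq: "tlift T (\<lambda>x u. tens A A (a \<otimes> f x u) v) (\<Delta> c) = tens A A a (\<epsilon> c \<odot> v)"
    if "c \<in> carrier A" "v \<in> carrier A" for c v
  proof -
    have "tlift T (\<lambda>x u. tens A A (a \<otimes> f x u) v) (\<Delta> c) = tens A A (a \<otimes> tlift A f (\<Delta> c)) v"
      using that by (subst TS.clinear_tlift_comp[OF cvs_axioms T.cvs_axioms f lin]) auto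
    also have "\<dots> = tens A A a (\<epsilon> c \<odot> v)"
      using that a by (simp add: fe mult_smult_one clinear_smult[OF TS.clinear_tens(1)] clinear_smult[OF TS.clinear_tens(2)])
    finally show ?thesis .
  qed
  have e: "cbilinear A A A (\<lambda>c v. \<epsilon> c \<odot> v)"
    by (intro cbilinearI clinear_smult_left[OF cvs_axioms clinear_id] clinear_smult_right[OF cvs_axioms _ clinear_\<epsilon>])
  have "tlift T (\<lambda>x y. tlift T (\<lambda>u v. tens A A (a \<otimes> f x u) v) (\<Delta> y)) (\<Delta> b)
      = tlift T (\<lambda>c v. tlift T (\<lambda>x u. tens A A (a \<otimes> f x u) v) (\<Delta> c)) (\<Delta> b)"
    using a b cbilinearD[OF f]
    by (intro coassoc_lift[symmetric, OF T.cvs_axioms] TS.clinear_tens m_closed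
        clinear_comp[OF cbilinearD(2)[OF f] lin] clinear_comp[OF cbilinearD(1)[OF f] lin]) auto
  also have "\<dots> = tlift T (\<lambda>c v. tens A A a (\<epsilon> c \<odot> v)) (\<Delta> b)"
    using b by (intro TS.tlift_cong[OF T.cvs_axioms cbilinear_comp[OF e TS.clinear_tens(1)[OF a]]]) (simp_all add: eq)
  also have "\<dots> = tens A A a (tlift A (\<lambda>c v. \<epsilon> c \<odot> v) (\<Delta> b))"
    using b by (intro TS.clinear_tlift_comp[OF cvs_axioms T.cvs_axioms e TS.clinear_tens(1)[OF a], symmetric]) simp
  finally show ?thesis using b by (simp add: counit_left)
qed

section \<open>The map \<open>s\<close> and its inverse\<close>

abbreviation "s \<equiv> s_map A \<Delta> S"

text \<open>\<open>t(a \<otimes> b) = a b\<^sub>(\<^sub>1\<^sub>) \<otimes> b\<^sub>(\<^sub>2\<^sub>)\<close>\<close>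

definition "t = tlift T (\<lambda>a b. lact a (\<Delta> b))"

lemma cbilinear_s0: "a \<in> carrier A \<Longrightarrow> cbilinear A A T (\<lambda>x y. tens A A (a \<otimes> S x) y)"
  by (intro cbilinearI TS.clinear_tens
      clinear_comp[OF clinear_comp[OF clinear_S clinear_mult_right] TS.clinear_tens(2)]) auto

lemma cbilinear_s: "cbilinear A A T (\<lambda>a b. tlift T (\<lambda>x y. tens A A (a \<otimes> S x) y) (\<Delta> b))"
  by (rule cbilinear_sweedler[OF cvs_axioms T.cvs_axioms cbilinear_s0])
    (auto intro!: clinear_comp[OF clinear_mult_left TS.clinear_tens(2)])

lemma clinear_s: "clinear T T s"
  unfolding s_map_def by (rule TS.clinear_tlift[OF T.cvs_axioms cbilinear_s])

lemma s_tens: "\<lbrakk>a \<in> carrier A; b \<in> carrier A\<rbrakk> \<Longrightarrow> s (tens A A a b) = tlift T (\<lambda>x y. tens A A (a \<otimes> S x) y) (\<Delta> b)"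
  unfolding s_map_def by (rule TS.tlift_tens[OF T.cvs_axioms cbilinear_s])

lemma cbilinear_t: "cbilinear A A T (\<lambda>a b. lact a (\<Delta> b))"
  by (intro cbilinearI clinear_lact_left clinear_comp[OF clinear_\<Delta> clinear_lact]) auto

lemma clinear_t: "clinear T T t"
  unfolding t_def by (rule TS.clinear_tlift[OF T.cvs_axioms cbilinear_t])

lemma t_tens: "\<lbrakk>a \<in> carrier A; b \<in> carrier A\<rbrakk> \<Longrightarrow> t (tens A A a b) = lact a (\<Delta> b)"
  unfolding t_def by (rule TS.tlift_tens[OF T.cvs_axioms cbilinear_t])

lemmas s_closed = clinear_closed[OF clinear_s]
lemmas t_closed = clinear_closed[OF clinear_t]

lemma t_s:
  assumes "X \<in> carrier T"
  shows "t (s X) = X"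
proof (rule clinear_eq_T[OF clinear_comp[OF clinear_s clinear_t] clinear_id _ assms])
  fix a b assume ab: "a \<in> carrier A" "b \<in> carrier A"
  have f: "cbilinear A A A (\<lambda>x y. S x \<otimes> y)"
    by (intro cbilinearI clinear_mult_right clinear_comp[OF clinear_S clinear_mult_left]) auto
  have "t (s (tens A A a b)) = tlift T (\<lambda>x y. t (tens A A (a \<otimes> S x) y)) (\<Delta> b)"
    using ab by (simp add: s_tens TS.clinear_tlift_comp[OF T.cvs_axioms T.cvs_axioms cbilinear_s0 clinear_t])
  also have "\<dots> = tlift T (\<lambda>x y. tlift T (\<lambda>u v. tens A A (a \<otimes> (S x \<otimes> u)) v) (\<Delta> y)) (\<Delta> b)"
  proof (rule TS.tlift_cong[OF T.cvs_axioms cbilinear_sweedler[OF cvs_axioms T.cvs_axioms]])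
    show "t (tens A A (a \<otimes> S x) y) = tlift T (\<lambda>u v. tens A A (a \<otimes> (S x \<otimes> u)) v) (\<Delta> y)"
      if "x \<in> carrier A" "y \<in> carrier A" for x y
    proof -
      have c: "cbilinear A A T (\<lambda>u v. tens A A (a \<otimes> S x \<otimes> u) v)" using that ab by (intro cbilinear_lact) auto
      have "t (tens A A (a \<otimes> S x) y) = lact (a \<otimes> S x) (\<Delta> y)" using that ab by (intro t_tens) auto
      also have "\<dots> = tlift T (\<lambda>u v. tens A A (a \<otimes> (S x \<otimes> u)) v) (\<Delta> y)"
        using that ab by (intro TS.tlift_cong[symmetric, OF T.cvs_axioms c]) (simp_all add: m_assoc)
      finally show ?thesis .
    qed
    show "cbilinear A A T (\<lambda>u v. tens A A (a \<otimes> (S x \<otimes> u)) v)" if "x \<in> carrier A" for x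
      using that ab
      by (intro cbilinearI TS.clinear_tens
          clinear_comp[OF clinear_comp[OF clinear_mult_right clinear_mult_right] TS.clinear_tens(2)]) auto
    show "clinear A T (\<lambda>x. tens A A (a \<otimes> (S x \<otimes> u)) v)" if "u \<in> carrier A" "v \<in> carrier A" for u v
      using that ab cbilinearD(2)[OF f that(1)]
      by (intro clinear_comp[OF clinear_comp[OF _ clinear_mult_right] TS.clinear_tens(2)]) auto
  qed (use ab in simp)
  also have "\<dots> = tens A A a b"
    using ab by (intro sweedler_contract f antipode_left)
  finally show "t (s (tens A A a b)) = tens A A a b" .
qed

lemma s_t:
  assumes "X \<in> carrier T"
  shows "s (t X) = X"
proof (rule clinear_eq_T[OF clinear_comp[OF clinear_t clinear_s] clinear_id _ assms])
  fix a b assume ab: "a \<in> carrier A" "b \<in> carrier A"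
  have f: "cbilinear A A A (\<lambda>x y. x \<otimes> S y)"
    by (intro cbilinearI clinear_mult_left clinear_comp[OF clinear_S clinear_mult_right]) auto
  have "s (t (tens A A a b)) = tlift T (\<lambda>x y. s (tens A A (a \<otimes> x) y)) (\<Delta> b)"
    using ab by (simp add: t_tens TS.clinear_tlift_comp[OF T.cvs_axioms T.cvs_axioms cbilinear_lact clinear_s])
  also have "\<dots> = tlift T (\<lambda>x y. tlift T (\<lambda>u v. tens A A (a \<otimes> (x \<otimes> S u)) v) (\<Delta> y)) (\<Delta> b)"
  proof (rule TS.tlift_cong[OF T.cvs_axioms cbilinear_sweedler[OF cvs_axioms T.cvs_axioms]])
    show "s (tens A A (a \<otimes> x) y) = tlift T (\<lambda>u v. tens A A (a \<otimes> (x \<otimes> S u)) v) (\<Delta> y)"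
      if "x \<in> carrier A" "y \<in> carrier A" for x y
    proof -
      have c: "cbilinear A A T (\<lambda>u v. tens A A (a \<otimes> x \<otimes> S u) v)" using that ab by (intro cbilinear_s0) auto
      have "s (tens A A (a \<otimes> x) y) = tlift T (\<lambda>u v. tens A A (a \<otimes> x \<otimes> S u) v) (\<Delta> y)"
        using that ab by (intro s_tens) auto
      also have "\<dots> = tlift T (\<lambda>u v. tens A A (a \<otimes> (x \<otimes> S u)) v) (\<Delta> y)"
        using that ab by (intro TS.tlift_cong[symmetric, OF T.cvs_axioms c]) (simp_all add: m_assoc)
      finally show ?thesis .
    qed
    show "cbilinear A A T (\<lambda>u v. tens A A (a \<otimes> (x \<otimes> S u)) v)" if "x \<in> carrier A" for x
      using that ab cbilinearD(1)[OF f that]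
      by (intro cbilinearI TS.clinear_tens clinear_comp[OF clinear_comp[OF _ clinear_mult_right] TS.clinear_tens(2)]) auto
    show "clinear A T (\<lambda>x. tens A A (a \<otimes> (x \<otimes> S u)) v)" if "u \<in> carrier A" "v \<in> carrier A" for u v
      using that ab cbilinearD(2)[OF f that(1)]
      by (intro clinear_comp[OF clinear_comp[OF _ clinear_mult_right] TS.clinear_tens(2)]) auto
  qed (use ab in simp)
  also have "\<dots> = tens A A a b"
    using ab by (intro sweedler_contract f antipode_right)
  finally show "s (t (tens A A a b)) = tens A A a b" .
qed

text \<open>Left multiplication becomes multiplication inside the algebra
  \<open>A \<otimes> A\<close>, so that \<open>t(a \<otimes> b)\<close> reads
  \<open>(a \<otimes> 1) \<Delta>(b)\<close> and associativity there can be used.\<close>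

lemma lact_eq_mult:
  assumes "a \<in> carrier A" "X \<in> carrier T"
  shows "lact a X = tens A A a \<one> \<otimes>\<^bsub>T\<^esub> X"
  by (rule clinear_eq_T[OF clinear_lact T.clinear_mult_right _ assms(2)])
    (use assms in \<open>simp_all add: lact_tens mult_tens[OF calg_axioms calg_axioms]\<close>)

lemma t_lact:
  assumes "a \<in> carrier A" "X \<in> carrier T"
  shows "t (lact a X) = lact a (t X)"
  by (rule clinear_eq_T[OF clinear_comp[OF clinear_lact clinear_t] clinear_comp[OF clinear_t clinear_lact] _ assms(2)])
    (use assms in \<open>simp_all add: lact_tens t_tens lact_mult\<close>)

text \<open>Inherited from \<open>t_lact\<close> by inverting, which avoids a second computation
  with Sweedler sums.\<close>

lemma s_lact:
  assumes "a \<in> carrier A" "X \<in> carrier T"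
  shows "s (lact a X) = lact a (s X)"
  using t_lact[OF assms(1) s_closed[OF assms(2)]] assms s_t[OF lact_closed[OF assms(1) s_closed[OF assms(2)]]]
  by (simp add: t_s)

text \<open>On \<open>a \<otimes> b\<close> both sides equal
  \<open>(a \<otimes> 1) \<Delta>(b) \<Delta>(h)\<close>, because \<open>\<Delta>\<close> is
  multiplicative.\<close>

lemma t_ract:
  assumes "h \<in> carrier A" "X \<in> carrier T"
  shows "t (ract X h) = t X \<otimes>\<^bsub>T\<^esub> \<Delta> h"
  by (rule clinear_eq_T[OF clinear_comp[OF clinear_ract clinear_t] clinear_comp[OF clinear_t T.clinear_mult_left] _ assms(2)])
    (use assms in \<open>simp_all add: ract_tens t_tens \<Delta>_mult lact_eq_mult T.m_assoc\<close>)

section \<open>Subbimodules attached to right ideals\<close>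

abbreviation "G_plus \<equiv> aug_ideal A \<epsilon>"

lemma aug_ideal_closed: "h \<in> G_plus \<Longrightarrow> h \<in> carrier A"
  by (simp add: aug_ideal_def)

lemma submodule_aug_ideal: "submodule G_plus complex_alg A"
  unfolding submodule_iff
  by (auto simp: aug_ideal_def clinearD[OF clinear_\<epsilon>] clinear_zero[OF cvs_axioms cvs_complex_alg clinear_\<epsilon>])

text \<open>The left side is
  \<open>a S(b\<^sub>(\<^sub>1\<^sub>)) b\<^sub>(\<^sub>2\<^sub>)\<close>. In particular
  \<open>s(a \<otimes> v)\<close> lies in the kernel of multiplication for \<open>v\<close> in the
  augmentation ideal.\<close>

lemma mult_map_s:
  assumes "a \<in> carrier A" "b \<in> carrier A"
  shows "mult_map (s (tens A A a b)) = \<epsilon> b \<odot> a"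
proof -
  have f: "cbilinear A A A (\<lambda>x y. S x \<otimes> y)"
    by (intro cbilinearI clinear_mult_right clinear_comp[OF clinear_S clinear_mult_left]) auto
  have "mult_map (s (tens A A a b)) = tlift A (\<lambda>x y. mult_map (tens A A (a \<otimes> S x) y)) (\<Delta> b)"
    using assms
    by (simp add: s_tens TS.clinear_tlift_comp[OF T.cvs_axioms cvs_axioms cbilinear_s0 clinear_mult_map])
  also have "\<dots> = tlift A (\<lambda>x y. a \<otimes> (S x \<otimes> y)) (\<Delta> b)"
    using assms
    by (intro TS.tlift_cong[OF cvs_axioms cbilinear_comp[OF f clinear_mult_right]]) (auto simp: mult_map_tens m_assoc)
  also have "\<dots> = a \<otimes> tlift A (\<lambda>x y. S x \<otimes> y) (\<Delta> b)"
    using assms by (intro TS.clinear_tlift_comp[OF cvs_axioms cvs_axioms f clinear_mult_right, symmetric]) auto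
  finally show ?thesis using assms by (simp add: antipode_left mult_smult_one)
qed

abbreviation "N_sub \<equiv> s_sub A \<Delta> S"

lemma submodule_s_sub:
  assumes "I \<subseteq> carrier A"
  shows "submodule (N_sub I) complex_alg T"
  unfolding s_sub_def using assms
  by (intro submodule_image[OF T.cvs_axioms T.cvs_axioms clinear_s] TS.submodule_tensor_sub) auto

lemma s_sub_eq_cspan:
  assumes "I \<subseteq> carrier A"
  shows "N_sub I = cspan T {s (tens A A a v) | a v. a \<in> carrier A \<and> v \<in> I}"
proof -
  have "N_sub I = cspan T (s ` {tens A A a v | a v. a \<in> carrier A \<and> v \<in> I})"
    unfolding s_sub_def tensor_sub_def using assms
    by (intro cspan_image[OF T.cvs_axioms T.cvs_axioms clinear_s]) auto
  also have "s ` {tens A A a v | a v. a \<in> carrier A \<and> v \<in> I} = {s (tens A A a v) | a v. a \<in> carrier A \<and> v \<in> I}"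
    by blast
  finally show ?thesis .
qed

lemma s_tens_in_s_sub: "a \<in> carrier A \<Longrightarrow> v \<in> I \<Longrightarrow> s (tens A A a v) \<in> N_sub I"
  unfolding s_sub_def by (intro imageI TS.tensor_subI)

lemma s_sub_universal:
  assumes "I \<subseteq> G_plus"
  shows "N_sub I \<subseteq> carrier uc"
proof -
  have I: "I \<subseteq> carrier A" using assms aug_ideal_closed by blast
  have "{s (tens A A a v) | a v. a \<in> carrier A \<and> v \<in> I} \<subseteq> {X \<in> carrier T. mult_map X \<in> {\<zero>}}"
    using assms I by (auto simp: mult_map_s aug_ideal_def intro!: s_closed)
  then have "N_sub I \<subseteq> {X \<in> carrier T. mult_map X \<in> {\<zero>}}"
    unfolding s_sub_eq_cspan[OF I]
    by (intro cspan_least submodule_vimage[OF T.cvs_axioms cvs_axioms clinear_mult_map]) (simp_all add: submodule_iff)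
  then show ?thesis by (auto simp: universal_calculus_simps(1))
qed

lemma t_s_sub:
  assumes "I \<subseteq> carrier A" "X \<in> N_sub I"
  shows "t X \<in> tensor_sub A A (carrier A) I"
proof -
  obtain Y where "Y \<in> tensor_sub A A (carrier A) I" "X = s Y" using assms(2) by (auto simp: s_sub_def)
  moreover from this have "Y \<in> carrier T"
    using TS.submodule_tensor_sub[of "carrier A" I] assms(1) by (auto simp: T.submodule_iff)
  ultimately show ?thesis by (simp add: t_s)
qed

lemma tensor_sub_lact:
  assumes I: "I \<subseteq> carrier A" and "a \<in> carrier A" "Y \<in> tensor_sub A A (carrier A) I"
  shows "lact a Y \<in> tensor_sub A A (carrier A) I"
proof -
  have "{tens A A x v | x v. x \<in> carrier A \<and> v \<in> I} \<subseteq> {Y \<in> carrier T. lact a Y \<in> tensor_sub A A (carrier A) I}"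
    using assms by (auto simp: lact_tens subset_iff intro!: TS.tensor_subI)
  then have "tensor_sub A A (carrier A) I \<subseteq> {Y \<in> carrier T. lact a Y \<in> tensor_sub A A (carrier A) I}"
    by (subst tensor_sub_def)
      (intro cspan_least submodule_vimage[OF T.cvs_axioms T.cvs_axioms clinear_lact] TS.submodule_tensor_sub
        I assms(2) order_refl)
  then show ?thesis using assms(3) by blast
qed

text \<open>On pure tensors \<open>(a \<otimes> v)(x \<otimes> y) = ax \<otimes> vy\<close>, and
  \<open>vy\<close> stays in the right ideal. Used with \<open>Z = \<Delta>(h)\<close>, it gives
  stability under the right action.\<close>

lemma tensor_sub_mult:
  assumes I: "right_ideal_in A G_plus I" and "Y \<in> tensor_sub A A (carrier A) I" "Z \<in> carrier T"
  shows "Y \<otimes>\<^bsub>T\<^esub> Z \<in> tensor_sub A A (carrier A) I"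
proof -
  let ?U = "tensor_sub A A (carrier A) I"
  have IA: "I \<subseteq> carrier A" and IG: "\<And>v h. v \<in> I \<Longrightarrow> h \<in> carrier A \<Longrightarrow> v \<otimes> h \<in> I"
    using I aug_ideal_closed by (auto simp: right_ideal_in_def)
  note U = TS.submodule_tensor_sub[OF order_refl IA]
  have 1: "tens A A a v \<otimes>\<^bsub>T\<^esub> Z \<in> ?U" if av: "a \<in> carrier A" "v \<in> I" for a v
  proof -
    have "{tens A A x y | x y. x \<in> carrier A \<and> y \<in> carrier A} \<subseteq> {Z \<in> carrier T. tens A A a v \<otimes>\<^bsub>T\<^esub> Z \<in> ?U}"
      using av IA IG by (auto simp: mult_tens[OF calg_axioms calg_axioms] subset_iff intro!: TS.tensor_subI)
    then have "carrier T \<subseteq> {Z \<in> carrier T. tens A A a v \<otimes>\<^bsub>T\<^esub> Z \<in> ?U}"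
      using av IA by (subst TS.cspan_tens[symmetric])
        (intro cspan_least submodule_vimage[OF T.cvs_axioms T.cvs_axioms T.clinear_mult_right] U; auto)
    then show ?thesis using assms(3) by blast
  qed
  have "{tens A A x v | x v. x \<in> carrier A \<and> v \<in> I} \<subseteq> {Y \<in> carrier T. Y \<otimes>\<^bsub>T\<^esub> Z \<in> ?U}"
    using 1 IA by auto
  then have "?U \<subseteq> {Y \<in> carrier T. Y \<otimes>\<^bsub>T\<^esub> Z \<in> ?U}"
    by (subst tensor_sub_def)
      (intro cspan_least submodule_vimage[OF T.cvs_axioms T.cvs_axioms T.clinear_mult_left] U assms(3))
  then show ?thesis using assms(2) by blast
qed

lemma subbimodule_s_sub:
  assumes I: "right_ideal_in A G_plus I"
  shows "subbimodule A uc (N_sub I)"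
proof -
  interpret U: abelian_group uc by (rule abelian_group_universal)
  have IG: "I \<subseteq> G_plus" using I by (simp add: right_ideal_in_def)
  then have IA: "I \<subseteq> carrier A" using aug_ideal_closed by blast
  note N = submodule_s_sub[OF IA, unfolded T.submodule_iff] and NU = s_sub_universal[OF IG]
  have "subgroup (N_sub I) (add_monoid uc)"
  proof (rule U.add.subgroupI)
    show "N_sub I \<noteq> {}" using N by blast
    show "a \<oplus>\<^bsub>uc\<^esub> b \<in> N_sub I" if "a \<in> N_sub I" "b \<in> N_sub I" for a b
      using N that by (simp add: universal_calculus_simps(2))
    show "\<ominus>\<^bsub>uc\<^esub> a \<in> N_sub I" if a: "a \<in> N_sub I" for a
    proof -
      have ma: "(- 1) \<odot>\<^bsub>T\<^esub> a \<in> N_sub I" using N a by blast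
      have "(- 1) \<odot>\<^bsub>T\<^esub> a \<oplus>\<^bsub>uc\<^esub> a = \<zero>\<^bsub>uc\<^esub>"
        using a N by (auto simp: universal_calculus_simps(2,3) T.smult_minus_one T.l_neg subset_iff)
      then have "\<ominus>\<^bsub>uc\<^esub> a = (- 1) \<odot>\<^bsub>T\<^esub> a"
        using a ma NU by (intro U.minus_equality) auto
      then show ?thesis using ma by simp
    qed
  qed (use NU in simp)
  moreover have "lact a w \<in> N_sub I" if a: "a \<in> carrier A" and w: "w \<in> N_sub I" for a w
  proof -
    have wT: "w \<in> carrier T" using w N by blast
    have "lact a w = s (lact a (t w))" using a wT by (simp add: s_lact s_t t_closed)
    then show ?thesis
      unfolding s_sub_def using tensor_sub_lact[OF IA a t_s_sub[OF IA w]] by blast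
  qed
  moreover have "ract w a \<in> N_sub I" if a: "a \<in> carrier A" and w: "w \<in> N_sub I" for a w
  proof -
    have wT: "w \<in> carrier T" using w N by blast
    have "ract w a = s (t (ract w a))" using a wT by (simp add: s_t ract_closed)
    moreover have "t (ract w a) \<in> tensor_sub A A (carrier A) I"
      using a wT tensor_sub_mult[OF I t_s_sub[OF IA w], of "\<Delta> a"] by (simp add: t_ract)
    ultimately show ?thesis unfolding s_sub_def by blast
  qed
  ultimately show ?thesis by (simp add: subbimodule_def universal_calculus_simps(4,5))
qed

text \<open>The differential of \<open>b\<close> is sent by \<open>t\<close> to
  \<open>\<Delta>(b) - b \<otimes> 1\<close>, which by the counit axiom equals
  \<open>b\<^sub>(\<^sub>1\<^sub>) \<otimes> (b\<^sub>(\<^sub>2\<^sub>) -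
  \<epsilon>(b\<^sub>(\<^sub>2\<^sub>)) 1)\<close> and so has its second factor in the augmentation
  ideal. The forms \<open>a db\<close> span everything.\<close>

lemma universal_eq_s_sub: "carrier uc = N_sub G_plus"
proof
  show "N_sub G_plus \<subseteq> carrier uc" by (rule s_sub_universal) simp
  have GA: "G_plus \<subseteq> carrier A" using aug_ideal_closed by blast
  note U = TS.submodule_tensor_sub[OF order_refl GA]
  have diff: "t (diff uc b) \<in> tensor_sub A A (carrier A) G_plus" if b: "b \<in> carrier A" for b
  proof -
    \<comment> \<open>The projection of \<open>A\<close> onto the augmentation ideal along the
      multiples of the unit.\<close>
    let ?\<pi> = "\<lambda>y. y \<ominus> \<epsilon> y \<odot> \<one>"
    have lin\<epsilon>: "clinear A A (\<lambda>y. \<epsilon> y \<odot> \<one>)"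
      by (intro clinear_smult_right[OF cvs_axioms _ clinear_\<epsilon>]) simp
    have \<pi>: "clinear A A ?\<pi>" by (intro clinear_minus_fun cvs_axioms clinear_id lin\<epsilon>)
    have \<pi>G: "?\<pi> y \<in> G_plus" if "y \<in> carrier A" for y
      using that by (simp add: aug_ideal_def clinear_minus[OF cvs_axioms cvs_complex_alg clinear_\<epsilon>]
          clinear_smult[OF clinear_\<epsilon>] \<epsilon>_one complex_alg_minus)
    let ?P = "\<lambda>X. tlift T (\<lambda>x y. tens A A x (?\<pi> y)) X"
    have bP: "cbilinear A A T (\<lambda>x y. tens A A x (?\<pi> y))"
      using \<pi>G GA by (intro cbilinearI TS.clinear_tens clinear_comp[OF \<pi> TS.clinear_tens(1)]) auto
    have linP: "clinear T T ?P" by (rule TS.clinear_tlift[OF T.cvs_axioms bP])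
    have "{tens A A x y | x y. x \<in> carrier A \<and> y \<in> carrier A} \<subseteq> {X \<in> carrier T. ?P X \<in> tensor_sub A A (carrier A) G_plus}"
      using \<pi>G by (auto simp: TS.tlift_tens[OF T.cvs_axioms bP] intro!: TS.tensor_subI)
    then have "carrier T \<subseteq> {X \<in> carrier T. ?P X \<in> tensor_sub A A (carrier A) G_plus}"
      by (subst TS.cspan_tens[symmetric]) (intro cspan_least submodule_vimage[OF T.cvs_axioms T.cvs_axioms linP] U)
    then have "?P (\<Delta> b) \<in> tensor_sub A A (carrier A) G_plus" using \<Delta>_closed[OF b] by blast
    moreover have "?P (\<Delta> b) = t (diff uc b)"
    proof -
      have e: "cbilinear A A A (\<lambda>x y. \<epsilon> y \<odot> x)"
        by (intro cbilinearI clinear_smult_left[OF cvs_axioms clinear_id] clinear_smult_right[OF cvs_axioms _ clinear_\<epsilon>])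
      note e' = cbilinear_comp[OF e TS.clinear_tens(2)[OF one_closed]]
      have "?P (\<Delta> b) = \<Delta> b \<ominus>\<^bsub>T\<^esub> tlift T (\<lambda>x y. tens A A (\<epsilon> y \<odot> x) \<one>) (\<Delta> b)"
        by (rule clinear_eq_T[OF linP clinear_minus_fun[OF T.cvs_axioms clinear_id TS.clinear_tlift[OF T.cvs_axioms e']]])
          (use b in \<open>simp_all add: TS.tlift_tens[OF T.cvs_axioms bP] TS.tlift_tens[OF T.cvs_axioms e']
            clinear_minus[OF cvs_axioms T.cvs_axioms TS.clinear_tens(1)]
            clinear_smult[OF TS.clinear_tens(1)] clinear_smult[OF TS.clinear_tens(2)]\<close>)
      also have "tlift T (\<lambda>x y. tens A A (\<epsilon> y \<odot> x) \<one>) (\<Delta> b) = tens A A b \<one>"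
        using b TS.clinear_tlift_comp[OF cvs_axioms T.cvs_axioms e TS.clinear_tens(2)[OF one_closed], of "\<Delta> b"]
        by (simp add: counit_right)
      also have "\<Delta> b \<ominus>\<^bsub>T\<^esub> tens A A b \<one> = t (diff uc b)"
        using b by (simp add: universal_calculus_simps clinear_minus[OF T.cvs_axioms T.cvs_axioms clinear_t]
            t_tens lact_one \<Delta>_one lact_tens)
      finally show ?thesis .
    qed
    ultimately show ?thesis by simp
  qed
  have "lact a (diff uc b) \<in> N_sub G_plus" if "a \<in> carrier A" "b \<in> carrier A" for a b
  proof -
    have d: "diff uc b \<in> carrier T" using that clinear_closed[OF clinear_diff_univ] by blast
    have "lact a (diff uc b) = s (lact a (t (diff uc b)))" using that d by (simp add: s_lact s_t t_closed)
    then show ?thesis unfolding s_sub_def using tensor_sub_lact[OF GA that(1) diff[OF that(2)]] by blast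
  qed
  then have "cspan T {lact a (diff uc b) | a b. a \<in> carrier A \<and> b \<in> carrier A} \<subseteq> N_sub G_plus"
    by (intro cspan_least submodule_s_sub GA) auto
  then show "carrier uc \<subseteq> N_sub G_plus" using cspan_lact_diff by blast
qed

end

section \<open>Free bases of the calculus of a right ideal\<close>

context hopf
begin

text \<open>Under the identification of forms by \<open>s\<close> this is the identity tensored with
  \<open>\<phi>\<close>, that is, the coordinate function that the functional \<open>\<phi>\<close>
  induces on forms.\<close>

definition coef :: "('a \<Rightarrow> complex) \<Rightarrow> ('a \<times> 'a \<Rightarrow>\<^sub>0 complex) set \<Rightarrow> 'a" where
  "coef \<phi> X = tlift A (\<lambda>a b. \<phi> b \<odot> a) (t X)"

lemma
  assumes \<phi>: "clinear A complex_alg \<phi>"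
  shows clinear_coef: "clinear T A (coef \<phi>)"
    and coef_s_tens: "\<lbrakk>a \<in> carrier A; v \<in> carrier A\<rbrakk> \<Longrightarrow> coef \<phi> (s (tens A A a v)) = \<phi> v \<odot> a"
proof -
  have b: "cbilinear A A A (\<lambda>a b. \<phi> b \<odot> a)"
    by (intro cbilinearI clinear_smult_left[OF cvs_axioms clinear_id] clinear_smult_right[OF cvs_axioms _ \<phi>])
  show "clinear T A (coef \<phi>)"
    unfolding coef_def by (rule clinear_comp[OF clinear_t TS.clinear_tlift[OF cvs_axioms b]])
  show "\<lbrakk>a \<in> carrier A; v \<in> carrier A\<rbrakk> \<Longrightarrow> coef \<phi> (s (tens A A a v)) = \<phi> v \<odot> a"
    unfolding coef_def by (simp add: t_s TS.tlift_tens[OF cvs_axioms b])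
qed

text \<open>If \<open>\<phi>\<close> kills \<open>I\<close>, the coordinate vanishes on
  \<open>a \<otimes> v\<close> for every \<open>v\<close> in \<open>I\<close>, so it depends only on
  the class of a form in the quotient.\<close>

lemma coef_s_sub:
  assumes \<phi>: "clinear A complex_alg \<phi>" and I: "I \<subseteq> carrier A" "\<And>v. v \<in> I \<Longrightarrow> \<phi> v = 0" and X: "X \<in> N_sub I"
  shows "coef \<phi> X = \<zero>"
proof -
  have "{s (tens A A a v) | a v. a \<in> carrier A \<and> v \<in> I} \<subseteq> {X \<in> carrier T. coef \<phi> X \<in> {\<zero>}}"
    using I by (auto simp: coef_s_tens[OF \<phi>] subset_iff intro!: s_closed)
  then have "N_sub I \<subseteq> {X \<in> carrier T. coef \<phi> X \<in> {\<zero>}}"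
    unfolding s_sub_eq_cspan[OF I(1)]
    by (intro cspan_least submodule_vimage[OF T.cvs_axioms cvs_axioms clinear_coef[OF \<phi>]]) (simp_all add: submodule_iff)
  then show ?thesis using X by auto
qed

lemma finsum_universal:
  assumes "finite J" "g \<in> J \<rightarrow> carrier uc"
  shows "finsum uc g J = finsum T g J"
  using additive_finsum[OF abelian_group_universal T.abelian_group_axioms _ _ assms, of "\<lambda>X. X"]
  by (simp add: universal_calculus_simps(1,2))

text \<open>The functionals \<open>\<phi> j\<close> are, up to scaling, dual to the residues of the \<open>v j\<close> in \<open>A\<^sup>+/I\<close>.\<close>

lemma free_family_ideal_calculus:
  fixes J :: "'j set" and \<kappa> :: "'j \<Rightarrow> complex"
  assumes I: "right_ideal_in A G_plus I" and J: "finite J" and v: "\<And>j. j \<in> J \<Longrightarrow> v j \<in> G_plus"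
    and \<phi>: "\<And>j. j \<in> J \<Longrightarrow> clinear A complex_alg (\<phi> j)"
    and \<phi>I: "\<And>j x. j \<in> J \<Longrightarrow> x \<in> I \<Longrightarrow> \<phi> j x = 0"
    and \<phi>v: "\<And>j k. j \<in> J \<Longrightarrow> k \<in> J \<Longrightarrow> \<phi> j (v k) = (if j = k then \<kappa> j else 0)"
    and \<kappa>: "\<And>j. j \<in> J \<Longrightarrow> \<kappa> j \<noteq> 0"
    and sep: "\<And>h. h \<in> G_plus \<Longrightarrow> (\<And>j. j \<in> J \<Longrightarrow> \<phi> j h = 0) \<Longrightarrow> h \<in> I"
  shows "free_family A (ideal_calculus A \<Delta> S I) J (\<lambda>j. N_sub I +>\<^bsub>uc\<^esub> s (tens A A \<one> (v j)))"
proof -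
  have IG: "I \<subseteq> G_plus" using I by (simp add: right_ideal_in_def)
  then have IA: "I \<subseteq> carrier A" using aug_ideal_closed by blast
  have vA: "v j \<in> carrier A" if "j \<in> J" for j using v[OF that] by (rule aug_ideal_closed)
  interpret U: subcalculus A uc "N_sub I"
    by (intro subcalculusI calculus_universal subbimodule_s_sub I)
  let ?Q = "ideal_calculus A \<Delta> S I"
  have Q: "?Q = quotient_calculus uc (N_sub I)" by (simp add: ideal_calculus_def)
  interpret Q: calculus A ?Q unfolding Q by (rule U.calculus_quotient)
  note N = submodule_s_sub[OF IA]
  let ?e = "\<lambda>j. s (tens A A \<one> (v j))"
  have sG: "s (tens A A a h) \<in> carrier uc" if "a \<in> carrier A" "h \<in> G_plus" for a h
    unfolding universal_eq_s_sub using that by (intro s_tens_in_s_sub)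
  have e: "?e j \<in> carrier uc" "?e j \<in> carrier T" if "j \<in> J" for j
    using sG[of \<one> "v j"] v[OF that] by (auto simp: universal_calculus_simps(1))
  have lact_e: "lact a (?e j) = s (tens A A a (v j))" if "a \<in> carrier A" "j \<in> J" for a j
    using that vA[of j] by (simp add: s_lact[symmetric] lact_tens)
  let ?s = "\<lambda>c. \<Oplus>\<^bsub>T\<^esub>j\<in>J. s (tens A A (c j) (v j))"
  have sc: "(\<lambda>j. s (tens A A (c j) (v j))) \<in> J \<rightarrow> carrier uc" if "c \<in> J \<rightarrow> carrier A" for c
    using that v sG by auto
  have s_uc: "?s c \<in> carrier uc" if "c \<in> J \<rightarrow> carrier A" for c
    using finsum_universal[OF J sc[OF that]] U.finsum_closed[OF sc[OF that]] by simp
  have sum: "(\<Oplus>\<^bsub>?Q\<^esub>j\<in>J. c j \<odot>\<^bsub>?Q\<^esub> (N_sub I +>\<^bsub>uc\<^esub> ?e j)) = N_sub I +>\<^bsub>uc\<^esub> ?s c"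
    if c: "c \<in> J \<rightarrow> carrier A" for c
  proof -
    have "(\<Oplus>\<^bsub>?Q\<^esub>j\<in>J. c j \<odot>\<^bsub>?Q\<^esub> (N_sub I +>\<^bsub>uc\<^esub> ?e j)) = (\<Oplus>\<^bsub>?Q\<^esub>j\<in>J. N_sub I +>\<^bsub>uc\<^esub> s (tens A A (c j) (v j)))"
    proof (rule Q.finsum_cong'[OF refl])
      show "(\<lambda>j. N_sub I +>\<^bsub>uc\<^esub> s (tens A A (c j) (v j))) \<in> J \<rightarrow> carrier ?Q"
        using sc[OF c] unfolding Q by auto
      show "c j \<odot>\<^bsub>?Q\<^esub> (N_sub I +>\<^bsub>uc\<^esub> ?e j) = N_sub I +>\<^bsub>uc\<^esub> s (tens A A (c j) (v j))" if "j \<in> J" for j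
      proof -
        have cj: "c j \<in> carrier A" using c that by auto
        show ?thesis
          unfolding Q U.coset_lsmult[OF cj e(1)[OF that], symmetric]
          by (simp add: universal_calculus_simps(4) lact_e[OF cj that])
      qed
    qed
    also have "\<dots> = N_sub I +>\<^bsub>uc\<^esub> (\<Oplus>\<^bsub>uc\<^esub>j\<in>J. s (tens A A (c j) (v j)))"
      by (rule additive_finsum[OF abelian_group_universal Q.abelian_group_axioms _ _ J sc[OF c], symmetric])
        (simp_all add: Q U.coset_add)
    finally show ?thesis by (simp only: finsum_universal[OF J sc[OF c]])
  qed
  show ?thesis
    unfolding free_family_def
  proof (intro conjI ballI impI J)
    show "(\<lambda>j. N_sub I +>\<^bsub>uc\<^esub> ?e j) \<in> J \<rightarrow> carrier ?Q" using e unfolding Q by auto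
  next
    \<comment> \<open>The expected coefficients of \<open>X\<close>. The map \<open>?F\<close>
      removes the combination that they define; spanning means that the remainder always lies in
      \<open>N_sub I\<close>.\<close>
    let ?c = "\<lambda>X j. inverse (\<kappa> j) \<odot> coef (\<phi> j) X"
    let ?F = "\<lambda>X. X \<ominus>\<^bsub>T\<^esub> ?s (?c X)"
    have c: "clinear T A (\<lambda>X. ?c X j)" if "j \<in> J" for j
      by (rule clinear_smult_left[OF cvs_axioms clinear_coef[OF \<phi>[OF that]]])
    have cc: "?c X \<in> J \<rightarrow> carrier A" if "X \<in> carrier T" for X
      using clinear_closed[OF c that] by auto
    have F: "clinear T T ?F"
      using vA by (intro clinear_minus_fun[OF T.cvs_axioms clinear_id] clinear_finsum_fun[OF T.cvs_axioms]
          clinear_comp[OF clinear_comp[OF c TS.clinear_tens(2)] clinear_s]) auto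
    have gen: "?F (s (tens A A a h)) \<in> N_sub I" if a: "a \<in> carrier A" and h: "h \<in> G_plus" for a h
    proof -
      have hA: "h \<in> carrier A" using h by (rule aug_ideal_closed)
      let ?\<mu> = "\<lambda>j. inverse (\<kappa> j) * \<phi> j h"
      let ?h = "\<Oplus>j\<in>J. ?\<mu> j \<odot> v j"
      have hs: "?h \<in> carrier A" using vA by (intro finsum_closed) auto
      have "clinear A T (\<lambda>x. s (tens A A a x))"
        using a by (intro clinear_comp[OF TS.clinear_tens(1) clinear_s])
      note lin = this
      have "?s (?c (s (tens A A a h))) = (\<Oplus>\<^bsub>T\<^esub>j\<in>J. s (tens A A a (?\<mu> j \<odot> v j)))"
      proof (rule T.finsum_cong'[OF refl])
        show "(\<lambda>j. s (tens A A a (?\<mu> j \<odot> v j))) \<in> J \<rightarrow> carrier T" using vA a by (auto intro!: s_closed)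
        show "s (tens A A (?c (s (tens A A a h)) j) (v j)) = s (tens A A a (?\<mu> j \<odot> v j))" if "j \<in> J" for j
          using that a hA vA[OF that]
          by (simp add: coef_s_tens[OF \<phi>[OF that]] smult_assoc[symmetric]
              clinear_smult[OF TS.clinear_tens(1)] clinear_smult[OF TS.clinear_tens(2)])
      qed
      also have "\<dots> = s (tens A A a ?h)"
        using vA by (intro clinear_finsum[OF cvs_axioms T.cvs_axioms lin, symmetric]) auto
      finally have "?F (s (tens A A a h)) = s (tens A A a (h \<ominus> ?h))"
        using hA hs by (simp add: clinear_minus[OF cvs_axioms T.cvs_axioms lin])
      \<comment> \<open>The expansion \<open>?h\<close> takes the same value as \<open>h\<close>
        under every \<open>\<phi> k\<close>, so \<open>sep\<close> puts the difference into
        \<open>I\<close>.\<close>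
      moreover have "h \<ominus> ?h \<in> I"
      proof (rule sep)
        have "\<epsilon> ?h = (\<Sum>j\<in>J. \<epsilon> (?\<mu> j \<odot> v j))"
          using vA by (subst clinear_finsum[OF cvs_axioms cvs_complex_alg clinear_\<epsilon>]) auto
        also have "\<dots> = 0"
          using v vA by (intro sum.neutral) (simp add: clinear_smult[OF clinear_\<epsilon>] aug_ideal_def)
        finally show "h \<ominus> ?h \<in> G_plus"
          using h hA hs by (simp add: aug_ideal_def clinear_minus[OF cvs_axioms cvs_complex_alg clinear_\<epsilon>] complex_alg_minus)
        fix k assume k: "k \<in> J"
        have "\<phi> k ?h = (\<Sum>j\<in>J. \<phi> k (?\<mu> j \<odot> v j))"
          using vA by (subst clinear_finsum[OF cvs_axioms cvs_complex_alg \<phi>[OF k]]) auto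
        also have "\<dots> = (\<Sum>j\<in>J. if j = k then \<phi> k h else 0)"
          using vA k \<kappa>[OF k] by (intro sum.cong) (auto simp: clinear_smult[OF \<phi>[OF k]] \<phi>v)
        also have "\<dots> = \<phi> k h" using J k by simp
        finally show "\<phi> k (h \<ominus> ?h) = 0"
          using hA hs by (simp add: clinear_minus[OF cvs_axioms cvs_complex_alg \<phi>[OF k]] complex_alg_minus)
      qed
      ultimately show ?thesis using s_tens_in_s_sub[OF a] by simp
    qed
    have GA: "G_plus \<subseteq> carrier A" using aug_ideal_closed by blast
    have "carrier uc \<subseteq> {X \<in> carrier T. ?F X \<in> N_sub I}"
      unfolding universal_eq_s_sub s_sub_eq_cspan[OF GA]
      using gen GA by (intro cspan_least submodule_vimage[OF T.cvs_axioms T.cvs_axioms F N]) (auto intro!: s_closed)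
    then have F_uc: "?F X \<in> N_sub I" if "X \<in> carrier uc" for X using that by blast
    fix m assume "m \<in> carrier ?Q"
    then obtain X where X: "X \<in> carrier uc" "m = N_sub I +>\<^bsub>uc\<^esub> X" unfolding Q by (rule U.coset_cases)
    have XT: "X \<in> carrier T" using X by (simp add: universal_calculus_simps(1))
    have sT: "?s (?c X) \<in> carrier T"
      using s_uc[OF cc[OF XT]] by (simp add: universal_calculus_simps(1))
    have "X \<in> N_sub I +>\<^bsub>uc\<^esub> ?s (?c X)"
    proof -
      have "X = ?F X \<oplus>\<^bsub>uc\<^esub> ?s (?c X)"
        using XT sT by (simp add: universal_calculus_simps(2) a_minus_def T.a_assoc T.l_neg)
      then show ?thesis using F_uc[OF X(1)] unfolding a_r_coset_def' by blast
    qed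
    then have "m = N_sub I +>\<^bsub>uc\<^esub> ?s (?c X)"
      using X(2) U.a_repr_independence'[OF _ s_uc[OF cc[OF XT]]] by simp
    then show "\<exists>c\<in>J \<rightarrow> carrier A. m = (\<Oplus>\<^bsub>?Q\<^esub>j\<in>J. c j \<odot>\<^bsub>?Q\<^esub> (N_sub I +>\<^bsub>uc\<^esub> ?e j))"
      using sum[OF cc[OF XT]] cc[OF XT] by auto
  next
    fix c c' k assume c: "c \<in> J \<rightarrow> carrier A" and c': "c' \<in> J \<rightarrow> carrier A" and k: "k \<in> J"
      and eq: "(\<Oplus>\<^bsub>?Q\<^esub>j\<in>J. c j \<odot>\<^bsub>?Q\<^esub> (N_sub I +>\<^bsub>uc\<^esub> ?e j)) = (\<Oplus>\<^bsub>?Q\<^esub>j\<in>J. c' j \<odot>\<^bsub>?Q\<^esub> (N_sub I +>\<^bsub>uc\<^esub> ?e j))"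
    \<comment> \<open>The \<open>k\<close>-th coordinate of a combination returns
      \<open>\<kappa> k\<close> times its \<open>k\<close>-th coefficient. As the coordinate kills
      \<open>N_sub I\<close>, equal classes have equal coefficients.\<close>
    have coef_s: "coef (\<phi> k) (?s c) = \<kappa> k \<odot> c k" if c: "c \<in> J \<rightarrow> carrier A" for c
    proof -
      have sT: "(\<lambda>j. s (tens A A (c j) (v j))) \<in> J \<rightarrow> carrier T" using sc[OF c] by (auto simp: universal_calculus_simps(1))
      have "coef (\<phi> k) (?s c) = (\<Oplus>j\<in>J. coef (\<phi> k) (s (tens A A (c j) (v j))))"
        by (rule clinear_finsum[OF T.cvs_axioms cvs_axioms clinear_coef[OF \<phi>[OF k]] sT])
      also have "\<dots> = (\<Oplus>j\<in>J. if k = j then \<kappa> j \<odot> c j else \<zero>)"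
        using c vA k by (intro finsum_cong') (auto simp: coef_s_tens[OF \<phi>[OF k]] \<phi>v Pi_iff)
      also have "\<dots> = \<kappa> k \<odot> c k"
        using c by (intro finsum_singleton[OF k J]) auto
      finally show ?thesis .
    qed
    have "?s c \<in> N_sub I +>\<^bsub>uc\<^esub> ?s c'"
      using U.a_rcos_self[OF s_uc[OF c]] eq by (simp add: sum[OF c] sum[OF c'])
    then obtain n where n: "n \<in> N_sub I" "?s c = n \<oplus>\<^bsub>T\<^esub> ?s c'"
      by (auto simp: a_r_coset_def' universal_calculus_simps(2))
    have "n \<in> carrier T" "?s c' \<in> carrier T"
      using n N s_uc[OF c'] by (auto simp: T.submodule_iff universal_calculus_simps(1))
    then have "coef (\<phi> k) (?s c) = coef (\<phi> k) n \<oplus> coef (\<phi> k) (?s c')"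
      unfolding n(2) by (rule clinear_add[OF clinear_coef[OF \<phi>[OF k]]])
    also have "coef (\<phi> k) n = \<zero>" using \<phi>I[OF k] n(1) by (intro coef_s_sub[OF \<phi>[OF k] IA])
    finally have "\<kappa> k \<odot> c k = \<kappa> k \<odot> c' k"
      using c c' k by (simp add: coef_s Pi_iff)
    then have "inverse (\<kappa> k) \<odot> (\<kappa> k \<odot> c k) = inverse (\<kappa> k) \<odot> (\<kappa> k \<odot> c' k)" by simp
    then show "c k = c' k"
      using c c' k \<kappa>[OF k] by (simp add: smult_assoc[symmetric] Pi_iff)
  qed
qed

section \<open>Invariant forms and iterated quotients of calculi\<close>

lemma cvs_aug_ideal: "cvs (A\<lparr>carrier := G_plus\<rparr>)" (is "cvs ?P")
  and clinear_aug_ideal_incl: "clinear (A\<lparr>carrier := G_plus\<rparr>) A (\<lambda>x. x)"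
proof -
  have G0: "\<zero> \<in> G_plus" and Ga: "\<And>x y. x \<in> G_plus \<Longrightarrow> y \<in> G_plus \<Longrightarrow> x \<oplus> y \<in> G_plus"
    and Gs: "\<And>c x. x \<in> G_plus \<Longrightarrow> c \<odot> x \<in> G_plus"
    using submodule_aug_ideal unfolding submodule_iff by auto
  have Gc: "x \<in> G_plus \<Longrightarrow> x \<in> carrier A" for x by (rule aug_ideal_closed)
  have "abelian_group ?P"
  proof (rule abelian_groupI)
    show "\<exists>y\<in>carrier ?P. y \<oplus>\<^bsub>?P\<^esub> x = \<zero>\<^bsub>?P\<^esub>" if "x \<in> carrier ?P" for x
      using that Gs[of x "-1"] Gc[of x] by (intro bexI[of _ "(- 1) \<odot> x"]) (simp_all add: smult_minus_one l_neg)
  qed (simp_all add: G0 Ga Gc a_ac)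
  then show "cvs ?P"
    by (intro cvs.intro cvs_axioms.intro) (simp_all add: Gs Gc smult_l_distr smult_r_distr smult_assoc)
  show "clinear ?P A (\<lambda>x. x)" by (rule clinearI) (auto simp: Gc)
qed

text \<open>The record with carrier \<open>G_plus\<close> does not contain its own unit, because
  \<open>\<epsilon>(1) = 1\<close>; it is therefore handled as a vector space, and its quotient by
  \<open>K\<close> as a quotient of vector spaces.\<close>

lemma quotient_space_inv_forms:
  assumes "right_ideal_in A G_plus K"
  shows "quotient_space (A\<lparr>carrier := G_plus\<rparr>) K"
proof (rule quotient_spaceI[OF cvs_aug_ideal submodule_subspace[OF cvs_aug_ideal clinear_aug_ideal_incl]])
  show "submodule K complex_alg A" "K \<subseteq> carrier (A\<lparr>carrier := G_plus\<rparr>)"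
    using assms by (auto simp: right_ideal_in_def)
qed

lemma coset_aug_ideal: "K +>\<^bsub>A\<lparr>carrier := G_plus\<rparr>\<^esub> v = K +> v"
  by (simp add: a_r_coset_def')

lemma clinear_coset_inv_forms:
  assumes "right_ideal_in A G_plus K"
  shows "clinear (A\<lparr>carrier := G_plus\<rparr>) (inv_forms A \<epsilon> K) (\<lambda>v. K +> v)"
  using quotient_space.clinear_coset[OF quotient_space_inv_forms[OF assms]]
  by (simp add: inv_forms_def coset_aug_ideal)

lemma cspan_aug_ideal: "X \<subseteq> G_plus \<Longrightarrow> cspan (A\<lparr>carrier := G_plus\<rparr>) X = cspan A X"
  by (intro cspan_subspace cvs_aug_ideal cvs_axioms clinear_aug_ideal_incl) simp

text \<open>The residue map kills \<open>K\<close> and carries spans to spans. The two summands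
  appear in the opposite order on the right because \<open>V\<^sub>D\<close> is written that
  way.\<close>

lemma inv_forms_image:
  assumes K: "right_ideal_in A G_plus K" and D: "D\<^sub>1 \<subseteq> G_plus" "D\<^sub>2 \<subseteq> G_plus"
  shows "(\<lambda>v. K +> v) ` (K <+>\<^bsub>A\<^esub> cspan A D\<^sub>1 <+>\<^bsub>A\<^esub> cspan A D\<^sub>2) =
    cspan (inv_forms A \<epsilon> K) ((\<lambda>v. K +> v) ` D\<^sub>2) <+>\<^bsub>inv_forms A \<epsilon> K\<^esub> cspan (inv_forms A \<epsilon> K) ((\<lambda>v. K +> v) ` D\<^sub>1)"
proof -
  let ?P = "A\<lparr>carrier := G_plus\<rparr>" and ?\<Lambda> = "inv_forms A \<epsilon> K" and ?p = "\<lambda>v. K +> v"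
  interpret P: quotient_space ?P K by (rule quotient_space_inv_forms[OF K])
  interpret \<Lambda>: cvs ?\<Lambda> unfolding inv_forms_def by (rule P.cvs_quotient)
  note p = clinear_coset_inv_forms[OF K]
  have span: "?p ` cspan A D = cspan ?\<Lambda> (?p ` D)" if "D \<subseteq> G_plus" for D
    using that cspan_image[OF cvs_aug_ideal \<Lambda>.cvs_axioms p] by (simp add: cspan_aug_ideal)
  have sub: "cspan A D \<subseteq> G_plus" if "D \<subseteq> G_plus" for D
    using that by (intro cspan_least submodule_aug_ideal)
  have KG: "K \<subseteq> G_plus" and K0: "\<zero> \<in> K" using K by (auto simp: right_ideal_in_def submodule_iff)
  have pk: "?p k = \<zero>\<^bsub>?\<Lambda>\<^esub>" if "k \<in> K" for k
  proof -
    have "K +>\<^bsub>?P\<^esub> k = K" using that KG by (subst P.coset_eq_self_iff) auto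
    then show ?thesis by (simp add: coset_aug_ideal inv_forms_def quotient_alg_simps(3))
  qed
  have p3: "?p (k \<oplus> d\<^sub>1 \<oplus> d\<^sub>2) = ?p d\<^sub>2 \<oplus>\<^bsub>?\<Lambda>\<^esub> ?p d\<^sub>1"
    if "k \<in> K" "d\<^sub>1 \<in> cspan A D\<^sub>1" "d\<^sub>2 \<in> cspan A D\<^sub>2" for k d\<^sub>1 d\<^sub>2
  proof -
    have G: "k \<in> G_plus" "d\<^sub>1 \<in> G_plus" "d\<^sub>2 \<in> G_plus"
      using that KG sub[OF D(1)] sub[OF D(2)] by auto
    then have "?p (k \<oplus> d\<^sub>1 \<oplus> d\<^sub>2) = ?p k \<oplus>\<^bsub>?\<Lambda>\<^esub> ?p d\<^sub>1 \<oplus>\<^bsub>?\<Lambda>\<^esub> ?p d\<^sub>2"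
      using clinear_add[OF p, of "k \<oplus> d\<^sub>1" d\<^sub>2] clinear_add[OF p, of k d\<^sub>1] P.add.m_closed[of k d\<^sub>1] by simp
    then show ?thesis
      using G clinear_closed[OF p, of d\<^sub>1] clinear_closed[OF p, of d\<^sub>2] pk[OF that(1)] by (simp add: \<Lambda>.a_comm)
  qed
  show ?thesis
    unfolding span[OF D(1), symmetric] span[OF D(2), symmetric]
  proof (intro equalityI subsetI)
    fix x assume "x \<in> ?p ` (K <+>\<^bsub>A\<^esub> cspan A D\<^sub>1 <+>\<^bsub>A\<^esub> cspan A D\<^sub>2)"
    then obtain k d\<^sub>1 d\<^sub>2 where d: "k \<in> K" "d\<^sub>1 \<in> cspan A D\<^sub>1" "d\<^sub>2 \<in> cspan A D\<^sub>2" "x = ?p (k \<oplus> d\<^sub>1 \<oplus> d\<^sub>2)"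
      by (auto simp: mem_set_add)
    then show "x \<in> ?p ` cspan A D\<^sub>2 <+>\<^bsub>?\<Lambda>\<^esub> ?p ` cspan A D\<^sub>1"
      unfolding mem_set_add using p3[OF d(1-3)] by (intro bexI[of _ "?p d\<^sub>2"] bexI[of _ "?p d\<^sub>1"]) simp_all
  next
    fix x assume "x \<in> ?p ` cspan A D\<^sub>2 <+>\<^bsub>?\<Lambda>\<^esub> ?p ` cspan A D\<^sub>1"
    then obtain d\<^sub>1 d\<^sub>2 where d: "d\<^sub>1 \<in> cspan A D\<^sub>1" "d\<^sub>2 \<in> cspan A D\<^sub>2" "x = ?p d\<^sub>2 \<oplus>\<^bsub>?\<Lambda>\<^esub> ?p d\<^sub>1"
      by (auto simp: mem_set_add)
    then have "x = ?p (\<zero> \<oplus> d\<^sub>1 \<oplus> d\<^sub>2)" using p3[OF K0] by simp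
    moreover have "\<zero> \<oplus> d\<^sub>1 \<oplus> d\<^sub>2 \<in> K <+>\<^bsub>A\<^esub> cspan A D\<^sub>1 <+>\<^bsub>A\<^esub> cspan A D\<^sub>2"
    proof -
      have "\<zero> \<oplus> d\<^sub>1 \<in> K <+>\<^bsub>A\<^esub> cspan A D\<^sub>1" unfolding mem_set_add using d K0 by blast
      then show ?thesis unfolding mem_set_add[of _ _ _ "cspan A D\<^sub>2"] using d by blast
    qed
    ultimately show "x \<in> ?p ` (K <+>\<^bsub>A\<^esub> cspan A D\<^sub>1 <+>\<^bsub>A\<^esub> cspan A D\<^sub>2)" by (rule image_eqI)
  qed
qed

lemma clinear_complex_space_universal: "clinear (complex_space A uc) T (\<lambda>X. X)"
  by (rule clinearI) (simp_all add: complex_space_def universal_calculus_simps(1,2,4) lact_scalar)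

text \<open>Changing the representative \<open>v\<close> by an element \<open>k\<close> of the ideal
  \<open>K\<close> changes \<open>s(a \<otimes> v)\<close> by \<open>s(a \<otimes> k)\<close>, which
  lies in \<open>N_sub K\<close>. Hence the union in \<open>s_quot\<close> is a single class and
  depends bilinearly on \<open>a\<close> and the coset.\<close>

lemma s_quot_tens:
  assumes K: "right_ideal_in A G_plus K"
  shows "cbilinear A (inv_forms A \<epsilon> K) (complex_space A (ideal_calculus A \<Delta> S K))
      (\<lambda>a V. \<Union>v\<in>V. N_sub K +>\<^bsub>uc\<^esub> s (tens A A a v))" (is "cbilinear A ?\<Lambda> ?C ?\<beta>")
    and "\<lbrakk>a \<in> carrier A; v \<in> G_plus\<rbrakk> \<Longrightarrow>
      s_quot A \<Delta> S K (tens A (inv_forms A \<epsilon> K) a (K +> v)) = N_sub K +>\<^bsub>uc\<^esub> s (tens A A a v)"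
proof -
  let ?P = "A\<lparr>carrier := G_plus\<rparr>" and ?N = "N_sub K"
  interpret P: quotient_space ?P K by (rule quotient_space_inv_forms[OF K])
  interpret \<Lambda>: cvs ?\<Lambda> unfolding inv_forms_def by (rule P.cvs_quotient)
  interpret U: subcalculus A uc ?N by (intro subcalculusI calculus_universal subbimodule_s_sub K)
  have Q: "ideal_calculus A \<Delta> S K = quotient_calculus uc ?N" by (simp add: ideal_calculus_def)
  interpret C: cvs ?C unfolding Q by (rule calculus.cvs_complex_space[OF U.calculus_quotient])
  note p = clinear_coset_inv_forms[OF K]
  have KA: "K \<subseteq> carrier A" using K aug_ideal_closed by (auto simp: right_ideal_in_def)
  have sG: "s (tens A A a v) \<in> carrier uc" if "a \<in> carrier A" "v \<in> G_plus" for a v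
    unfolding universal_eq_s_sub using that by (intro s_tens_in_s_sub)
  have uT: "X \<in> carrier T" if "X \<in> carrier uc" for X using that by (simp add: universal_calculus_simps(1))
  have \<beta>: "?\<beta> a (K +> v) = ?N +>\<^bsub>uc\<^esub> s (tens A A a v)" if a: "a \<in> carrier A" and v: "v \<in> G_plus" for a v
  proof -
    have "(\<Union>v'\<in>K +>\<^bsub>?P\<^esub> v. ?N +>\<^bsub>uc\<^esub> s (tens A A a v')) = ?N +>\<^bsub>uc\<^esub> s (tens A A a v)"
    proof (rule P.UN_coset)
      fix x assume x: "x \<in> carrier ?P" "x \<ominus>\<^bsub>?P\<^esub> v \<in> K"
      let ?d = "x \<ominus>\<^bsub>?P\<^esub> v"
      have dA: "?d \<in> carrier A" using x(2) KA by blast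
      have "x = ?d \<oplus>\<^bsub>?P\<^esub> v"
        using abelian_group.minus_add_cancel[OF cvs.axioms(1)[OF cvs_aug_ideal], of x v] x(1) v by simp
      then have xd: "x = ?d \<oplus> v" by simp
      have "s (tens A A a x) = s (tens A A a ?d) \<oplus>\<^bsub>uc\<^esub> s (tens A A a v)"
        using a v aug_ideal_closed dA
        by (subst xd) (simp add: clinear_add[OF TS.clinear_tens(1)] clinear_add[OF clinear_s] universal_calculus_simps(2))
      then have "s (tens A A a x) \<in> ?N +>\<^bsub>uc\<^esub> s (tens A A a v)"
        using s_tens_in_s_sub[OF a x(2)] unfolding a_r_coset_def' by blast
      then show "?N +>\<^bsub>uc\<^esub> s (tens A A a x) = ?N +>\<^bsub>uc\<^esub> s (tens A A a v)"
        using U.a_repr_independence'[OF _ sG[OF a v]] by simp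
    qed (use v in simp)
    then show ?thesis by (simp add: coset_aug_ideal)
  qed
  have cases: "\<exists>v\<in>G_plus. V = K +> v" if "V \<in> carrier ?\<Lambda>" for V
    using that unfolding inv_forms_def by (auto elim!: P.coset_cases simp: coset_aug_ideal)
  have Gadd: "v \<oplus> w \<in> G_plus" and Gsmult: "c \<odot> v \<in> G_plus" if "v \<in> G_plus" "w \<in> G_plus" for v w c
    using submodule_aug_ideal that by (auto simp: submodule_iff)
  have padd: "(K +> v) \<oplus>\<^bsub>?\<Lambda>\<^esub> (K +> w) = K +> (v \<oplus> w)" and psmult: "c \<odot>\<^bsub>?\<Lambda>\<^esub> (K +> v) = K +> (c \<odot> v)"
    if "v \<in> G_plus" "w \<in> G_plus" for v w c
    using clinear_add[OF p, of v w] clinear_smult[OF p, of v c] that by auto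
  have C: "carrier ?C = carrier (quotient_calculus uc ?N)" "add ?C = add (quotient_calculus uc ?N)"
    "c \<odot>\<^bsub>?C\<^esub> m = (c \<odot> \<one>) \<odot>\<^bsub>quotient_calculus uc ?N\<^esub> m" for c m
    by (simp_all add: complex_space_def Q)
  have Cadd: "(?N +>\<^bsub>uc\<^esub> X) \<oplus>\<^bsub>?C\<^esub> (?N +>\<^bsub>uc\<^esub> Y) = ?N +>\<^bsub>uc\<^esub> (X \<oplus>\<^bsub>T\<^esub> Y)"
    if "X \<in> carrier uc" "Y \<in> carrier uc" for X Y
    using U.coset_add[OF that] by (simp add: C(2) universal_calculus_simps(2))
  have Csmult: "c \<odot>\<^bsub>?C\<^esub> (?N +>\<^bsub>uc\<^esub> X) = ?N +>\<^bsub>uc\<^esub> (c \<odot>\<^bsub>T\<^esub> X)" if "X \<in> carrier uc" for c X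
    using U.coset_lsmult[OF _ that, of "c \<odot> \<one>"] uT[OF that] by (simp add: C(3) universal_calculus_simps(4) lact_scalar)
  show bil: "cbilinear A ?\<Lambda> ?C ?\<beta>"
  proof (intro cbilinearI clinearI)
    fix a V c assume a: "a \<in> carrier A" and "V \<in> carrier ?\<Lambda>"
    then obtain v where v: "v \<in> G_plus" "V = K +> v" using cases by blast
    then show "?\<beta> a V \<in> carrier ?C" using a sG by (simp add: \<beta> C(1))
    show "?\<beta> a (c \<odot>\<^bsub>?\<Lambda>\<^esub> V) = c \<odot>\<^bsub>?C\<^esub> ?\<beta> a V"
      using a v(1) Gsmult[OF v(1) v(1)] aug_ideal_closed[OF v(1)]
      by (simp add: v(2) psmult \<beta> Csmult sG clinear_smult[OF TS.clinear_tens(1)] clinear_smult[OF clinear_s])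
    fix W assume "W \<in> carrier ?\<Lambda>"
    then obtain w where w: "w \<in> G_plus" "W = K +> w" using cases by blast
    show "?\<beta> a (V \<oplus>\<^bsub>?\<Lambda>\<^esub> W) = ?\<beta> a V \<oplus>\<^bsub>?C\<^esub> ?\<beta> a W"
      using a v(1) w(1) Gadd[OF v(1) w(1)] aug_ideal_closed[OF v(1)] aug_ideal_closed[OF w(1)]
      by (simp add: v(2) w(2) padd \<beta> Cadd sG clinear_add[OF TS.clinear_tens(1)] clinear_add[OF clinear_s])
  next
    fix V a c assume a: "a \<in> carrier A" and "V \<in> carrier ?\<Lambda>"
    then obtain v where v: "v \<in> G_plus" "V = K +> v" using cases by blast
    then show "?\<beta> a V \<in> carrier ?C" using a sG by (simp add: \<beta> C(1))
    show "?\<beta> (c \<odot> a) V = c \<odot>\<^bsub>?C\<^esub> ?\<beta> a V"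
      using a v(1) aug_ideal_closed[OF v(1)]
      by (simp add: v(2) \<beta> Csmult sG clinear_smult[OF TS.clinear_tens(2)] clinear_smult[OF clinear_s])
    fix b assume b: "b \<in> carrier A"
    show "?\<beta> (a \<oplus> b) V = ?\<beta> a V \<oplus>\<^bsub>?C\<^esub> ?\<beta> b V"
      using a b v(1) aug_ideal_closed[OF v(1)]
      by (simp add: v(2) \<beta> Cadd sG clinear_add[OF TS.clinear_tens(2)] clinear_add[OF clinear_s])
  qed
  interpret A\<Lambda>: tensor_space A ?\<Lambda> by (intro tensor_spaceI cvs_axioms \<Lambda>.cvs_axioms)
  assume "a \<in> carrier A" "v \<in> G_plus"
  then show "s_quot A \<Delta> S K (tens A ?\<Lambda> a (K +> v)) = ?N +>\<^bsub>uc\<^esub> s (tens A A a v)"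
    unfolding s_quot_def using clinear_closed[OF p, of v]
    by (subst A\<Lambda>.tlift_tens[OF C.cvs_axioms bil]) (simp_all add: \<beta>)
qed

text \<open>Both sides are linear images of spans, and by \<open>s_quot_tens\<close> both are
  spanned by the classes of \<open>s(a \<otimes> v)\<close> with \<open>v\<close> in
  \<open>I\<close>.\<close>

lemma s_quot_image:
  assumes K: "right_ideal_in A G_plus K" and I: "I \<subseteq> G_plus"
  shows "s_quot A \<Delta> S K ` tensor_sub A (inv_forms A \<epsilon> K) (carrier A) ((\<lambda>v. K +> v) ` I)
    = (\<lambda>X. N_sub K +>\<^bsub>uc\<^esub> X) ` N_sub I"
proof -
  let ?\<Lambda> = "inv_forms A \<epsilon> K" and ?C = "complex_space A (ideal_calculus A \<Delta> S K)" and ?N = "N_sub K"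
  let ?P = "A\<lparr>carrier := G_plus\<rparr>" and ?U = "complex_space A uc"
  interpret P: quotient_space ?P K by (rule quotient_space_inv_forms[OF K])
  interpret \<Lambda>: cvs ?\<Lambda> unfolding inv_forms_def by (rule P.cvs_quotient)
  interpret U: subcalculus A uc ?N by (intro subcalculusI calculus_universal subbimodule_s_sub K)
  have Q: "ideal_calculus A \<Delta> S K = quotient_calculus uc ?N" by (simp add: ideal_calculus_def)
  interpret C: cvs ?C unfolding Q by (rule calculus.cvs_complex_space[OF U.calculus_quotient])
  interpret UC: cvs ?U by (rule U.cvs_complex_space)
  interpret A\<Lambda>: tensor_space A ?\<Lambda> by (intro tensor_spaceI cvs_axioms \<Lambda>.cvs_axioms)
  have IA: "I \<subseteq> carrier A" using I aug_ideal_closed by blast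
  let ?Z = "{s (tens A A a v) | a v. a \<in> carrier A \<and> v \<in> I}"
  have Z: "?Z \<subseteq> carrier ?U"
    using s_sub_universal[OF I] s_tens_in_s_sub by (auto simp: complex_space_def)
  have rho: "clinear ?U ?C (\<lambda>X. ?N +>\<^bsub>uc\<^esub> X)"
    by (rule clinearI) (simp_all add: complex_space_def Q U.coset_add U.coset_lsmult)
  have pI: "K +> v \<in> carrier ?\<Lambda>" if "v \<in> I" for v
    using clinear_closed[OF clinear_coset_inv_forms[OF K], of v] that I by auto
  have lin: "clinear (tensor A ?\<Lambda>) ?C (s_quot A \<Delta> S K)"
    unfolding s_quot_def by (rule A\<Lambda>.clinear_tlift[OF C.cvs_axioms s_quot_tens(1)[OF K]])
  have "s_quot A \<Delta> S K ` tensor_sub A ?\<Lambda> (carrier A) ((\<lambda>v. K +> v) ` I) =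
      cspan ?C (s_quot A \<Delta> S K ` {tens A ?\<Lambda> a V | a V. a \<in> carrier A \<and> V \<in> (\<lambda>v. K +> v) ` I})"
    unfolding tensor_sub_def using pI by (intro cspan_image A\<Lambda>.cvs_tensor C.cvs_axioms lin) auto
  also have "s_quot A \<Delta> S K ` {tens A ?\<Lambda> a V | a V. a \<in> carrier A \<and> V \<in> (\<lambda>v. K +> v) ` I}
      = (\<lambda>X. ?N +>\<^bsub>uc\<^esub> X) ` ?Z"
  proof -
    have "{tens A ?\<Lambda> a V | a V. a \<in> carrier A \<and> V \<in> (\<lambda>v. K +> v) ` I}
        = (\<lambda>(a, v). tens A ?\<Lambda> a (K +> v)) ` (carrier A \<times> I)" by auto
    moreover have "?Z = (\<lambda>(a, v). s (tens A A a v)) ` (carrier A \<times> I)" by auto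
    ultimately show ?thesis
      unfolding image_image using s_quot_tens(2)[OF K] I by (auto simp: image_image intro!: image_cong)
  qed
  also have "cspan ?C ((\<lambda>X. ?N +>\<^bsub>uc\<^esub> X) ` ?Z) = (\<lambda>X. ?N +>\<^bsub>uc\<^esub> X) ` cspan ?U ?Z"
    by (rule cspan_image[OF UC.cvs_axioms C.cvs_axioms rho Z, symmetric])
  \<comment> \<open>The scalar \<open>c\<close> acts on the universal calculus as left
    multiplication by \<open>c 1\<close>, which is the scalar multiplication of
    \<open>A \<otimes> A\<close>; so the two notions of span agree.\<close>
  also have "cspan ?U ?Z = N_sub I"
    unfolding s_sub_eq_cspan[OF IA]
    by (rule cspan_subspace[OF UC.cvs_axioms T.cvs_axioms clinear_complex_space_universal Z])
  finally show ?thesis .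
qed

text \<open>The third isomorphism theorem for \<open>N_sub K \<subseteq> N_sub I\<close>, after
  \<open>s_quot_image\<close> has identified \<open>W\<close> with the image of
  \<open>N_sub I\<close>. The value of the isomorphism on invariant forms is recorded for
  transporting the basis.\<close>

theorem quotient_of_ideal_calculus:
  fixes K I
  assumes K: "right_ideal_in A G_plus K" and I: "right_ideal_in A G_plus I" and KI: "K \<subseteq> I"
  defines "\<Omega> \<equiv> ideal_calculus A \<Delta> S K" and "\<Lambda> \<equiv> inv_forms A \<epsilon> K"
  defines "W \<equiv> s_quot A \<Delta> S K ` tensor_sub A \<Lambda> (carrier A) ((\<lambda>v. K +> v) ` I)"
  shows "subbimodule A \<Omega> W" and "calculus A (quotient_calculus \<Omega> W)"
    and "\<exists>\<phi>. calculus_iso A (ideal_calculus A \<Delta> S I) (quotient_calculus \<Omega> W) \<phi> \<and>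
      (\<forall>v\<in>G_plus. \<phi> (N_sub I +>\<^bsub>uc\<^esub> s (tens A A \<one> v)) = W +>\<^bsub>\<Omega>\<^esub> s_quot A \<Delta> S K (tens A \<Lambda> \<one> (K +> v)))"
proof -
  have IG: "I \<subseteq> G_plus" using I by (simp add: right_ideal_in_def)
  have IA: "I \<subseteq> carrier A" using IG aug_ideal_closed by blast
  have KN: "N_sub K \<subseteq> N_sub I"
  proof -
    have "tensor_sub A A (carrier A) K \<subseteq> tensor_sub A A (carrier A) I"
      using KI IA unfolding tensor_sub_def[of _ _ _ K]
      by (intro cspan_least TS.submodule_tensor_sub) (auto intro!: TS.tensor_subI)
    then show ?thesis unfolding s_sub_def by blast
  qed
  have W: "W = (\<lambda>X. N_sub K +>\<^bsub>uc\<^esub> X) ` N_sub I"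
    unfolding W_def \<Lambda>_def by (rule s_quot_image[OF K IG])
  have \<Omega>: "\<Omega> = quotient_calculus uc (N_sub K)" by (simp add: \<Omega>_def ideal_calculus_def)
  note iso = third_isomorphism[OF calculus_universal subbimodule_s_sub[OF K] subbimodule_s_sub[OF I] KN,
      folded \<Omega> W]
  show sub: "subbimodule A \<Omega> W" by (rule iso(1))
  have "calculus A \<Omega>"
    unfolding \<Omega> by (intro subcalculus.calculus_quotient subcalculusI calculus_universal subbimodule_s_sub K)
  then show "calculus A (quotient_calculus \<Omega> W)"
    by (intro subcalculus.calculus_quotient subcalculusI sub)
  have sG: "s (tens A A \<one> v) \<in> carrier uc" if "v \<in> G_plus" for v
    unfolding universal_eq_s_sub using that by (intro s_tens_in_s_sub) auto
  obtain \<phi> where \<phi>: "calculus_iso A (quotient_calculus uc (N_sub I)) (quotient_calculus \<Omega> W) \<phi>"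
      "\<And>X. X \<in> carrier uc \<Longrightarrow> \<phi> (N_sub I +>\<^bsub>uc\<^esub> X) = W +>\<^bsub>\<Omega>\<^esub> (N_sub K +>\<^bsub>uc\<^esub> X)"
    using iso(2) by blast
  then show "\<exists>\<phi>. calculus_iso A (ideal_calculus A \<Delta> S I) (quotient_calculus \<Omega> W) \<phi> \<and>
      (\<forall>v\<in>G_plus. \<phi> (N_sub I +>\<^bsub>uc\<^esub> s (tens A A \<one> v)) = W +>\<^bsub>\<Omega>\<^esub> s_quot A \<Delta> S K (tens A \<Lambda> \<one> (K +> v)))"
    using sG unfolding \<Lambda>_def ideal_calculus_def[of _ _ _ I]
    by (intro exI[of _ \<phi>]) (simp add: s_quot_tens(2)[OF K])
qed

end

section \<open>The quantum Killing representation\<close>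

lemma clinear_complex_sum:
  "(\<And>i. i \<in> X \<Longrightarrow> clinear V complex_alg (f i)) \<Longrightarrow> clinear V complex_alg (\<lambda>x. \<Sum>i\<in>X. f i x)"
  using clinear_finsum_fun[OF cvs_complex_alg, of X V f] by simp

lemma clinear_complex_mult:
  "clinear V complex_alg f \<Longrightarrow> clinear V complex_alg (\<lambda>x. z * f x)"
  using clinear_smult_left[OF cvs_complex_alg, of V f z] by simp

lemma clinear_complex_mult_right:
  "clinear V complex_alg f \<Longrightarrow> clinear V complex_alg (\<lambda>x. f x * z)"
  using clinear_complex_mult[of V f z] by (simp add: mult.commute)

definition Rc :: "real \<Rightarrow> nat \<Rightarrow> nat \<Rightarrow> nat \<Rightarrow> nat \<Rightarrow> complex" where
  "Rc q i k j l = of_real (R_matrix q i k j l)"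

lemma Rc_eq:
  "Rc q i k j l = (if i = l \<and> k = j then (if i = k then of_real q else 1) else 0)
     + (if i = j \<and> k = l \<and> i < k then of_real (q - inverse q) else 0)"
  by (auto simp: Rc_def R_matrix_def)

text \<open>The setting of the matrix computation: the values of the structure maps on the
  generators, and \<open>generated\<close>, an induction principle that prepends one generator at a
  time.\<close>

locale quantum_killing = hopf A \<Delta> \<epsilon> S
  for A :: "(complex, 'a) module" (structure) and \<Delta> \<epsilon> S +
  fixes N :: nat and q :: real and q_root :: complex and r and u :: "nat \<Rightarrow> nat \<Rightarrow> 'a"
  assumes N: "N \<ge> 2" and q: "0 < q" "q \<le> 1" and q_root: "q_root ^ N = of_real q"
    and u_closed: "\<lbrakk>i \<in> {1..N}; j \<in> {1..N}\<rbrakk> \<Longrightarrow> u i j \<in> carrier A"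
    and comult: "\<lbrakk>i \<in> {1..N}; j \<in> {1..N}\<rbrakk> \<Longrightarrow> \<Delta> (u i j) = (\<Oplus>\<^bsub>T\<^esub>k\<in>{1..N}. tens A A (u i k) (u k j))"
    and counit: "\<lbrakk>i \<in> {1..N}; j \<in> {1..N}\<rbrakk> \<Longrightarrow> \<epsilon> (u i j) = of_bool (i = j)"
    and coquasi: "coquasitriangular A \<Delta> \<epsilon> r"
    and r_gen: "\<lbrakk>i \<in> {1..N}; j \<in> {1..N}; k \<in> {1..N}; l \<in> {1..N}\<rbrakk>
      \<Longrightarrow> r (u i j) (u k l) = inverse q_root * of_real (R_matrix q k i j l)"
    and generated: "\<lbrakk>submodule U complex_alg A; \<one> \<in> U;
        \<And>i j x. \<lbrakk>i \<in> {1..N}; j \<in> {1..N}; x \<in> U\<rbrakk> \<Longrightarrow> u i j \<otimes> x \<in> U\<rbrakk> \<Longrightarrow> carrier A \<subseteq> U"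
begin

declare One_nat_def [simp del]

abbreviation "c \<equiv> inverse q_root"
abbreviation "\<nu> \<equiv> complex_of_real (q - inverse q)"

lemma c_nonzero: "c \<noteq> 0"
  using q q_root N by (auto simp: power_0_left split: if_splits)

lemma \<nu>_nonzero: "q \<noteq> 1 \<Longrightarrow> \<nu> \<noteq> 0"
proof -
  assume "q \<noteq> 1"
  then have "inverse q > 1" using q by (simp add: one_less_inverse)
  then show ?thesis using q by (metis add_0 diff_add_cancel not_le of_real_eq_0_iff)
qed

text \<open>Equality would give \<open>q_root\<^sup>2 = q\<^sup>2\<close>; the \<open>N\<close>-th
  power of this is \<open>q\<^sup>2 = (q\<^sup>2)\<^sup>N\<close>, impossible for
  \<open>0 < q < 1\<close> and \<open>N \<ge> 2\<close>. The argument is the same for every complex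
  root.\<close>

lemma c2q2: "q \<noteq> 1 \<Longrightarrow> c\<^sup>2 * (of_real q)\<^sup>2 \<noteq> 1"
proof
  assume "q \<noteq> 1" and eq: "c\<^sup>2 * (of_real q)\<^sup>2 = 1"
  have qr: "q_root \<noteq> 0" using c_nonzero by auto
  have "(of_real q)\<^sup>2 = q_root\<^sup>2"
    using eq qr by (simp add: field_simps power2_eq_square)
  then have "((of_real q)\<^sup>2) ^ N = (q_root ^ N)\<^sup>2" by (metis power_mult mult.commute)
  then have "complex_of_real ((q\<^sup>2) ^ N) = complex_of_real (q\<^sup>2)" by (simp add: q_root)
  then have "(q\<^sup>2) ^ N = q\<^sup>2" by (rule of_real_eq_iff[THEN iffD1])
  moreover have "q\<^sup>2 < 1" "0 < q\<^sup>2" using q \<open>q \<noteq> 1\<close> by (auto simp: power_less_one_iff)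
  then have "(q\<^sup>2) ^ N < (q\<^sup>2) ^ 1" using N by (intro power_strict_decreasing) auto
  ultimately show False by simp
qed

section \<open>The matrices of \<open>r\<close> and their triangularity\<close>

lemma r_linear: "f \<in> carrier A \<Longrightarrow> clinear A complex_alg (r f)"
  "g \<in> carrier A \<Longrightarrow> clinear A complex_alg (\<lambda>f. r f g)"
  using coquasi by (auto simp: coquasitriangular_def bilinear_form_def)

lemma cbilinear_prod:
  assumes "clinear A complex_alg f" "clinear A complex_alg g"
  shows "cbilinear A A complex_alg (\<lambda>a b. f a * g b)"
  by (intro cbilinearI clinear_complex_mult clinear_complex_mult_right assms)

lemma tlift_comult:
  assumes "cvs W" "cbilinear A A W \<beta>" "i \<in> {1..N}" "j \<in> {1..N}"
  shows "tlift W \<beta> (\<Delta> (u i j)) = (\<Oplus>\<^bsub>W\<^esub>k\<in>{1..N}. \<beta> (u i k) (u k j))"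
proof -
  interpret W: cvs W by fact
  have "tlift W \<beta> (\<Delta> (u i j)) = (\<Oplus>\<^bsub>W\<^esub>k\<in>{1..N}. tlift W \<beta> (tens A A (u i k) (u k j)))"
    unfolding comult[OF assms(3,4)] using assms(3,4)
    by (intro clinear_finsum[OF T.cvs_axioms assms(1) TS.clinear_tlift[OF assms(1,2)]]) (auto intro!: u_closed)
  also have "\<dots> = (\<Oplus>\<^bsub>W\<^esub>k\<in>{1..N}. \<beta> (u i k) (u k j))"
    using assms(3,4)
    by (intro W.finsum_cong')
      (auto intro!: cbilinearD(3)[OF assms(2)] simp: u_closed TS.tlift_tens[OF assms(1,2)])
  finally show ?thesis .
qed

lemmas tlift_comult_complex = tlift_comult[OF cvs_complex_alg, simplified finsum_complex_alg]

text \<open>As matrices, \<open>L\<^sup>+(fg) = L\<^sup>+(f) L\<^sup>+(g)\<close>, while the next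
  lemma gives \<open>L\<^sup>-(gh) = L\<^sup>-(h) L\<^sup>-(g)\<close>. This reversal is what makes
  the two-sided multiplication a right action.\<close>

lemma r_mult_left:
  assumes "f \<in> carrier A" "g \<in> carrier A" "k \<in> {1..N}" "l \<in> {1..N}"
  shows "r (f \<otimes> g) (u k l) = (\<Sum>p\<in>{1..N}. r f (u k p) * r g (u p l))"
proof -
  have "r (f \<otimes> g) (u k l) = tlift complex_alg (\<lambda>a b. r f a * r g b) (\<Delta> (u k l))"
    using coquasi assms u_closed[OF assms(3,4)] by (auto simp: coquasitriangular_def)
  then show ?thesis
    using assms by (simp add: tlift_comult_complex cbilinear_prod r_linear)
qed

lemma r_mult_right:
  assumes "g \<in> carrier A" "h \<in> carrier A" "k \<in> {1..N}" "l \<in> {1..N}"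
  shows "r (u k l) (g \<otimes> h) = (\<Sum>p\<in>{1..N}. r (u k p) h * r (u p l) g)"
proof -
  have "r (u k l) (g \<otimes> h) = tlift complex_alg (\<lambda>a b. r a h * r b g) (\<Delta> (u k l))"
    using coquasi assms u_closed[OF assms(3,4)] by (auto simp: coquasitriangular_def)
  then show ?thesis
    using assms by (simp add: tlift_comult_complex cbilinear_prod r_linear)
qed

lemma r_gen_Rc:
  "\<lbrakk>i \<in> {1..N}; j \<in> {1..N}; k \<in> {1..N}; l \<in> {1..N}\<rbrakk> \<Longrightarrow> r (u i j) (u k l) = c * Rc q k i j l"
  by (simp add: r_gen Rc_def)

text \<open>The diagonal generators act by invertible diagonal matrices, so \<open>1\<close> acts by the identity.\<close>

lemma r_one_left:
  assumes "k \<in> {1..N}" "l \<in> {1..N}"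
  shows "r \<one> (u k l) = of_bool (k = l)"
proof -
  have one: "1 \<in> {1..N}" using N by simp
  have gen: "r (u 1 1) (u k l) = c * (if k = l then (if k = 1 then of_real q else 1) else 0)"
    if "k \<in> {1..N}" "l \<in> {1..N}" for k l
    using that one by (auto simp: r_gen_Rc Rc_eq)
  have "r (u 1 1) (u k l) = (\<Sum>p\<in>{1..N}. r \<one> (u k p) * r (u 1 1) (u p l))"
    using r_mult_left[OF one_closed u_closed[OF one one] assms] u_closed[OF one one] by simp
  also have "\<dots> = (\<Sum>p\<in>{1..N}. if p = l then r \<one> (u k l) * (c * (if l = 1 then of_real q else 1)) else 0)"
    using assms by (intro sum.cong) (auto simp: gen)
  also have "\<dots> = r \<one> (u k l) * (c * (if l = 1 then of_real q else 1))" using assms by simp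
  finally show ?thesis using assms c_nonzero q by (auto simp: gen split: if_splits)
qed

lemma r_one_right:
  assumes "k \<in> {1..N}" "l \<in> {1..N}"
  shows "r (u k l) \<one> = of_bool (k = l)"
proof -
  have one: "1 \<in> {1..N}" using N by simp
  have gen: "r (u k l) (u 1 1) = c * (if k = l then (if k = 1 then of_real q else 1) else 0)"
    if "k \<in> {1..N}" "l \<in> {1..N}" for k l
    using that one by (auto simp: r_gen_Rc Rc_eq)
  have "r (u k l) (u 1 1) = (\<Sum>p\<in>{1..N}. r (u k p) (u 1 1) * r (u p l) \<one>)"
    using r_mult_right[OF one_closed u_closed[OF one one] assms] u_closed[OF one one] by simp
  also have "\<dots> = (\<Sum>p\<in>{1..N}. if p = k then c * (if k = 1 then of_real q else 1) * r (u k l) \<one> else 0)"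
    using assms by (intro sum.cong) (auto simp: gen)
  also have "\<dots> = c * (if k = 1 then of_real q else 1) * r (u k l) \<one>" using assms by simp
  finally show ?thesis using assms c_nonzero q by (auto simp: gen split: if_splits)
qed

text \<open>Induction along generators. In the matrix product for \<open>u i j \<otimes> x\<close>,
  the terms with \<open>p \<noteq> 1\<close> vanish by the hypothesis on \<open>x\<close>, and the
  term \<open>p = 1\<close> contains an entry of the R-matrix that is zero by its triangular shape.
  Index 1 alone is followed, since it determines the block.\<close>

lemma r_triangular:
  assumes "h \<in> carrier A" "n \<in> {2..N}"
  shows "r h (u n 1) = 0" "r (u 1 n) h = 0"
proof -
  let ?U = "{h \<in> carrier A. \<forall>n\<in>{2..N}. r h (u n 1) = 0 \<and> r (u 1 n) h = 0}"
  have one: "1 \<in> {1..N}" using N by simp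
  have lin: "clinear A complex_alg (\<lambda>h. r h (u n 1))" "clinear A complex_alg (r (u 1 n))" if "n \<in> {2..N}" for n
    using that one by (auto intro!: r_linear u_closed)
  have zero: "r \<zero> (u n 1) = 0" "r (u 1 n) \<zero> = 0" if "n \<in> {2..N}" for n
    using clinear_zero[OF cvs_axioms cvs_complex_alg lin(1)[OF that]]
      clinear_zero[OF cvs_axioms cvs_complex_alg lin(2)[OF that]] by simp_all
  have "carrier A \<subseteq> ?U"
  proof (rule generated)
    show "submodule ?U complex_alg A"
      unfolding submodule_iff
      by (auto simp: zero clinear_add[OF lin(1)] clinear_add[OF lin(2)] clinear_smult[OF lin(1)] clinear_smult[OF lin(2)])
    show "\<one> \<in> ?U" using one by (auto simp: r_one_left r_one_right)
    fix i j x assume i: "i \<in> {1..N}" and j: "j \<in> {1..N}" and x: "x \<in> ?U"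
    have xA: "x \<in> carrier A" using x by simp
    show "u i j \<otimes> x \<in> ?U"
    proof (intro CollectI conjI ballI)
      show "u i j \<otimes> x \<in> carrier A" using xA i j by (simp add: u_closed)
      fix n assume n: "n \<in> {2..N}"
      then have n1: "n \<in> {1..N}" by simp
      show "r (u i j \<otimes> x) (u n 1) = 0"
        unfolding r_mult_left[OF u_closed[OF i j] xA n1 one]
      proof (intro sum.neutral ballI)
        fix p assume p: "p \<in> {1..N}"
        show "r (u i j) (u n p) * r x (u p 1) = 0"
        proof (cases "p = 1")
          case True
          then show ?thesis using i j n n1 one by (auto simp: r_gen_Rc Rc_eq)
        qed (use p x in auto)
      qed
      show "r (u 1 n) (u i j \<otimes> x) = 0"
        unfolding r_mult_right[OF u_closed[OF i j] xA one n1]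
      proof (intro sum.neutral ballI)
        fix p assume p: "p \<in> {1..N}"
        show "r (u 1 p) x * r (u p n) (u i j) = 0"
        proof (cases "p = 1")
          case True
          then show ?thesis using i j n n1 one by (auto simp: r_gen_Rc Rc_eq)
        qed (use p x in auto)
      qed
    qed
  qed
  then show "r h (u n 1) = 0" "r (u 1 n) h = 0" using assms by blast+
qed

text \<open>The matrix entries of the right action \<open>M \<mapsto> L\<^sup>-(h\<^sub>(\<^sub>1\<^sub>)) M L\<^sup>+(h\<^sub>(\<^sub>2\<^sub>))\<close> of \<open>G\<close> on \<open>N \<times> N\<close> matrices, where
  \<open>L\<^sup>-(h)\<close> and \<open>L\<^sup>+(h)\<close> have the entries \<open>r(u\<^sup>k\<^sub>m \<otimes> h)\<close> and \<open>r(h \<otimes> u\<^sup>n\<^sub>l)\<close>: the matrix unit \<open>E\<^sub>m\<^sub>n\<close>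
  is sent to the matrix with entries \<open>\<rho> k m n l h\<close>.\<close>

definition \<rho>T :: "nat \<Rightarrow> nat \<Rightarrow> nat \<Rightarrow> nat \<Rightarrow> ('a \<times> 'a \<Rightarrow>\<^sub>0 complex) set \<Rightarrow> complex" where
  "\<rho>T k m n l = tlift complex_alg (\<lambda>a b. r (u k m) a * r b (u n l))"

abbreviation "\<rho> k m n l h \<equiv> \<rho>T k m n l (\<Delta> h)"

lemma cbilinear_\<rho>:
  "\<lbrakk>k \<in> {1..N}; m \<in> {1..N}; n \<in> {1..N}; l \<in> {1..N}\<rbrakk>
    \<Longrightarrow> cbilinear A A complex_alg (\<lambda>a b. r (u k m) a * r b (u n l))"
  by (intro cbilinear_prod r_linear u_closed)

lemma clinear_\<rho>T:
  "\<lbrakk>k \<in> {1..N}; m \<in> {1..N}; n \<in> {1..N}; l \<in> {1..N}\<rbrakk> \<Longrightarrow> clinear T complex_alg (\<rho>T k m n l)"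
  unfolding \<rho>T_def by (intro TS.clinear_tlift cvs_complex_alg cbilinear_\<rho>)

lemma \<rho>T_tens:
  "\<lbrakk>k \<in> {1..N}; m \<in> {1..N}; n \<in> {1..N}; l \<in> {1..N}; a \<in> carrier A; b \<in> carrier A\<rbrakk>
    \<Longrightarrow> \<rho>T k m n l (tens A A a b) = r (u k m) a * r b (u n l)"
  unfolding \<rho>T_def by (simp add: TS.tlift_tens[OF cvs_complex_alg] cbilinear_\<rho>)

lemma clinear_\<rho>:
  "\<lbrakk>k \<in> {1..N}; m \<in> {1..N}; n \<in> {1..N}; l \<in> {1..N}\<rbrakk> \<Longrightarrow> clinear A complex_alg (\<lambda>h. \<rho> k m n l h)"
  by (rule clinear_comp[OF clinear_\<Delta> clinear_\<rho>T])

text \<open>Stated on \<open>A \<otimes> A\<close>, so that linearity in each factor reduces it to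
  pure tensors, where it is the product of \<open>r_mult_left\<close> and
  \<open>r_mult_right\<close>. Composed with \<open>\<Delta>\<close> it is the law of a right
  action.\<close>

lemma \<rho>T_mult:
  assumes ix: "k \<in> {1..N}" "m \<in> {1..N}" "n \<in> {1..N}" "l \<in> {1..N}" and X: "X \<in> carrier T" and Y: "Y \<in> carrier T"
  shows "\<rho>T k m n l (X \<otimes>\<^bsub>T\<^esub> Y) = (\<Sum>p\<in>{1..N}. \<Sum>p'\<in>{1..N}. \<rho>T p m n p' X * \<rho>T k p p' l Y)"
proof (rule TS.clinear_eq_tensor[OF cvs_complex_alg _ _ _ Y])
  show "clinear T complex_alg (\<lambda>Y. \<rho>T k m n l (X \<otimes>\<^bsub>T\<^esub> Y))"
    using ix X by (intro clinear_comp[OF T.clinear_mult_right clinear_\<rho>T])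
  show "clinear T complex_alg (\<lambda>Y. \<Sum>p\<in>{1..N}. \<Sum>p'\<in>{1..N}. \<rho>T p m n p' X * \<rho>T k p p' l Y)"
    using ix by (intro clinear_complex_sum clinear_complex_mult clinear_\<rho>T)
  fix a' b' assume ab': "a' \<in> carrier A" "b' \<in> carrier A"
  then have t': "tens A A a' b' \<in> carrier T" by simp
  show "\<rho>T k m n l (X \<otimes>\<^bsub>T\<^esub> tens A A a' b')
      = (\<Sum>p\<in>{1..N}. \<Sum>p'\<in>{1..N}. \<rho>T p m n p' X * \<rho>T k p p' l (tens A A a' b'))"
  proof (rule TS.clinear_eq_tensor[OF cvs_complex_alg _ _ _ X])
    show "clinear T complex_alg (\<lambda>X. \<rho>T k m n l (X \<otimes>\<^bsub>T\<^esub> tens A A a' b'))"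
      using ix t' by (intro clinear_comp[OF T.clinear_mult_left clinear_\<rho>T])
    show "clinear T complex_alg (\<lambda>X. \<Sum>p\<in>{1..N}. \<Sum>p'\<in>{1..N}. \<rho>T p m n p' X * \<rho>T k p p' l (tens A A a' b'))"
      using ix by (intro clinear_complex_sum clinear_complex_mult_right clinear_\<rho>T)
    fix a b assume ab: "a \<in> carrier A" "b \<in> carrier A"
    have "\<rho>T k m n l (tens A A a b \<otimes>\<^bsub>T\<^esub> tens A A a' b')
        = (\<Sum>p\<in>{1..N}. r (u k p) a' * r (u p m) a) * (\<Sum>p'\<in>{1..N}. r b (u n p') * r b' (u p' l))"
      using ix ab ab' by (simp add: mult_tens[OF calg_axioms calg_axioms] \<rho>T_tens r_mult_left r_mult_right)
    also have "\<dots> = (\<Sum>p\<in>{1..N}. \<Sum>p'\<in>{1..N}. \<rho>T p m n p' (tens A A a b) * \<rho>T k p p' l (tens A A a' b'))"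
      unfolding sum_product using ix ab ab'
      by (intro sum.cong refl) (simp add: \<rho>T_tens mult_ac)
    finally show "\<rho>T k m n l (tens A A a b \<otimes>\<^bsub>T\<^esub> tens A A a' b')
        = (\<Sum>p\<in>{1..N}. \<Sum>p'\<in>{1..N}. \<rho>T p m n p' (tens A A a b) * \<rho>T k p p' l (tens A A a' b'))" .
  qed
qed

lemma \<rho>_mult:
  assumes "k \<in> {1..N}" "m \<in> {1..N}" "n \<in> {1..N}" "l \<in> {1..N}" "g \<in> carrier A" "h \<in> carrier A"
  shows "\<rho> k m n l (g \<otimes> h) = (\<Sum>p\<in>{1..N}. \<Sum>p'\<in>{1..N}. \<rho> p m n p' g * \<rho> k p p' l h)"
  using assms by (simp add: \<Delta>_mult \<rho>T_mult)

lemma \<rho>_one: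
  "\<lbrakk>k \<in> {1..N}; m \<in> {1..N}; n \<in> {1..N}; l \<in> {1..N}\<rbrakk> \<Longrightarrow> \<rho> k m n l \<one> = of_bool (k = m \<and> n = l)"
  by (simp add: \<Delta>_one \<rho>T_tens r_one_left r_one_right)

text \<open>Under the last hypothesis one factor of the integrand
  \<open>r(u k m, a) r(b, u n l)\<close> vanishes identically by \<open>r_triangular\<close>. Hence
  a matrix unit inside the block contributes nothing to the first row or column.\<close>

lemma \<rho>_triangular:
  assumes "h \<in> carrier A" "k \<in> {1..N}" "m \<in> {1..N}" "n \<in> {1..N}" "l \<in> {1..N}"
    and "k = 1 \<and> m \<noteq> 1 \<or> l = 1 \<and> n \<noteq> 1"
  shows "\<rho> k m n l h = 0"
proof -
  have z: "cbilinear A A complex_alg (\<lambda>a b. 0)"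
    by (intro cbilinearI clinearI) simp_all
  have "\<rho> k m n l h = tlift complex_alg (\<lambda>a b. 0) (\<Delta> h)"
    unfolding \<rho>T_def using assms r_triangular[of _ m] r_triangular[of _ n]
    by (intro TS.tlift_cong[OF cvs_complex_alg z]) auto
  also have "\<dots> = 0"
    by (rule TS.clinear_eq_tensor[OF cvs_complex_alg TS.clinear_tlift[OF cvs_complex_alg z], of "\<lambda>X. 0"])
      (use assms(1) in \<open>auto simp: TS.tlift_tens[OF cvs_complex_alg z] intro!: clinearI\<close>)
  finally show ?thesis .
qed

lemma \<rho>_gen:
  assumes "k \<in> {1..N}" "m \<in> {1..N}" "n \<in> {1..N}" "l \<in> {1..N}" "i \<in> {1..N}" "j \<in> {1..N}"
  shows "\<rho> k m n l (u i j) = c\<^sup>2 * ((if k = m then (if i = k then of_real q else 1) * Rc q n i j l else 0)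
     + (if i = m \<and> i < k then \<nu> * Rc q n k j l else 0))"
proof -
  have "\<rho> k m n l (u i j) = (\<Sum>p\<in>{1..N}. r (u k m) (u i p) * r (u p j) (u n l))"
    unfolding \<rho>T_def using assms by (simp add: tlift_comult_complex cbilinear_\<rho>)
  \<comment> \<open>The entry \<open>r(u k m, u i p)\<close> is nonzero only for
    \<open>p = i\<close>, with \<open>k = m\<close>, or for \<open>p = k\<close>, with
    \<open>i = m\<close> and \<open>i < k\<close>.\<close>
  also have "\<dots> = (\<Sum>p\<in>{1..N}. (if p = i then c\<^sup>2 * (if k = m then (if i = k then of_real q else 1) * Rc q n i j l else 0) else 0)
      + (if p = k then c\<^sup>2 * (if i = m \<and> i < k then \<nu> * Rc q n k j l else 0) else 0))"
    using assms
    by (intro sum.cong refl) (auto simp: r_gen_Rc Rc_eq[of _ i k m] power2_eq_square algebra_simps)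
  also have "\<dots> = c\<^sup>2 * ((if k = m then (if i = k then of_real q else 1) * Rc q n i j l else 0)
     + (if i = m \<and> i < k then \<nu> * Rc q n k j l else 0))"
    using assms by (simp add: sum.distrib distrib_left)
  finally show ?thesis .
qed

section \<open>The Killing representation on generators\<close>

definition Q :: "'a \<Rightarrow> nat \<Rightarrow> nat \<Rightarrow> complex" where
  "Q h k l = (\<Sum>m\<in>{1..N}. \<rho> k m m l h)"

text \<open>The coproduct of \<open>u k l\<close> is a finite sum over \<open>m\<close>, which is
  moved outside the Sweedler sum of \<open>h\<close>; each term is an entry of the action on
  \<open>E\<^sub>m\<^sub>m\<close>.\<close>

lemma killing_form_eq_Q:
  assumes "h \<in> carrier A" "k \<in> {1..N}" "l \<in> {1..N}"
  shows "killing_form \<Delta> r h (u k l) = Q h k l"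
proof -
  let ?\<beta> = "\<lambda>a b. \<Sum>m\<in>{1..N}. r (u k m) a * r b (u m l)"
  have \<beta>: "cbilinear A A complex_alg ?\<beta>"
    using assms by (intro cbilinearI clinear_complex_sum clinear_complex_mult clinear_complex_mult_right r_linear u_closed)
  have "killing_form \<Delta> r h (u k l) = tlift complex_alg ?\<beta> (\<Delta> h)"
    unfolding killing_form_def using assms
    by (intro TS.tlift_cong[OF cvs_complex_alg \<beta>]) (simp_all add: tlift_comult_complex cbilinear_prod r_linear)
  also have "\<dots> = (\<Sum>m\<in>{1..N}. \<rho>T k m m l (\<Delta> h))"
  proof (rule TS.clinear_eq_tensor[OF cvs_complex_alg TS.clinear_tlift[OF cvs_complex_alg \<beta>] _ _ \<Delta>_closed[OF assms(1)]])
    show "clinear T complex_alg (\<lambda>X. \<Sum>m\<in>{1..N}. \<rho>T k m m l X)"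
      using assms by (intro clinear_complex_sum clinear_\<rho>T)
    show "tlift complex_alg ?\<beta> (tens A A a b) = (\<Sum>m\<in>{1..N}. \<rho>T k m m l (tens A A a b))"
      if "a \<in> carrier A" "b \<in> carrier A" for a b
      using that assms by (simp add: TS.tlift_tens[OF cvs_complex_alg \<beta>] \<rho>T_tens)
  qed
  finally show ?thesis by (simp add: Q_def)
qed

lemma clinear_Q: "\<lbrakk>k \<in> {1..N}; l \<in> {1..N}\<rbrakk> \<Longrightarrow> clinear A complex_alg (\<lambda>h. Q h k l)"
  unfolding Q_def by (intro clinear_complex_sum clinear_\<rho>)

lemma Q_mult:
  assumes "k \<in> {1..N}" "l \<in> {1..N}" "g \<in> carrier A" "h \<in> carrier A"
  shows "Q (g \<otimes> h) k l = (\<Sum>p\<in>{1..N}. \<Sum>p'\<in>{1..N}. Q g p p' * \<rho> k p p' l h)"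
proof -
  have "Q (g \<otimes> h) k l = (\<Sum>m\<in>{1..N}. \<Sum>p\<in>{1..N}. \<Sum>p'\<in>{1..N}. \<rho> p m m p' g * \<rho> k p p' l h)"
    unfolding Q_def using assms by (intro sum.cong refl) (simp add: \<rho>_mult)
  also have "\<dots> = (\<Sum>p\<in>{1..N}. \<Sum>m\<in>{1..N}. \<Sum>p'\<in>{1..N}. \<rho> p m m p' g * \<rho> k p p' l h)"
    by (rule sum.swap)
  also have "\<dots> = (\<Sum>p\<in>{1..N}. \<Sum>p'\<in>{1..N}. \<Sum>m\<in>{1..N}. \<rho> p m m p' g * \<rho> k p p' l h)"
    by (intro sum.cong refl sum.swap)
  finally show ?thesis by (simp add: Q_def sum_distrib_right)
qed

lemma Q_one: "\<lbrakk>k \<in> {1..N}; l \<in> {1..N}\<rbrakk> \<Longrightarrow> Q \<one> k l = of_bool (k = l)"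
proof -
  assume kl: "k \<in> {1..N}" "l \<in> {1..N}"
  have "Q \<one> k l = (\<Sum>m\<in>{1..N}. if m = k then of_bool (k = l) else 0)"
    unfolding Q_def using kl by (intro sum.cong) (auto simp: \<rho>_one)
  then show ?thesis using kl by simp
qed

text \<open>In the sum over \<open>m\<close> only \<open>m = k\<close> and \<open>m = i\<close>
  survive. The square of \<open>\<nu>\<close> arises below position \<open>i\<close> on the
  diagonal, where both R-entries contribute their \<open>\<nu>\<close> part.\<close>

lemma Q_gen:
  assumes "k \<in> {1..N}" "l \<in> {1..N}" "i \<in> {1..N}" "j \<in> {1..N}"
  shows "Q (u i j) k l = c\<^sup>2 * ((if k = l \<and> i = j then (if i = k then (of_real q)\<^sup>2 else 1) + (if i < k then \<nu>\<^sup>2 else 0) else 0)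
    + (if i \<noteq> k \<and> k = j \<and> i = l then \<nu> else 0))"
proof -
  have "Q (u i j) k l = (\<Sum>m\<in>{1..N}. (if m = k then c\<^sup>2 * ((if i = k then of_real q else 1) * Rc q k i j l) else 0)
     + (if m = i then c\<^sup>2 * (if i < k then \<nu> * Rc q i k j l else 0) else 0))"
    unfolding Q_def using assms by (intro sum.cong) (auto simp: \<rho>_gen distrib_left)
  also have "\<dots> = c\<^sup>2 * ((if i = k then of_real q else 1) * Rc q k i j l + (if i < k then \<nu> * Rc q i k j l else 0))"
    using assms by (simp add: sum.distrib distrib_left)
  also have "\<dots> = c\<^sup>2 * ((if k = l \<and> i = j then (if i = k then (of_real q)\<^sup>2 else 1) + (if i < k then \<nu>\<^sup>2 else 0) else 0)
    + (if i \<noteq> k \<and> k = j \<and> i = l then \<nu> else 0))"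
  proof -
    consider "i < k" | "i = k" | "k < i" by linarith
    then show ?thesis
      by cases (auto simp: Rc_eq power2_eq_square simp del: of_real_diff)
  qed
  finally show ?thesis .
qed

lemma Q_gen_offdiag:
  "\<lbrakk>k \<in> {1..N}; l \<in> {1..N}; i \<in> {1..N}; j \<in> {1..N}; i \<noteq> j\<rbrakk> \<Longrightarrow> Q (u i j) k l = (if k = j \<and> l = i then c\<^sup>2 * \<nu> else 0)"
  by (auto simp: Q_gen)

definition xs :: "nat \<Rightarrow> complex" where
  "xs a = (if a = 1 then 1 else (1 / (of_real q)\<^sup>2) ^ (a - 1) - (1 / (of_real q)\<^sup>2) ^ (a - 2))"

lemma sum_xs: "n \<ge> 1 \<Longrightarrow> (\<Sum>a\<in>{1..n}. xs a) = (1 / (of_real q)\<^sup>2) ^ (n - 1)"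
proof (induction n rule: dec_induct)
  case (step n)
  have "Suc n - 2 = n - 1" by simp
  with step show ?case by (simp add: xs_def)
qed (simp add: xs_def)

lemma xs_Suc: "a \<ge> 1 \<Longrightarrow> of_real q * xs (Suc a) = - \<nu> * (1 / (of_real q)\<^sup>2) ^ (a - 1)"
proof -
  assume "a \<ge> 1"
  then obtain b where b: "a = Suc b" by (cases a) auto
  have "complex_of_real q \<noteq> 0" using q by simp
  then show ?thesis
    unfolding b xs_def by (simp add: field_simps power2_eq_square)
qed

lemma xs_nonzero: "q \<noteq> 1 \<Longrightarrow> a \<ge> 2 \<Longrightarrow> xs a \<noteq> 0"
  using xs_Suc[of "a - 1"] \<nu>_nonzero q by (cases a) (auto simp: One_nat_def simp del: of_real_diff)

text \<open>The weights \<open>xs a\<close> solve \<open>(\<Sum>a. xs a E\<^sub>a\<^sub>i \<cdot> u\<^sup>a\<^sub>j) = c\<^sup>2 q \<delta>\<^sub>j\<^sub>1 E\<^sub>1\<^sub>i\<close>; acting with \<open>S(u\<^sup>j\<^sub>b)\<close> inverts this.\<close>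

lemma \<rho>_antipode:
  assumes i: "i \<in> {2..N}" and b: "b \<in> {1..N}" and kl: "k \<in> {1..N}" "l \<in> {1..N}"
  shows "c\<^sup>2 * of_real q * \<rho> k 1 i l (S (u 1 b)) = (if k = b \<and> l = i then xs b else 0)"
proof -
  have i1: "i \<in> {1..N}" and one: "1 \<in> {1..N}" using i N by auto
  have f: "cbilinear A A A (\<lambda>x y. x \<otimes> S y)"
    by (intro cbilinearI clinear_mult_left clinear_comp[OF clinear_S clinear_mult_right]) auto
  \<comment> \<open>The antipode axiom at a generator; the entries of the action are then evaluated
    on both sides of it.\<close>
  have inv: "(\<Oplus>j\<in>{1..N}. u a j \<otimes> S (u j b)) = of_bool (a = b) \<odot> \<one>" if a: "a \<in> {1..N}" for a
    using antipode_right[OF u_closed[OF a b]] a b by (simp add: tlift_comult[OF cvs_axioms f] counit)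
  have lhs: "(\<Sum>j\<in>{1..N}. \<Sum>p\<in>{1..N}. \<Sum>p'\<in>{1..N}. \<rho> p a i p' (u a j) * \<rho> k p p' l (S (u j b)))
      = of_bool (a = b \<and> k = a \<and> i = l)" if a: "a \<in> {1..N}" for a
  proof -
    have "of_bool (a = b \<and> k = a \<and> i = l) = \<rho> k a i l (of_bool (a = b) \<odot> \<one>)"
      using a i1 kl by (subst clinear_smult[OF clinear_\<rho>]) (auto simp: \<rho>_one)
    also have "\<dots> = (\<Sum>j\<in>{1..N}. \<rho> k a i l (u a j \<otimes> S (u j b)))"
      unfolding inv[OF a, symmetric] using a b i1 kl
      by (subst clinear_finsum[OF cvs_axioms cvs_complex_alg clinear_\<rho>]) (auto simp: u_closed)
    also have "\<dots> = (\<Sum>j\<in>{1..N}. \<Sum>p\<in>{1..N}. \<Sum>p'\<in>{1..N}. \<rho> p a i p' (u a j) * \<rho> k p p' l (S (u j b)))"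
      using a b i1 kl by (intro sum.cong refl) (simp add: \<rho>_mult u_closed)
    finally show ?thesis by simp
  qed
  \<comment> \<open>For fixed \<open>p\<close> all these entries are multiples of one R-entry, with
    factor \<open>q\<close> for \<open>a = p\<close>, factor \<open>\<nu>\<close> for
    \<open>a < p\<close>, and zero otherwise. The weights are made to cancel this combination for
    every \<open>p \<noteq> 1\<close>.\<close>
  have weights: "(\<Sum>a\<in>{1..N}. xs a * \<rho> p a i p' (u a j)) = (if p = 1 \<and> p' = i \<and> j = 1 then c\<^sup>2 * of_real q else 0)"
    if p: "p \<in> {1..N}" and p': "p' \<in> {1..N}" and j: "j \<in> {1..N}" for p p' j
  proof -
    have "(\<Sum>a\<in>{1..N}. xs a * \<rho> p a i p' (u a j))
        = (\<Sum>a\<in>{1..N}. c\<^sup>2 * Rc q i p j p' * ((if a = p then xs p * of_real q else 0) + \<nu> * (if a < p then xs a else 0)))"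
      using p p' j i1 by (intro sum.cong refl) (auto simp: \<rho>_gen)
    also have "\<dots> = c\<^sup>2 * Rc q i p j p' * (xs p * of_real q + \<nu> * (\<Sum>a\<in>{1..N}. if a < p then xs a else 0))"
      using p by (simp add: sum.distrib flip: sum_distrib_left)
    also have "(\<Sum>a\<in>{1..N}. if a < p then xs a else 0) = (\<Sum>a\<in>{1..p-1}. xs a)"
      using p by (intro sum.mono_neutral_cong_right) auto
    \<comment> \<open>For \<open>p \<ge> 2\<close> this is the recursion defining the weights; at
      \<open>p = 1\<close> the inner sum is empty.\<close>
    also have "xs p * of_real q + \<nu> * (\<Sum>a\<in>{1..p-1}. xs a) = (if p = 1 then of_real q else 0)"
    proof (cases "p = 1")
      case False
      then have "1 \<le> p - 1" "Suc (p - 1) = p" using p by auto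
      then show ?thesis using False sum_xs[of "p - 1"] xs_Suc[of "p - 1"] by (simp add: algebra_simps)
    qed (simp add: xs_def)
    \<comment> \<open>At \<open>p = 1\<close> the bound \<open>i \<ge> 2\<close> makes the R-entry
      equal to 1 for \<open>j = 1\<close> and \<open>p' = i\<close>, and to 0 otherwise.\<close>
    finally show ?thesis using i by (auto simp: Rc_eq)
  qed
  \<comment> \<open>The identities are summed over \<open>a\<close> with weights
    \<open>xs a\<close>. On the unit side only \<open>a = b\<close> remains, on the other side only
    \<open>j = p = 1\<close> and \<open>p' = i\<close>.\<close>
  have "(if k = b \<and> l = i then xs b else 0) = (\<Sum>a\<in>{1..N}. if a = b then if k = b \<and> l = i then xs b else 0 else 0)"
    using b by simp
  also have "\<dots> = (\<Sum>a\<in>{1..N}. xs a * of_bool (a = b \<and> k = a \<and> i = l))"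
    by (intro sum.cong refl) auto
  also have "\<dots> = (\<Sum>a\<in>{1..N}. \<Sum>j\<in>{1..N}. \<Sum>p\<in>{1..N}. \<Sum>p'\<in>{1..N}.
      xs a * \<rho> p a i p' (u a j) * \<rho> k p p' l (S (u j b)))"
    by (intro sum.cong refl) (simp add: lhs[symmetric] sum_distrib_left mult.assoc)
  also have "\<dots> = (\<Sum>j\<in>{1..N}. \<Sum>p\<in>{1..N}. \<Sum>p'\<in>{1..N}. \<Sum>a\<in>{1..N}.
      xs a * \<rho> p a i p' (u a j) * \<rho> k p p' l (S (u j b)))"
    by (rule trans[OF sum.swap], rule sum.cong[OF refl], rule trans[OF sum.swap], rule sum.cong[OF refl],
        rule sum.swap)
  also have "\<dots> = (\<Sum>j\<in>{1..N}. \<Sum>p\<in>{1..N}. \<Sum>p'\<in>{1..N}.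
      (if p' = i then if p = 1 then if j = 1 then c\<^sup>2 * of_real q * \<rho> k 1 i l (S (u 1 b)) else 0 else 0 else 0))"
    by (intro sum.cong refl) (simp add: sum_distrib_right[symmetric] weights)
  also have "\<dots> = c\<^sup>2 * of_real q * \<rho> k 1 i l (S (u 1 b))"
    using one i1 by simp
  finally show ?thesis by simp
qed

text \<open>\<open>Q(u\<^sup>i\<^sub>1)\<close> is \<open>c\<^sup>2 \<nu>\<close> times
  \<open>E\<^sub>1\<^sub>i\<close>, and by \<open>\<rho>_antipode\<close> acting with
  \<open>S(u\<^sup>1\<^sub>i)\<close> turns \<open>E\<^sub>1\<^sub>i\<close> into
  \<open>xs i / (c\<^sup>2 q)\<close> times \<open>E\<^sub>i\<^sub>i\<close>.\<close>

lemma Q_antipode: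
  assumes i: "i \<in> {2..N}" and kl: "k \<in> {1..N}" "l \<in> {1..N}"
  shows "Q (u i 1 \<otimes> S (u 1 i)) k l = (if k = i \<and> l = i then \<nu> * xs i / of_real q else 0)"
proof -
  have i1: "i \<in> {1..N}" and one: "1 \<in> {1..N}" and "i \<noteq> 1" using i N by auto
  have "Q (u i 1 \<otimes> S (u 1 i)) k l = (\<Sum>p\<in>{1..N}. \<Sum>p'\<in>{1..N}. Q (u i 1) p p' * \<rho> k p p' l (S (u 1 i)))"
    using i1 one by (intro Q_mult[OF kl]) (simp_all add: u_closed)
  also have "\<dots> = (\<Sum>p\<in>{1..N}. \<Sum>p'\<in>{1..N}. if p' = i then if p = 1 then c\<^sup>2 * \<nu> * \<rho> k 1 i l (S (u 1 i)) else 0 else 0)"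
    using i1 one \<open>i \<noteq> 1\<close> by (intro sum.cong refl) (simp add: Q_gen_offdiag)
  also have "\<dots> = c\<^sup>2 * \<nu> * \<rho> k 1 i l (S (u 1 i))" using one i1 by simp
  also have "\<dots> = \<nu> / of_real q * (c\<^sup>2 * of_real q * \<rho> k 1 i l (S (u 1 i)))" using q by simp
  also have "\<dots> = (if k = i \<and> l = i then \<nu> * xs i / of_real q else 0)"
    unfolding \<rho>_antipode[OF i i1 kl] by simp
  finally show ?thesis .
qed

section \<open>The ideals of the two calculi\<close>

definition K :: "'a set" where
  "K = {h \<in> G_plus. \<forall>k\<in>{1..N}. \<forall>l\<in>{1..N}. Q h k l = 0}"

definition I_set :: "'a set" where
  "I_set = {h \<in> G_plus. \<forall>k\<in>{1..N}. \<forall>l\<in>{1..N}. k = 1 \<or> l = 1 \<longrightarrow> Q h k l = 0}"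

lemma I_setD: "\<lbrakk>h \<in> I_set; k \<in> {1..N}; l \<in> {1..N}; k = 1 \<or> l = 1\<rbrakk> \<Longrightarrow> Q h k l = 0"
  unfolding I_set_def by blast

lemma Q_zero: "\<lbrakk>k \<in> {1..N}; l \<in> {1..N}\<rbrakk> \<Longrightarrow> Q \<zero> k l = 0"
  using clinear_zero[OF cvs_axioms cvs_complex_alg clinear_Q] by simp

lemma G_plus_mult: "\<lbrakk>g \<in> G_plus; h \<in> carrier A\<rbrakk> \<Longrightarrow> g \<otimes> h \<in> G_plus"
  by (simp add: aug_ideal_def \<epsilon>_mult)

text \<open>The predicate \<open>R\<close> selects which entries must vanish, which treats
  \<open>K\<close> and \<open>I_set\<close> together.\<close>

lemma submodule_Q_zero:
  "submodule {h \<in> G_plus. \<forall>k\<in>{1..N}. \<forall>l\<in>{1..N}. R k l \<longrightarrow> Q h k l = 0} complex_alg A" (is "submodule ?U _ _")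
  unfolding submodule_iff
proof (intro conjI allI ballI)
  note G = submodule_aug_ideal[unfolded submodule_iff]
  show "?U \<subseteq> carrier A" using aug_ideal_closed by blast
  show "\<zero> \<in> ?U" using G by (simp add: Q_zero)
  show "x \<oplus> y \<in> ?U" if x: "x \<in> ?U" and y: "y \<in> ?U" for x y
  proof -
    have "Q (x \<oplus> y) k l = Q x k l + Q y k l" if "k \<in> {1..N}" "l \<in> {1..N}" for k l
      using clinear_add[OF clinear_Q[OF that], of x y] x y aug_ideal_closed by simp
    then show ?thesis using x y G by simp
  qed
  show "a \<odot> x \<in> ?U" if x: "x \<in> ?U" for a x
  proof -
    have "Q (a \<odot> x) k l = a * Q x k l" if "k \<in> {1..N}" "l \<in> {1..N}" for k l
      using clinear_smult[OF clinear_Q[OF that], of x a] x aug_ideal_closed by simp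
    then show ?thesis using x G by simp
  qed
qed

lemma right_ideal_K: "right_ideal_in A G_plus K"
  unfolding right_ideal_in_def
proof (intro conjI ballI)
  show "submodule K complex_alg A"
    using submodule_Q_zero[of "\<lambda>k l. True"] by (simp only: K_def simp_thms)
  show "K \<subseteq> G_plus" by (auto simp: K_def)
  show "v \<otimes> h \<in> K" if v: "v \<in> K" and h: "h \<in> carrier A" for v h
  proof -
    have "v \<in> G_plus" "\<And>k l. k \<in> {1..N} \<Longrightarrow> l \<in> {1..N} \<Longrightarrow> Q v k l = 0" using v by (auto simp: K_def)
    then show ?thesis using h aug_ideal_closed[of v] by (simp add: K_def G_plus_mult Q_mult)
  qed
qed

lemma right_ideal_I_set: "right_ideal_in A G_plus I_set"
  unfolding right_ideal_in_def
proof (intro conjI ballI)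
  show "submodule I_set complex_alg A" unfolding I_set_def by (rule submodule_Q_zero)
  show "I_set \<subseteq> G_plus" by (auto simp: I_set_def)
  show "v \<otimes> h \<in> I_set" if v: "v \<in> I_set" and h: "h \<in> carrier A" for v h
  proof -
    have vG: "v \<in> G_plus" using v by (simp add: I_set_def)
    note v0 = I_setD[OF v]
    have "Q (v \<otimes> h) k l = 0" if kl: "k \<in> {1..N}" "l \<in> {1..N}" "k = 1 \<or> l = 1" for k l
      unfolding Q_mult[OF kl(1,2) aug_ideal_closed[OF vG] h]
    proof (intro sum.neutral ballI)
      fix p p' assume p: "p \<in> {1..N}" "p' \<in> {1..N}"
      \<comment> \<open>Terms with \<open>p = 1\<close> or \<open>p' = 1\<close> vanish because
        \<open>v\<close> lies in \<open>I_set\<close>; the remaining ones vanish because the action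
        preserves the block.\<close>
      show "Q v p p' * \<rho> k p p' l h = 0"
      proof (cases "p = 1 \<or> p' = 1")
        case False
        then show ?thesis using \<rho>_triangular[OF h kl(1) p kl(2)] kl(3) by auto
      qed (use v0 p in auto)
    qed
    then show ?thesis using vG h by (simp add: I_set_def G_plus_mult)
  qed
qed

definition "D1_gens = {u i 1 \<otimes> S (u 1 i) | i. i \<in> {2..N}}"
definition "D2_gens = {u i j | i j. i \<in> {2..N} \<and> j \<in> {2..N} \<and> i \<noteq> j}"
definition "I_SU = K <+>\<^bsub>A\<^esub> cspan A D1_gens <+>\<^bsub>A\<^esub> cspan A D2_gens"

lemma D1_gens_G_plus: "D1_gens \<subseteq> G_plus" and D2_gens_G_plus: "D2_gens \<subseteq> G_plus"
  using N by (auto simp: D1_gens_def D2_gens_def aug_ideal_def \<epsilon>_mult counit u_closed)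

lemma in_I_SU_iff: "x \<in> I_SU \<longleftrightarrow> (\<exists>k\<in>K. \<exists>d\<^sub>1\<in>cspan A D1_gens. \<exists>d\<^sub>2\<in>cspan A D2_gens. x = k \<oplus> d\<^sub>1 \<oplus> d\<^sub>2)"
proof
  assume "\<exists>k\<in>K. \<exists>d\<^sub>1\<in>cspan A D1_gens. \<exists>d\<^sub>2\<in>cspan A D2_gens. x = k \<oplus> d\<^sub>1 \<oplus> d\<^sub>2"
  then obtain k d\<^sub>1 d\<^sub>2 where d: "k \<in> K" "d\<^sub>1 \<in> cspan A D1_gens" "d\<^sub>2 \<in> cspan A D2_gens" "x = k \<oplus> d\<^sub>1 \<oplus> d\<^sub>2"
    by blast
  then have "k \<oplus> d\<^sub>1 \<in> K <+>\<^bsub>A\<^esub> cspan A D1_gens" unfolding mem_set_add by blast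
  then show "x \<in> I_SU" unfolding I_SU_def mem_set_add[of _ _ _ "cspan A D2_gens"] using d by blast
next
  assume "x \<in> I_SU"
  then obtain k d\<^sub>1 d\<^sub>2 where "k \<in> K" "d\<^sub>1 \<in> cspan A D1_gens" "d\<^sub>2 \<in> cspan A D2_gens" "x = k \<oplus> d\<^sub>1 \<oplus> d\<^sub>2"
    by (auto simp: I_SU_def mem_set_add)
  then show "\<exists>k\<in>K. \<exists>d\<^sub>1\<in>cspan A D1_gens. \<exists>d\<^sub>2\<in>cspan A D2_gens. x = k \<oplus> d\<^sub>1 \<oplus> d\<^sub>2" by blast
qed

lemma I_SU_subset:
  assumes "submodule U complex_alg A" "K \<subseteq> U" "D1_gens \<subseteq> U" "D2_gens \<subseteq> U"
  shows "I_SU \<subseteq> U"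
proof
  fix x assume "x \<in> I_SU"
  then obtain k d\<^sub>1 d\<^sub>2 where "k \<in> K" "d\<^sub>1 \<in> cspan A D1_gens" "d\<^sub>2 \<in> cspan A D2_gens" "x = k \<oplus> d\<^sub>1 \<oplus> d\<^sub>2"
    unfolding in_I_SU_iff by blast
  moreover from this have "k \<in> U" "d\<^sub>1 \<in> U" "d\<^sub>2 \<in> U"
    using cspan_least[OF assms(1,3)] cspan_least[OF assms(1,4)] assms(2) by auto
  ultimately show "x \<in> U" using assms(1) by (simp add: submodule_iff)
qed

lemma submodule_D: "submodule (cspan A D1_gens) complex_alg A" "submodule (cspan A D2_gens) complex_alg A"
  using D1_gens_G_plus D2_gens_G_plus aug_ideal_closed by (intro submodule_cspan; blast)+

lemma K_subset_I_SU: "K \<subseteq> I_SU"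
proof
  fix k assume k: "k \<in> K"
  have "\<zero> \<in> cspan A D1_gens" "\<zero> \<in> cspan A D2_gens" using submodule_D by (auto simp: submodule_iff)
  moreover have "k = k \<oplus> \<zero> \<oplus> \<zero>" using k aug_ideal_closed[of k] by (simp add: K_def)
  ultimately show "k \<in> I_SU" unfolding in_I_SU_iff using k by blast
qed

text \<open>For the harder inclusion, \<open>h\<close> is compared with a combination of the
  generators of \<open>D\<^sub>1\<close> and \<open>D\<^sub>2\<close> having the same matrix under
  \<open>Q\<close>; the difference then lies in \<open>K\<close>.\<close>

lemma I_SU_eq_I_set:
  assumes "q \<noteq> 1"
  shows "I_SU = I_set"
proof
  have sub: "submodule I_set complex_alg A" using right_ideal_I_set by (simp add: right_ideal_in_def)
  have "D1_gens \<subseteq> I_set"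
    using D1_gens_G_plus by (auto simp: I_set_def D1_gens_def Q_antipode)
  moreover have "D2_gens \<subseteq> I_set"
    using D2_gens_G_plus by (auto simp: I_set_def D2_gens_def Q_gen_offdiag)
  ultimately show "I_SU \<subseteq> I_set" by (intro I_SU_subset sub) (auto simp: K_def I_set_def)
  show "I_set \<subseteq> I_SU"
  proof
    fix h assume h: "h \<in> I_set"
    then have hG: "h \<in> G_plus" by (simp add: I_set_def)
    note h0 = I_setD[OF h]
    have hA: "h \<in> carrier A" using hG by (rule aug_ideal_closed)
    let ?D = "cspan A D1_gens <+>\<^bsub>A\<^esub> cspan A D2_gens"
    have D: "submodule ?D complex_alg A" by (intro submodule_set_add submodule_D)
    \<comment> \<open>Chosen so that \<open>Q (w (k, l))\<close> is \<open>\<kappa> (k, l)\<close>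
      times \<open>E\<^sub>k\<^sub>l\<close>. The indices of the generator are swapped because
      \<open>Q(u\<^sup>i\<^sub>j)\<close> is a multiple of \<open>E\<^sub>j\<^sub>i\<close>.\<close>
    define w where "w = (\<lambda>(k, l). if k = l then u k 1 \<otimes> S (u 1 k) else u l k)"
    define \<kappa> where "\<kappa> = (\<lambda>(k :: nat, l). if k = l then \<nu> * xs k / of_real q else c\<^sup>2 * \<nu>)"
    let ?P = "{2..N} \<times> {2..N}"
    have \<kappa>: "\<kappa> p \<noteq> 0" if "p \<in> ?P" for p
    proof -
      have "\<nu> * xs (fst p) / of_real q \<noteq> 0" "c\<^sup>2 * \<nu> \<noteq> 0"
        using that c_nonzero \<nu>_nonzero[OF assms] xs_nonzero[OF assms, of "fst p"] q by auto
      then show ?thesis unfolding \<kappa>_def case_prod_unfold by presburger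
    qed
    have Qw: "Q (w p) k l = (if p = (k, l) then \<kappa> p else 0)" if "p \<in> ?P" "k \<in> {1..N}" "l \<in> {1..N}" for p k l
      using that by (cases p) (auto simp: w_def \<kappa>_def Q_antipode Q_gen_offdiag)
    have wD: "w p \<in> ?D" if p: "p \<in> ?P" for p
    proof (cases "fst p = snd p")
      case True
      then have "w p \<in> D1_gens" using p by (auto simp: w_def D1_gens_def)
      then have "w p \<in> cspan A D1_gens" by (rule subsetD[OF cspan_superset])
      moreover have "\<zero> \<in> cspan A D2_gens" using submodule_D(2) by (simp add: submodule_iff)
      moreover have "w p = w p \<oplus> \<zero>" using calculation(1) submodule_D(1) by (auto simp: submodule_iff)
      ultimately show ?thesis unfolding mem_set_add by blast
    next
      case False
      then have "w p = u (snd p) (fst p)" by (simp add: w_def case_prod_unfold)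
      then have "w p \<in> D2_gens" using p False unfolding D2_gens_def by force
      then have "w p \<in> cspan A D2_gens" by (rule subsetD[OF cspan_superset])
      moreover have "\<zero> \<in> cspan A D1_gens" using submodule_D(1) by (simp add: submodule_iff)
      moreover have "w p = \<zero> \<oplus> w p" using calculation(1) submodule_D(2) by (auto simp: submodule_iff)
      ultimately show ?thesis unfolding mem_set_add by blast
    qed
    have DG: "?D \<subseteq> G_plus"
    proof -
      have "cspan A D1_gens \<subseteq> G_plus" "cspan A D2_gens \<subseteq> G_plus"
        by (intro cspan_least submodule_aug_ideal D1_gens_G_plus D2_gens_G_plus)+
      moreover have "x \<oplus> y \<in> G_plus" if "x \<in> G_plus" "y \<in> G_plus" for x y
        using that submodule_aug_ideal by (simp add: submodule_iff)
      ultimately show ?thesis unfolding subset_iff mem_set_add by blast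
    qed
    \<comment> \<open>The expansion of \<open>Q h\<close> in the matrix units of the block, lifted
      to the elements \<open>w p\<close>.\<close>
    define d where "d = (\<Oplus>p\<in>?P. (Q h (fst p) (snd p) / \<kappa> p) \<odot> w p)"
    have summand: "(Q h (fst p) (snd p) / \<kappa> p) \<odot> w p \<in> ?D" if "p \<in> ?P" for p
      using D wD[OF that] unfolding submodule_iff by blast
    have dD: "d \<in> ?D" unfolding d_def using summand by (intro submodule_finsum D) auto
    then have dG: "d \<in> G_plus" using DG by blast
    then have dA: "d \<in> carrier A" by (rule aug_ideal_closed)
    have wA: "w p \<in> carrier A" if "p \<in> ?P" for p using wD[OF that] DG aug_ideal_closed by blast
    have Qd: "Q d k l = Q h k l" if kl: "k \<in> {1..N}" "l \<in> {1..N}" for k l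
    proof -
      have "Q d k l = (\<Sum>p\<in>?P. Q ((Q h (fst p) (snd p) / \<kappa> p) \<odot> w p) k l)"
        unfolding d_def using wA by (subst clinear_finsum[OF cvs_axioms cvs_complex_alg clinear_Q[OF kl]]) auto
      also have "\<dots> = (\<Sum>p\<in>?P. if p = (k, l) then Q h k l else 0)"
        using wA \<kappa> by (intro sum.cong refl) (auto simp: clinear_smult[OF clinear_Q[OF kl]] Qw[OF _ kl])
      \<comment> \<open>Outside the block no summand contributes, and there the entry of
        \<open>Q h\<close> is zero because \<open>h\<close> lies in \<open>I_set\<close>.\<close>
      also have "\<dots> = Q h k l"
        using kl h0[OF kl] by (auto simp: sum.delta)
      finally show ?thesis .
    qed
    have "h \<ominus> d \<in> K"
      using hG dG hA dA
      by (simp add: K_def aug_ideal_def clinear_minus[OF cvs_axioms cvs_complex_alg clinear_\<epsilon>]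
          clinear_minus[OF cvs_axioms cvs_complex_alg clinear_Q] complex_alg_minus Qd)
    moreover obtain d\<^sub>1 d\<^sub>2 where d: "d\<^sub>1 \<in> cspan A D1_gens" "d\<^sub>2 \<in> cspan A D2_gens" "d = d\<^sub>1 \<oplus> d\<^sub>2"
      using dD unfolding mem_set_add by blast
    moreover have "h = (h \<ominus> d) \<oplus> d\<^sub>1 \<oplus> d\<^sub>2"
    proof -
      have "d\<^sub>1 \<in> carrier A" "d\<^sub>2 \<in> carrier A" using d submodule_D by (auto simp: submodule_iff)
      then show ?thesis using hA dA minus_add_cancel[OF hA dA] d(3) by (simp add: a_assoc)
    qed
    ultimately show "h \<in> I_SU" unfolding in_I_SU_iff by blast
  qed
qed

text \<open>At \<open>q = 1\<close> the factor \<open>\<nu>\<close> in \<open>Q_antipode\<close> and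
  \<open>Q_gen_offdiag\<close> vanishes, so all generators of \<open>D\<^sub>1\<close> and
  \<open>D\<^sub>2\<close> are in the kernel.\<close>

lemma I_SU_eq_K:
  assumes "q = 1"
  shows "I_SU = K"
proof
  have sub: "submodule K complex_alg A" using right_ideal_K by (simp add: right_ideal_in_def)
  have "D1_gens \<subseteq> K"
    using D1_gens_G_plus assms by (auto simp: K_def D1_gens_def Q_antipode)
  moreover have "D2_gens \<subseteq> K"
    using D2_gens_G_plus assms by (auto simp: K_def D2_gens_def Q_gen_offdiag)
  ultimately show "I_SU \<subseteq> K" by (intro I_SU_subset sub) auto
qed (rule K_subset_I_SU)

lemma right_ideal_I_SU: "right_ideal_in A G_plus I_SU"
  using I_SU_eq_K I_SU_eq_I_set right_ideal_K right_ideal_I_set by (cases "q = 1") auto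

lemma kerQ: "{h \<in> carrier A. \<forall>k\<in>{1..N}. \<forall>l\<in>{1..N}. killing_form \<Delta> r h (u k l) = 0} \<inter> G_plus = K"
  using aug_ideal_closed by (auto simp: K_def killing_form_eq_Q)

section \<open>The basis of the quotient calculus\<close>

definition J :: "(nat \<times> nat) set" where
  "J = (\<lambda>i. (i + 1, 1)) ` {1..N-1} \<union> {(1, 1)} \<union> (\<lambda>i. (1, i + 1)) ` {1..N-1}"

text \<open>The only diagonal pair in \<open>J\<close> is (1,1), so the first branch concerns
  \<open>u\<^sup>1\<^sub>1 - 1\<close> alone.\<close>

definition v :: "nat \<times> nat \<Rightarrow> 'a" where
  "v = (\<lambda>(i, j). if i = j then u 1 1 \<ominus> \<one> else u i j)"

lemma card_J: "card J = 2 * N - 1"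
proof -
  have "card J = card ((\<lambda>i::nat. (i + 1, 1::nat)) ` {1..N-1} \<union> {(1, 1)}) + card ((\<lambda>i::nat. (1::nat, i + 1)) ` {1..N-1})"
    unfolding J_def by (intro card_Un_disjoint) auto
  also have "card ((\<lambda>i::nat. (i + 1, 1::nat)) ` {1..N-1} \<union> {(1, 1)}) = card ((\<lambda>i::nat. (i + 1, 1::nat)) ` {1..N-1}) + card {(1::nat, 1::nat)}"
    by (intro card_Un_disjoint) auto
  finally show ?thesis using N by (simp add: card_image inj_on_def)
qed

text \<open>\<open>J\<close> is defined as three families so that its image is the set
  \<open>B\<close> as written. Here it is matched with the first row and column, the entries that
  define \<open>I_set\<close>.\<close>

lemma J_iff: "(i, j) \<in> J \<longleftrightarrow> i \<in> {1..N} \<and> j \<in> {1..N} \<and> (i = 1 \<or> j = 1)"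
proof
  show "(i, j) \<in> J \<Longrightarrow> i \<in> {1..N} \<and> j \<in> {1..N} \<and> (i = 1 \<or> j = 1)" using N by (auto simp: J_def)
  assume "i \<in> {1..N} \<and> j \<in> {1..N} \<and> (i = 1 \<or> j = 1)"
  then consider "i = 1" "j = 1" | "i = 1" "j - 1 \<in> {1..N-1}" "j = (j - 1) + 1"
    | "j = 1" "i - 1 \<in> {1..N-1}" "i = (i - 1) + 1" by fastforce
  then show "(i, j) \<in> J" unfolding J_def by cases blast+
qed

lemma v_G_plus: "p \<in> J \<Longrightarrow> v p \<in> G_plus"
proof -
  assume p: "p \<in> J"
  obtain i j where ij: "p = (i, j)" by (cases p)
  have one: "1 \<in> {1..N}" using N by simp
  show ?thesis
    using p one by (auto simp: ij J_iff v_def aug_ideal_def counit u_closed \<epsilon>_one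
        clinear_minus[OF cvs_axioms cvs_complex_alg clinear_\<epsilon>] complex_alg_minus)
qed

lemma free_family_SU:
  assumes "q \<noteq> 1"
  shows "free_family A (ideal_calculus A \<Delta> S I_SU) J (\<lambda>p. N_sub I_SU +>\<^bsub>uc\<^esub> s (tens A A \<one> (v p)))"
proof (rule free_family_ideal_calculus[OF right_ideal_I_SU])
  \<comment> \<open>Transposed, because the generator with indices \<open>(i, j)\<close> is detected
    by the entry \<open>(j, i)\<close> of \<open>Q\<close>.\<close>
  let ?\<phi> = "\<lambda>(i, j) h. Q h j i"
  \<comment> \<open>The diagonal value is the (1,1) entry of
    \<open>Q(u\<^sup>1\<^sub>1) - 1\<close>, nonzero by \<open>c2q2\<close>. The other diagonal
    entries of that matrix are not among the functionals indexed by \<open>J\<close>.\<close>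
  let ?\<kappa> = "\<lambda>(i :: nat, j). if i = j then c\<^sup>2 * (of_real q)\<^sup>2 - 1 else c\<^sup>2 * \<nu>"
  have one: "1 \<in> {1..N}" using N by simp
  show "finite J" by (simp add: J_def)
  show "v p \<in> G_plus" if "p \<in> J" for p using that by (rule v_G_plus)
  show "clinear A complex_alg (?\<phi> p)" if "p \<in> J" for p
    using that by (cases p) (simp add: J_iff clinear_Q)
  show "?\<phi> p x = 0" if "p \<in> J" "x \<in> I_SU" for p x
    using that I_setD[of x] by (cases p) (simp only: J_iff I_SU_eq_I_set[OF assms] case_prod_conv, blast)
  show "?\<kappa> p \<noteq> 0" if "p \<in> J" for p
    using c_nonzero \<nu>_nonzero[OF assms] c2q2[OF assms] by (cases p) (auto simp del: of_real_diff)
  show "?\<phi> p (v p') = (if p = p' then ?\<kappa> p else 0)" if "p \<in> J" "p' \<in> J" for p p'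
  proof -
    obtain i j i' j' where ij: "p = (i, j)" "p' = (i', j')" by (cases p, cases p')
    have m: "i \<in> {1..N}" "j \<in> {1..N}" "i = 1 \<or> j = 1" "i' \<in> {1..N}" "j' \<in> {1..N}" "i' = 1 \<or> j' = 1"
      using that by (auto simp: ij J_iff)
    show ?thesis
    proof (cases "i' = j'")
      case True
      have "Q (u 1 1 \<ominus> \<one>) j i = Q (u 1 1) j i - of_bool (j = i)"
        using m one by (simp add: clinear_minus[OF cvs_axioms cvs_complex_alg clinear_Q] u_closed complex_alg_minus Q_one)
      also have "\<dots> = (if i = j then c\<^sup>2 * (of_real q)\<^sup>2 - 1 else 0)"
        using m one by (auto simp: Q_gen)
      finally show ?thesis using True m by (auto simp: ij v_def)
    next
      case False
      then show ?thesis using m by (auto simp: ij v_def Q_gen_offdiag)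
    qed
  qed
  show "h \<in> I_SU" if h: "h \<in> G_plus" "\<And>p. p \<in> J \<Longrightarrow> ?\<phi> p h = 0" for h
  proof -
    have "Q h k l = 0" if "k \<in> {1..N}" "l \<in> {1..N}" "k = 1 \<or> l = 1" for k l
      using h(2)[of "(l, k)"] that by (auto simp: J_iff)
    then show ?thesis using h(1) by (simp add: I_SU_eq_I_set[OF assms] I_set_def)
  qed
qed

lemma one_neq_zero: "\<one> \<noteq> \<zero>"
  using \<epsilon>_one clinear_zero[OF cvs_axioms cvs_complex_alg clinear_\<epsilon>] by auto

theorem SU_calculus:
  fixes \<Omega> \<Lambda> W form B V\<^sub>D
  defines "\<Omega> \<equiv> ideal_calculus A \<Delta> S K" and "\<Lambda> \<equiv> inv_forms A \<epsilon> K"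
  defines "V\<^sub>D \<equiv> cspan \<Lambda> {K +> u i j | i j. i \<in> {2..N} \<and> j \<in> {2..N} \<and> i \<noteq> j}
              <+>\<^bsub>\<Lambda>\<^esub> cspan \<Lambda> {K +> (u i 1 \<otimes> S (u 1 i)) | i. i \<in> {2..N}}"
  defines "W \<equiv> s_quot A \<Delta> S K ` tensor_sub A \<Lambda> (carrier A) V\<^sub>D"
  defines "form \<equiv> (\<lambda>x. W +>\<^bsub>\<Omega>\<^esub> s_quot A \<Delta> S K (tens A \<Lambda> \<one> (K +> x)))"
  defines "B \<equiv> (\<lambda>i. form (u (i + 1) 1)) ` {1..N-1} \<union> {form (u 1 1 \<ominus> \<one>)} \<union> (\<lambda>i. form (u 1 (i + 1))) ` {1..N-1}"
  shows "subbimodule A \<Omega> W" "first_order_calculus A (quotient_calculus \<Omega> W)"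
    "calculus_isomorphic A (ideal_calculus A \<Delta> S I_SU) (quotient_calculus \<Omega> W)"
    "q \<noteq> 1 \<Longrightarrow> left_module_basis A (quotient_calculus \<Omega> W) B \<and> card B = 2 * N - 1"
proof -
  have "{K +> u i j | i j. i \<in> {2..N} \<and> j \<in> {2..N} \<and> i \<noteq> j} = (\<lambda>x. K +> x) ` D2_gens"
    unfolding D2_gens_def by blast
  moreover have "{K +> (u i 1 \<otimes> S (u 1 i)) | i. i \<in> {2..N}} = (\<lambda>x. K +> x) ` D1_gens"
    unfolding D1_gens_def by blast
  \<comment> \<open>\<open>V\<^sub>D\<close> is the space of residues of \<open>I_SU\<close> modulo
    \<open>K\<close>, which brings \<open>W\<close> into the form required by
    \<open>quotient_of_ideal_calculus\<close>.\<close>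
  ultimately have "V\<^sub>D = (\<lambda>x. K +> x) ` I_SU"
    unfolding V\<^sub>D_def \<Lambda>_def I_SU_def
    by (simp only: inv_forms_image[OF right_ideal_K D1_gens_G_plus D2_gens_G_plus])
  then have W: "W = s_quot A \<Delta> S K ` tensor_sub A (inv_forms A \<epsilon> K) (carrier A) ((\<lambda>x. K +> x) ` I_SU)"
    by (simp add: W_def \<Lambda>_def)
  note quot = quotient_of_ideal_calculus[OF right_ideal_K right_ideal_I_SU K_subset_I_SU, folded W \<Omega>_def \<Lambda>_def]
  show "subbimodule A \<Omega> W" by (rule quot(1))
  show "first_order_calculus A (quotient_calculus \<Omega> W)"
    by (intro calculus_imp_first_order_calculus quot(2))
  obtain \<phi> where \<phi>: "calculus_iso A (ideal_calculus A \<Delta> S I_SU) (quotient_calculus \<Omega> W) \<phi>"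
      "\<And>x. x \<in> G_plus \<Longrightarrow> \<phi> (N_sub I_SU +>\<^bsub>uc\<^esub> s (tens A A \<one> x)) = form x"
    using quot(3) unfolding form_def by blast
  show "calculus_isomorphic A (ideal_calculus A \<Delta> S I_SU) (quotient_calculus \<Omega> W)"
    by (rule calculus_isomorphicI[OF \<phi>(1)])
  assume q1: "q \<noteq> 1"
  interpret Q: calculus A "quotient_calculus \<Omega> W" by (rule quot(2))
  have "calculus A (ideal_calculus A \<Delta> S I_SU)"
    unfolding ideal_calculus_def
    by (intro subcalculus.calculus_quotient subcalculusI calculus_universal subbimodule_s_sub right_ideal_I_SU)
  \<comment> \<open>Freeness is known for the calculus of \<open>I_SU\<close>; the isomorphism
    carries the class of \<open>1 \<otimes> v p\<close> to \<open>form (v p)\<close>.\<close>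
  from free_family_iso[OF this quot(2) \<phi>(1) free_family_SU[OF q1]]
  have "free_family A (quotient_calculus \<Omega> W) J (\<lambda>p. form (v p))"
    by (rule Q.free_family_cong) (simp add: \<phi>(2) v_G_plus)
  note Q.free_family_basis[OF this one_neq_zero]
  moreover have "(\<lambda>p. form (v p)) ` J = B"
    unfolding J_def B_def image_Un image_image by (auto simp: v_def intro!: arg_cong2[of _ _ _ _ "(\<union>)"] image_cong)
  ultimately show "left_module_basis A (quotient_calculus \<Omega> W) B \<and> card B = 2 * N - 1"
    by (simp add: card_J)
qed

end

section \<open>Generators of the quantum group\<close>

lemma monoid_alg_sum_closed:
  "(\<And>i. i \<in> X \<Longrightarrow> f i \<in> carrier (monoid_alg M)) \<Longrightarrow> sum f X \<in> carrier (monoid_alg M)"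
  using keys_sum[of f X] by fastforce

lemma monoid_alg_diff_closed:
  "f \<in> carrier (monoid_alg M) \<Longrightarrow> g \<in> carrier (monoid_alg M) \<Longrightarrow> f - g \<in> carrier (monoid_alg M)"
  using keys_diff[of f g] by auto

abbreviation "word_monoid N \<equiv> \<lparr>carrier = lists ({1..N} \<times> {1..N}), mult = (@), one = []\<rparr>"

lemma monoid_words: "monoid (word_monoid N :: (nat \<times> nat) list monoid)"
  by (rule monoidI) auto

lemma calg_free_alg: "calg (free_alg N)"
  unfolding free_alg_def by (intro calg_monoid_alg monoid_words)

lemma single_free_alg: "w \<in> lists ({1..N} \<times> {1..N}) \<Longrightarrow> Poly_Mapping.single w z \<in> carrier (free_alg N)"
  unfolding free_alg_def by simp

lemma M_relators_closed: "M_relators N q \<subseteq> carrier (free_alg N)"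
proof
  fix x assume "x \<in> M_relators N q"
  then show "x \<in> carrier (free_alg N)"
    unfolding M_relators_def free_alg_def
    by (auto intro!: monoid_alg_diff_closed monoid_alg_sum_closed simp del: monoid_alg_simps(1))
      (auto split: if_splits)
qed

lemma quotient_CqM: "quotient_calg (free_alg N) (Idl\<^bsub>free_alg N\<^esub> (M_relators N q))"
proof -
  interpret F: calg "free_alg N" by (rule calg_free_alg)
  show ?thesis by (intro quotient_calgI calg_free_alg F.genideal_ideal M_relators_closed)
qed

lemma calg_CqM: "calg (CqM N q)"
  unfolding CqM_def by (rule quotient_calg.calg_quotient[OF quotient_CqM])

lemma M_gen_closed:
  assumes "i \<in> {1..N}" "j \<in> {1..N}"
  shows "M_gen N q i j \<in> carrier (CqM N q)"
proof -
  interpret M: quotient_calg "free_alg N" "Idl\<^bsub>free_alg N\<^esub> (M_relators N q)" by (rule quotient_CqM)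
  show ?thesis
    unfolding M_gen_def CqM_def using assms by (intro M.coset_closed single_free_alg) auto
qed

text \<open>Permutations keep the lower indices in range. With the determinant in the carrier,
  \<open>det_ideal\<close> is a genuine two-sided ideal.\<close>

lemma q_det_closed: "q_det N q \<in> carrier (CqM N q)"
proof -
  interpret M: calg "CqM N q" by (rule calg_CqM)
  have foldr: "foldr (\<lambda>i x. M_gen N q i (\<pi> i) \<otimes>\<^bsub>CqM N q\<^esub> x) is \<one>\<^bsub>CqM N q\<^esub> \<in> carrier (CqM N q)"
    if "set is \<subseteq> {1..N}" "\<pi> permutes {1..N}" for \<pi> "is"
    using that
  proof (induction "is")
    case (Cons i "is")
    then show ?case using M_gen_closed permutes_in_image[OF that(2), of i] by simp
  qed simp
  show ?thesis
    unfolding q_det_def by (intro M.finsum_closed Pi_I M.smult_closed foldr) auto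
qed

lemma quotient_CqSU: "quotient_calg (CqM N q) (det_ideal N q)"
proof -
  interpret M: calg "CqM N q" by (rule calg_CqM)
  show ?thesis
    unfolding det_ideal_def
    by (intro quotient_calgI calg_CqM M.genideal_ideal) (simp add: q_det_closed)
qed

lemma SU_gen_closed:
  assumes "i \<in> {1..N}" "j \<in> {1..N}"
  shows "SU_gen N q i j \<in> carrier (CqSU N q)"
proof -
  interpret D: quotient_calg "CqM N q" "det_ideal N q" by (rule quotient_CqSU)
  show ?thesis
    unfolding SU_gen_def CqSU_def by (intro D.coset_closed M_gen_closed assms)
qed

text \<open>The composite of the two quotient maps from the free algebra is linear, multiplicative
  and surjective. By induction on words, adding letters on the left, the preimage of
  \<open>U\<close> contains every word, and words span the free algebra.\<close>

lemma CqSU_generated: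
  assumes U: "submodule U complex_alg (CqSU N q)" and one: "\<one>\<^bsub>CqSU N q\<^esub> \<in> U"
    and gen: "\<And>i j x. \<lbrakk>i \<in> {1..N}; j \<in> {1..N}; x \<in> U\<rbrakk> \<Longrightarrow> SU_gen N q i j \<otimes>\<^bsub>CqSU N q\<^esub> x \<in> U"
  shows "carrier (CqSU N q) \<subseteq> U"
proof -
  let ?F = "free_alg N"
  interpret M: quotient_calg ?F "Idl\<^bsub>?F\<^esub> (M_relators N q)" by (rule quotient_CqM)
  interpret D: quotient_calg "CqM N q" "det_ideal N q" by (rule quotient_CqSU)
  let ?m = "\<lambda>f. Idl\<^bsub>?F\<^esub> (M_relators N q) +>\<^bsub>?F\<^esub> f"
  let ?p = "\<lambda>f. det_ideal N q +>\<^bsub>CqM N q\<^esub> ?m f"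
  have m: "clinear ?F (CqM N q) ?m" unfolding CqM_def by (rule M.clinear_coset)
  have d: "clinear (CqM N q) (CqSU N q) (\<lambda>x. det_ideal N q +>\<^bsub>CqM N q\<^esub> x)"
    unfolding CqSU_def by (rule D.clinear_coset)
  have p: "clinear ?F (CqSU N q) ?p" by (rule clinear_comp[OF m d])
  have F: "cvs ?F" and SU: "cvs (CqSU N q)"
    using D.calg_quotient by (auto simp: calg_def M.cvs_axioms CqSU_def)
  have surj: "carrier (CqSU N q) \<subseteq> ?p ` carrier ?F"
  proof
    fix x assume "x \<in> carrier (CqSU N q)"
    then obtain y where y: "y \<in> carrier (CqM N q)" "x = det_ideal N q +>\<^bsub>CqM N q\<^esub> y"
      unfolding CqSU_def by (rule D.coset_cases)
    then obtain f where "f \<in> carrier ?F" "y = ?m f" unfolding CqM_def by (auto elim: M.coset_cases)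
    then show "x \<in> ?p ` carrier ?F" using y by blast
  qed
  have p_mult: "?p (f \<otimes>\<^bsub>?F\<^esub> g) = ?p f \<otimes>\<^bsub>CqSU N q\<^esub> ?p g" if "f \<in> carrier ?F" "g \<in> carrier ?F" for f g
  proof -
    have "?m (f \<otimes>\<^bsub>?F\<^esub> g) = ?m f \<otimes>\<^bsub>CqM N q\<^esub> ?m g" unfolding CqM_def by (rule M.coset_mult[OF that])
    then show ?thesis
      unfolding CqSU_def using clinear_closed[OF m that(1)] clinear_closed[OF m that(2)]
      by (simp add: D.coset_mult)
  qed
  have word: "?p (Poly_Mapping.single w 1) \<in> U" if "w \<in> lists ({1..N} \<times> {1..N})" for w
    using that
  proof (induction w)
    case Nil
    have "?p (Poly_Mapping.single [] 1) = \<one>\<^bsub>CqSU N q\<^esub>"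
      unfolding CqSU_def D.coset_one by (simp add: CqM_def M.coset_one) (simp add: free_alg_def)
    then show ?case using one by simp
  next
    case (Cons a w)
    obtain i j where a: "a = (i, j)" "i \<in> {1..N}" "j \<in> {1..N}" using Cons by (cases a) auto
    have "Poly_Mapping.single (a # w) 1 = Poly_Mapping.single [a] 1 \<otimes>\<^bsub>?F\<^esub> Poly_Mapping.single w (1 :: complex)"
      unfolding free_alg_def using a Cons monoid_alg_mult_single[OF monoid_words, of "[a]" N w 1 1] by simp
    then have "?p (Poly_Mapping.single (a # w) 1) = ?p (Poly_Mapping.single [a] 1) \<otimes>\<^bsub>CqSU N q\<^esub> ?p (Poly_Mapping.single w 1)"
      using a Cons by (simp only: p_mult single_free_alg lists.intros mem_Sigma_iff)
    also have "?p (Poly_Mapping.single [a] 1) = SU_gen N q i j" by (simp add: SU_gen_def M_gen_def a)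
    finally show ?case using gen[OF a(2,3)] Cons by simp
  qed
  have "carrier ?F = cspan ?F {Poly_Mapping.single w 1 | w. w \<in> lists ({1..N} \<times> {1..N})}"
    using cspan_monoid_alg[of "word_monoid N"] unfolding free_alg_def by simp
  also have "\<dots> \<subseteq> {f \<in> carrier ?F. ?p f \<in> U}"
    using word by (intro cspan_least submodule_vimage[OF F SU p U]) (auto intro!: single_free_alg)
  finally show ?thesis using surj by blast
qed


text \<open>The basis claim carries the condition \<open>q \<noteq> 1\<close>: at
  \<open>q = 1\<close> every off-diagonal generator is sent to zero by \<open>Q\<close>, so its
  class in the invariant forms vanishes and cannot belong to a basis.\<close>

theorem corollary4p4:
  fixes N :: nat and q :: real and q_root :: complex and \<Delta> \<epsilon> S r
  assumes N: "N \<ge> 2"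
    and q: "0 < q" "q \<le> 1"
    and q_root: "q_root ^ N = of_real q"
    and hopf: "hopf_algebra (CqSU N q) \<Delta> \<epsilon> S"
    and comult: "\<And>i j. i \<in> {1..N} \<Longrightarrow> j \<in> {1..N} \<Longrightarrow>
      \<Delta> (SU_gen N q i j) = (\<Oplus>\<^bsub>tensor (CqSU N q) (CqSU N q)\<^esub>k\<in>{1..N}.
        tens (CqSU N q) (CqSU N q) (SU_gen N q i k) (SU_gen N q k j))"
    and counit: "\<And>i j. i \<in> {1..N} \<Longrightarrow> j \<in> {1..N} \<Longrightarrow> \<epsilon> (SU_gen N q i j) = of_bool (i = j)"
    and coquasi: "coquasitriangular (CqSU N q) \<Delta> \<epsilon> r"
    and r_gen: "\<And>i j k l. i \<in> {1..N} \<Longrightarrow> j \<in> {1..N} \<Longrightarrow> k \<in> {1..N} \<Longrightarrow> l \<in> {1..N} \<Longrightarrow>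
      r (SU_gen N q i j) (SU_gen N q k l) = inverse q_root * of_real (R_matrix q k i j l)"
  shows
    "let G = CqSU N q;
         u = SU_gen N q;
         K = kerQ_plus N q \<Delta> \<epsilon> r;
         \<Omega>bc = ideal_calculus G \<Delta> S K;
         \<Lambda> = inv_forms G \<epsilon> K;
         V\<^sub>D = cspan \<Lambda> {K +>\<^bsub>G\<^esub> u i j | i j. i \<in> {2..N} \<and> j \<in> {2..N} \<and> i \<noteq> j}
              <+>\<^bsub>\<Lambda>\<^esub> cspan \<Lambda> {K +>\<^bsub>G\<^esub> (u i 1 \<otimes>\<^bsub>G\<^esub> S (u 1 i)) | i. i \<in> {2..N}};
         W = s_quot G \<Delta> S K ` tensor_sub G \<Lambda> (carrier G) V\<^sub>D;
         \<Omega>q = quotient_calculus \<Omega>bc W;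
         D\<^sub>1 = cspan G {u i 1 \<otimes>\<^bsub>G\<^esub> S (u 1 i) | i. i \<in> {2..N}};
         D\<^sub>2 = cspan G {u i j | i j. i \<in> {2..N} \<and> j \<in> {2..N} \<and> i \<noteq> j};
         I = K <+>\<^bsub>G\<^esub> D\<^sub>1 <+>\<^bsub>G\<^esub> D\<^sub>2;
         form = (\<lambda>v. W +>\<^bsub>\<Omega>bc\<^esub> s_quot G \<Delta> S K (tens G \<Lambda> \<one>\<^bsub>G\<^esub> (K +>\<^bsub>G\<^esub> v)));
         B = (\<lambda>i. form (u (i + 1) 1)) ` {1..N-1}
             \<union> {form (u 1 1 \<ominus>\<^bsub>G\<^esub> \<one>\<^bsub>G\<^esub>)}
             \<union> (\<lambda>i. form (u 1 (i + 1))) ` {1..N-1}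
     in subbimodule G \<Omega>bc W
        \<and> first_order_calculus G \<Omega>q
        \<and> right_ideal_in G (aug_ideal G \<epsilon>) I
        \<and> calculus_isomorphic G (ideal_calculus G \<Delta> S I) \<Omega>q
        \<and> (q \<noteq> 1 \<longrightarrow> left_module_basis G \<Omega>q B \<and> card B = 2 * N - 1)"
proof -
  interpret H: hopf "CqSU N q" \<Delta> \<epsilon> S
    using hopf by (simp add: hopf_def hopf_axioms_def calg_tensor_square_def calg_iff_complex_algebra hopf_algebra_def)
  interpret SU: quantum_killing "CqSU N q" \<Delta> \<epsilon> S N q q_root r "SU_gen N q"
    by unfold_locales (use N q q_root comult counit coquasi r_gen SU_gen_closed CqSU_generated in auto)
  have K: "kerQ_plus N q \<Delta> \<epsilon> r = SU.K"
    unfolding kerQ_plus_def by (rule SU.kerQ)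
  show ?thesis
    unfolding Let_def K
    using SU.SU_calculus SU.right_ideal_I_SU[unfolded SU.I_SU_def SU.D1_gens_def SU.D2_gens_def]
    unfolding SU.I_SU_def SU.D1_gens_def SU.D2_gens_def by blast
qed

end
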